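(* Assume that $\operatorname{pos}(\operatorname{dom}\varphi-(0,\bar u))$ is linear and strongly closed, and that the following two conditions hold: (1) $\operatorname{pos}(\operatorname{dom}_uEf-\bar u)$ is linear and strongly closed; (2) for every $t=0,\dots,T$ and every $z\in\mathcal X$ with $(z,\bar u)\in\operatorname{dom}Ef$, there exists $\bar z\in\mathcal X$ with $(\bar z,\bar u)\in\operatorname{dom}Ef$ and $\bar z^t=E_tz^t$. Then \[ \inf(SP)=\inf(SP_{\mathcal X})=\sup(D) \] and the optimum in the dual problem $(D)$ is attained. Moreover, a primal feasible $x$ solves $(SP)$ if and only if there exists a dual feasible $(p,y)$ with $(p,y)\in\partial f(x,\bar u)$ almost surely.
   Context: $(\Omega,\mathcal F,P)$ is a probability space with a filtration $(\mathcal F_t)_{t=0}^T$; $E_t$ is the conditional expectation given $\mathcal F_t$. $\mathcal N$ is the linear space of all processes $x=(x_t)_{t=0}^T$ with $x_t$ $\mathbb R^{n_t}$-valued and $\mathcal F_t$-measurable; $n=n_0+\dots+n_T$; $x^t:=(x_0,\dots,x_t)$. $f:\mathbb R^n\times\mathbb R^m\times\Omega\to\overline{\mathbb R}$ is a convex normal integrand: $f(\cdot,\omega)$ is a closed convex function for every $\omega$ and $\omega\mapsto\operatorname{epi}f(\cdot,\omega)$ is a measurable set-valued mapping. $Ef(x,u):=\int f(x(\omega),u(\omega),\omega)\,dP(\omega)$, where the integral of an extended real-valued random variable is $+\infty$ unless its positive part is integrable. $f^*(\cdot,\omega)$ is the convex conjugate of $f(\cdot,\omega)$, $Ef^*$ is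 defined analogously, and $\partial f$ is the scenario-wise convex subdifferential in $(x,u)$. $\mathcal X,\mathcal V\subset L^0(\Omega,\mathcal F,P;\mathbb R^n)$ and $\mathcal U,\mathcal Y\subset L^0(\Omega,\mathcal F,P;\mathbb R^m)$ are linear spaces; $\mathcal X$ and $\mathcal V$ are in separating duality under $\langle x,v\rangle=E[x\cdot v]$ and $\mathcal U$ and $\mathcal Y$ under $\langle u,y\rangle=E[u\cdot y]$. All four spaces are decomposable ($1_Ax+1_{\Omega\setminus A}x'$ belongs to the space for every $x$ in the space, $x'\in L^\infty$, $A\in\mathcal F$) and solid (if $\bar x$ is in the space and $x\in L^0$ has $|x^i|\le|\bar x^i|$ a.s. for every component $i$, then $x$ is in the space). $\mathcal X$ and $\mathcal U$ are endowed with "strong" topologies, at least as strong as the Mackey topologies $\tau(\mathcal X,\mathcal V)$, $\tau(\mathcal U,\mathcal Y)$, under which they are Fréchet spaces and their topological duals are $\mathcal X^*=\mathcal V\oplus\mathcal V^s$, $\mathcal U^*=\mathcal Y\oplus\mathcal Y^s$: each $y\in\mathcal U^*$ is uniquely of the form $\langle u,y\rangle=E[u\cdot y^c]+\langle u,y^s\rangle$ with $y^c\in\mathcal Y$, $y^s\in\mathcal Y^s$, and similarly for $\mathcal X^*$. Here $\mathcal Y^s$ is the set of singular elements: those $y\in\mathcal U^*$ such that for every $u\in\mathcal U$ there is a decreasing sequence $(A^\nu)\subset\mathcal F$ with $P(A^\nu)\searrow0$ and $\langle1_{\Omega\setminus A^\nu}u,y\rangle=0$ for all $\nu$; similarly for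 $\mathcal V^s$. Assume $E_t\mathcal X\subseteq\mathcal X$ for all $t$. $\bar u\in\mathcal U$ is fixed, $\mathcal X_a:=\mathcal X\cap\mathcal N$, $\mathcal X_a^\perp:=\{p\in\mathcal V\mid E[x\cdot p]=0\ \forall x\in\mathcal X_a\}$. $\operatorname{dom}Ef=\{(x,u)\in\mathcal X\times\mathcal U\mid Ef(x,u)<\infty\}$, $\operatorname{dom}_uEf$ is its projection to $\mathcal U$, and $\operatorname{pos}C=\bigcup_{\lambda>0}\lambda C$. The optimum value function on $\mathcal X\times\mathcal U$ is $\varphi(z,u):=\inf_{x\in\mathcal X}\{Ef(x,u)\mid x-z\in\mathcal N\}$, and $\operatorname{dom}\varphi=\{(z,u)\mid\varphi(z,u)<\infty\}$. "Linear" means being a linear subspace; "strongly closed" means closed in the strong topology. Problems: $(SP)$: minimize $Ef(x,\bar u)$ over $x\in\mathcal N$. $(SP_{\mathcal X})$: minimize $Ef(x,\bar u)$ over $x\in\mathcal X_a$ (its optimum value is $\varphi(0,\bar u)$). $(D)$: maximize $\langle\bar u,y\rangle-Ef^*(p,y)$ over $(p,y)\in\mathcal X_a^\perp\times\mathcal Y$. Primal feasible: $x\in\mathcal N$ with $Ef(x,\bar u)<\infty$. Dual feasible: $(p,y)\in\mathcal X_a^\perp\times\mathcal Y$ with $Ef^*(p,y)<\infty$.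
   Formalization: In the last claim, "x solves (SP)" is read as attaining an optimum value other than −∞; with value −∞ the equivalence fails, e.g. f(x,u,ω)=η(ω), η≤0 real-valued, Eη=−∞, where every x attains −∞ but no dual feasible point exists. *)

theory Defs
  imports "HOL-Probability.Probability" "HOL-Library.Function_Algebras"
begin

section \<open>Functions as a real vector space\<close>

instantiation "fun" :: (type, scaleR) scaleR
begin
definition scaleR_fun_def: "c *\<^sub>R f = (\<lambda>x. c *\<^sub>R f x)"
instance ..
end

instance "fun" :: (type, real_vector) real_vector
  by standard (auto simp: scaleR_fun_def plus_fun_def scaleR_add_right scaleR_add_left)


section \<open>Extended real-valued convex analysis\<close>

definition epi :: "('a \<Rightarrow> ereal) \<Rightarrow> ('a \<times> real) set" where
  "epi g = {(x, \<alpha>). g x \<le> ereal \<alpha>}"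

text \<open>Closedness is closedness of the epigraph. Improper functions with closed epigraph are not
  excluded.\<close>

definition convex_normal_integrand ::
    "'w measure \<Rightarrow> ('w \<Rightarrow> 'a::euclidean_space \<Rightarrow> ereal) \<Rightarrow> bool" where
  "convex_normal_integrand M f \<longleftrightarrow>
     (\<forall>\<omega>\<in>space M. closed (epi (f \<omega>)) \<and> convex (epi (f \<omega>))) \<and>
     (\<forall>W. open W \<longrightarrow> {\<omega>\<in>space M. epi (f \<omega>) \<inter> W \<noteq> {}} \<in> sets M)"

definition conjugate :: "('a::real_inner \<Rightarrow> ereal) \<Rightarrow> 'a \<Rightarrow> ereal" where
  "conjugate g v = (SUP x. ereal (x \<bullet> v) - g x)"

definition subdifferential :: "('a::real_inner \<Rightarrow> ereal) \<Rightarrow> 'a \<Rightarrow> 'a set" where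
  "subdifferential g x = {v. \<forall>x'. g x + ereal ((x' - x) \<bullet> v) \<le> g x'}"

text \<open>\<^const>\<open>e2ennreal\<close> maps negative numbers to 0, so the two integrals are those of the positive
  and of the negative part.\<close>

definition ext_integral :: "'w measure \<Rightarrow> ('w \<Rightarrow> ereal) \<Rightarrow> ereal" where
  "ext_integral M g =
     (if (\<integral>\<^sup>+\<omega>. e2ennreal (g \<omega>) \<partial>M) = \<infinity> then \<infinity>
      else enn2ereal (\<integral>\<^sup>+\<omega>. e2ennreal (g \<omega>) \<partial>M) - enn2ereal (\<integral>\<^sup>+\<omega>. e2ennreal (- g \<omega>) \<partial>M))"

definition integral_functional ::
    "'w measure \<Rightarrow> ('w \<Rightarrow> 'a \<times> 'b \<Rightarrow> ereal) \<Rightarrow> ('w \<Rightarrow> 'a) \<Rightarrow> ('w \<Rightarrow> 'b) \<Rightarrow> ereal" where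
  "integral_functional M f x u = ext_integral M (\<lambda>\<omega>. f \<omega> (x \<omega>, u \<omega>))"

definition pos :: "'a::real_vector set \<Rightarrow> 'a set" where
  "pos C = (\<Union>r\<in>{0<..}. (\<lambda>c. r *\<^sub>R c) ` C)"


section \<open>Spaces of random variables\<close>

text \<open>Elements of \<open>L\<^sup>0\<close> are represented by measurable functions. Solid sets of such functions are
  closed under almost sure equality, hence correspond to sets of equivalence classes.\<close>

definition pairing ::
    "'w measure \<Rightarrow> ('w \<Rightarrow> 'a::euclidean_space) \<Rightarrow> ('w \<Rightarrow> 'a) \<Rightarrow> real" where
  "pairing M x v = (\<integral>\<omega>. x \<omega> \<bullet> v \<omega> \<partial>M)"

definition separating_duality ::
    "'w measure \<Rightarrow> ('w \<Rightarrow> 'a::euclidean_space) set \<Rightarrow> ('w \<Rightarrow> 'a) set \<Rightarrow> bool" where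
  "separating_duality M X V \<longleftrightarrow>
     (\<forall>x\<in>X. \<forall>v\<in>V. integrable M (\<lambda>\<omega>. x \<omega> \<bullet> v \<omega>)) \<and>
     (\<forall>x\<in>X. (\<forall>v\<in>V. pairing M x v = 0) \<longrightarrow> (AE \<omega> in M. x \<omega> = 0)) \<and>
     (\<forall>v\<in>V. (\<forall>x\<in>X. pairing M x v = 0) \<longrightarrow> (AE \<omega> in M. v \<omega> = 0))"

definition Linfty :: "'w measure \<Rightarrow> ('w \<Rightarrow> 'a::euclidean_space) set" where
  "Linfty M = {x \<in> borel_measurable M. \<exists>C. AE \<omega> in M. norm (x \<omega>) \<le> C}"

definition decomposable :: "'w measure \<Rightarrow> ('w \<Rightarrow> 'a::euclidean_space) set \<Rightarrow> bool" where
  "decomposable M X \<longleftrightarrow>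
     (\<forall>x\<in>X. \<forall>x'\<in>Linfty M. \<forall>A\<in>sets M. (\<lambda>\<omega>. if \<omega> \<in> A then x \<omega> else x' \<omega>) \<in> X)"

definition solid :: "'w measure \<Rightarrow> ('w \<Rightarrow> real ^ 'k) set \<Rightarrow> bool" where
  "solid M X \<longleftrightarrow>
     (\<forall>xb\<in>X. \<forall>x\<in>borel_measurable M. (AE \<omega> in M. \<forall>i. \<bar>x \<omega> $ i\<bar> \<le> \<bar>xb \<omega> $ i\<bar>) \<longrightarrow> x \<in> X)"

definition random_variable_space :: "'w measure \<Rightarrow> ('w \<Rightarrow> real ^ 'k) set \<Rightarrow> bool" where
  "random_variable_space M X \<longleftrightarrow>
     X \<subseteq> borel_measurable M \<and> subspace X \<and> decomposable M X \<and> solid M X"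


section \<open>Topologies on spaces of random variables\<close>

text \<open>Topologies live on sets of representatives; they are the preimages of topologies on spaces
  of equivalence classes, so that closedness and continuity agree with the notions for
  equivalence classes.\<close>

definition seminorm_on :: "'a::real_vector set \<Rightarrow> ('a \<Rightarrow> real) \<Rightarrow> bool" where
  "seminorm_on X \<rho> \<longleftrightarrow>
     (\<forall>x\<in>X. 0 \<le> \<rho> x) \<and> (\<forall>x\<in>X. \<forall>c. \<rho> (c *\<^sub>R x) = \<bar>c\<bar> * \<rho> x) \<and>
     (\<forall>x\<in>X. \<forall>x'\<in>X. \<rho> (x + x') \<le> \<rho> x + \<rho> x')"

text \<open>A Frechet topology is given by a countable separating family of seminorms for which the space
  is complete; here points are separated up to almost sure equality.\<close>

definition frechet ::
    "'w measure \<Rightarrow> ('w \<Rightarrow> 'a::euclidean_space) set \<Rightarrow> ('w \<Rightarrow> 'a) topology \<Rightarrow> bool" where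
  "frechet M X TX \<longleftrightarrow>
     (\<exists>\<rho> :: nat \<Rightarrow> ('w \<Rightarrow> 'a) \<Rightarrow> real.
        (\<forall>k. seminorm_on X (\<rho> k)) \<and>
        (\<forall>x\<in>X. (\<forall>k. \<rho> k x = 0) \<longleftrightarrow> (AE \<omega> in M. x \<omega> = 0)) \<and>
        TX = topology_generated_by
               {{x'\<in>X. \<rho> k (x' - x) < \<epsilon>} | k x \<epsilon>. x \<in> X \<and> 0 < \<epsilon>} \<and>
        (\<forall>s :: nat \<Rightarrow> 'w \<Rightarrow> 'a. range s \<subseteq> X \<and>
            (\<forall>k. \<forall>\<epsilon>>0. \<exists>n0. \<forall>i\<ge>n0. \<forall>j\<ge>n0. \<rho> k (s i - s j) < \<epsilon>) \<longrightarrow>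
            (\<exists>x\<in>X. \<forall>k. (\<lambda>i. \<rho> k (s i - x)) \<longlonglongrightarrow> 0)))"

text \<open>The topology \<open>\<sigma>(V,X)\<close> on \<open>V\<close>.\<close>

definition weak_topology ::
    "'w measure \<Rightarrow> ('w \<Rightarrow> 'a::euclidean_space) set \<Rightarrow> ('w \<Rightarrow> 'a) set \<Rightarrow> ('w \<Rightarrow> 'a) topology" where
  "weak_topology M V X =
     topology_generated_by {{v\<in>V. pairing M x v \<in> W} | x W. x \<in> X \<and> open W}"

text \<open>The Mackey topology \<open>\<tau>(X,V)\<close>: uniform convergence on the \<open>\<sigma>(V,X)\<close>-compact absolutely convex
  subsets of \<open>V\<close>. By compactness of \<open>K\<close>, the generating sets are the open balls of the seminorms
  \<open>x \<mapsto> sup {\<bar>\<langle>x,v\<rangle>\<bar> | v \<in> K}\<close>.\<close>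

definition mackey_topology ::
    "'w measure \<Rightarrow> ('w \<Rightarrow> 'a::euclidean_space) set \<Rightarrow> ('w \<Rightarrow> 'a) set \<Rightarrow> ('w \<Rightarrow> 'a) topology" where
  "mackey_topology M X V =
     topology_generated_by
       {{x'\<in>X. \<forall>v\<in>K. \<bar>pairing M (x' - x) v\<bar> < \<epsilon>} | x K \<epsilon>.
          x \<in> X \<and> 0 < \<epsilon> \<and> compactin (weak_topology M V X) K \<and> convex K \<and> (\<forall>v\<in>K. - v \<in> K)}"

text \<open>Functionals are total functions; only their values on \<open>X\<close> are meaningful.\<close>

definition topological_dual :: "'a::real_vector set \<Rightarrow> 'a topology \<Rightarrow> ('a \<Rightarrow> real) set" where
  "topological_dual X TX =
     {l. (\<forall>x\<in>X. \<forall>x'\<in>X. \<forall>a b. l (a *\<^sub>R x + b *\<^sub>R x') = a * l x + b * l x') \<and>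
         continuous_map TX euclideanreal l}"

definition singular_functionals ::
    "'w measure \<Rightarrow> ('w \<Rightarrow> 'a::euclidean_space) set \<Rightarrow> ('w \<Rightarrow> 'a) topology \<Rightarrow> (('w \<Rightarrow> 'a) \<Rightarrow> real) set"
  where
  "singular_functionals M X TX =
     {l \<in> topological_dual X TX. \<forall>x\<in>X. \<exists>A :: nat \<Rightarrow> 'w set.
        range A \<subseteq> sets M \<and> decseq A \<and> (\<lambda>\<nu>. measure M (A \<nu>)) \<longlonglongrightarrow> 0 \<and>
        (\<forall>\<nu>. l (\<lambda>\<omega>. if \<omega> \<in> A \<nu> then 0 else x \<omega>) = 0)}"

text \<open>The dual of \<open>X\<close> is the direct sum of \<open>V\<close> and the singular functionals.\<close>

definition dual_is_direct_sum ::
    "'w measure \<Rightarrow> ('w \<Rightarrow> 'a::euclidean_space) set \<Rightarrow> ('w \<Rightarrow> 'a) set \<Rightarrow> ('w \<Rightarrow> 'a) topology \<Rightarrow> bool" where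
  "dual_is_direct_sum M X V TX \<longleftrightarrow>
     (\<forall>v\<in>V. (\<lambda>x. pairing M x v) \<in> topological_dual X TX) \<and>
     (\<forall>l\<in>topological_dual X TX. \<exists>v\<in>V. \<exists>s\<in>singular_functionals M X TX.
        (\<forall>x\<in>X. l x = pairing M x v + s x) \<and>
        (\<forall>v'\<in>V. \<forall>s'\<in>singular_functionals M X TX.
           (\<forall>x\<in>X. l x = pairing M x v' + s' x) \<longrightarrow>
           (AE \<omega> in M. v' \<omega> = v \<omega>) \<and> (\<forall>x\<in>X. s' x = s x)))"

definition strong_topology ::
    "'w measure \<Rightarrow> ('w \<Rightarrow> 'a::euclidean_space) set \<Rightarrow> ('w \<Rightarrow> 'a) set \<Rightarrow> ('w \<Rightarrow> 'a) topology \<Rightarrow> bool" where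
  "strong_topology M X V TX \<longleftrightarrow>
     frechet M X TX \<and>
     (\<forall>S. openin (mackey_topology M X V) S \<longrightarrow> openin TX S) \<and>
     dual_is_direct_sum M X V TX"


section \<open>The stochastic optimization problem and its dual\<close>

text \<open>A map \<open>stage\<close> from the coordinates of \<open>\<real>\<^sup>n\<close> to \<open>{0..T}\<close> encodes the splitting
  \<open>x = (x\<^sub>0,\<dots>,x\<^sub>T)\<close>: the block \<open>x\<^sub>t\<close> consists of the coordinates with \<open>stage i = t\<close>, so \<open>n\<^sub>t\<close> is their
  number, and \<open>x\<^sup>t\<close> consists of the coordinates with \<open>stage i \<le> t\<close>.\<close>

definition finite_filtration :: "'w measure \<Rightarrow> nat \<Rightarrow> (nat \<Rightarrow> 'w measure) \<Rightarrow> bool" where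
  "finite_filtration M T F \<longleftrightarrow>
     (\<forall>t\<le>T. subalgebra M (F t)) \<and> (\<forall>s t. s \<le> t \<and> t \<le> T \<longrightarrow> sets (F s) \<subseteq> sets (F t))"

definition cond_exp_vec ::
    "'w measure \<Rightarrow> 'w measure \<Rightarrow> ('w \<Rightarrow> real ^ 'n) \<Rightarrow> 'w \<Rightarrow> real ^ 'n" where
  "cond_exp_vec M G x = (\<lambda>\<omega>. \<chi> i. real_cond_exp M G (\<lambda>\<omega>'. x \<omega>' $ i) \<omega>)"

definition adapted :: "(nat \<Rightarrow> 'w measure) \<Rightarrow> ('n \<Rightarrow> nat) \<Rightarrow> ('w \<Rightarrow> real ^ 'n) set" where
  "adapted F stage = {x. \<forall>i. (\<lambda>\<omega>. x \<omega> $ i) \<in> borel_measurable (F (stage i))}"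

definition adapted_perp ::
    "'w measure \<Rightarrow> (nat \<Rightarrow> 'w measure) \<Rightarrow> ('n \<Rightarrow> nat) \<Rightarrow> ('w \<Rightarrow> real ^ 'n) set \<Rightarrow>
     ('w \<Rightarrow> real ^ 'n) set \<Rightarrow> ('w \<Rightarrow> real ^ 'n) set" where
  "adapted_perp M F stage X V = {p\<in>V. \<forall>x\<in>X \<inter> adapted F stage. pairing M x p = 0}"

definition dom_Ef ::
    "'w measure \<Rightarrow> ('w \<Rightarrow> 'a \<times> 'b \<Rightarrow> ereal) \<Rightarrow> ('w \<Rightarrow> 'a) set \<Rightarrow> ('w \<Rightarrow> 'b) set \<Rightarrow>
     (('w \<Rightarrow> 'a) \<times> ('w \<Rightarrow> 'b)) set" where
  "dom_Ef M f X U = {(x, u) \<in> X \<times> U. integral_functional M f x u < \<infinity>}"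

definition value_function ::
    "'w measure \<Rightarrow> (nat \<Rightarrow> 'w measure) \<Rightarrow> ('n \<Rightarrow> nat) \<Rightarrow> ('w \<Rightarrow> real ^ 'n) set \<Rightarrow>
     ('w \<Rightarrow> (real ^ 'n) \<times> 'b \<Rightarrow> ereal) \<Rightarrow> ('w \<Rightarrow> real ^ 'n) \<Rightarrow> ('w \<Rightarrow> 'b) \<Rightarrow> ereal" where
  "value_function M F stage X f z u =
     (INF x\<in>{x\<in>X. x - z \<in> adapted F stage}. integral_functional M f x u)"

definition dom_value_function ::
    "'w measure \<Rightarrow> (nat \<Rightarrow> 'w measure) \<Rightarrow> ('n \<Rightarrow> nat) \<Rightarrow> ('w \<Rightarrow> real ^ 'n) set \<Rightarrow> ('w \<Rightarrow> 'b) set \<Rightarrow>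
     ('w \<Rightarrow> (real ^ 'n) \<times> 'b \<Rightarrow> ereal) \<Rightarrow> (('w \<Rightarrow> real ^ 'n) \<times> ('w \<Rightarrow> 'b)) set" where
  "dom_value_function M F stage X U f =
     {(z, u) \<in> X \<times> U. value_function M F stage X f z u < \<infinity>}"

definition inf_SP ::
    "'w measure \<Rightarrow> (nat \<Rightarrow> 'w measure) \<Rightarrow> ('n \<Rightarrow> nat) \<Rightarrow> ('w \<Rightarrow> (real ^ 'n) \<times> 'b \<Rightarrow> ereal) \<Rightarrow>
     ('w \<Rightarrow> 'b) \<Rightarrow> ereal" where
  "inf_SP M F stage f ub = (INF x\<in>adapted F stage. integral_functional M f x ub)"

definition inf_SPX ::
    "'w measure \<Rightarrow> (nat \<Rightarrow> 'w measure) \<Rightarrow> ('n \<Rightarrow> nat) \<Rightarrow> ('w \<Rightarrow> real ^ 'n) set \<Rightarrow>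
     ('w \<Rightarrow> (real ^ 'n) \<times> 'b \<Rightarrow> ereal) \<Rightarrow> ('w \<Rightarrow> 'b) \<Rightarrow> ereal" where
  "inf_SPX M F stage X f ub = (INF x\<in>X \<inter> adapted F stage. integral_functional M f x ub)"

definition conj_functional ::
    "'w measure \<Rightarrow> ('w \<Rightarrow> 'a::euclidean_space \<times> 'b::euclidean_space \<Rightarrow> ereal) \<Rightarrow>
     ('w \<Rightarrow> 'a) \<Rightarrow> ('w \<Rightarrow> 'b) \<Rightarrow> ereal" where
  "conj_functional M f p y = integral_functional M (\<lambda>\<omega>. conjugate (f \<omega>)) p y"

definition dual_objective ::
    "'w measure \<Rightarrow> ('w \<Rightarrow> 'a::euclidean_space \<times> 'b::euclidean_space \<Rightarrow> ereal) \<Rightarrow> ('w \<Rightarrow> 'b) \<Rightarrow>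
     ('w \<Rightarrow> 'a) \<Rightarrow> ('w \<Rightarrow> 'b) \<Rightarrow> ereal" where
  "dual_objective M f ub p y = ereal (pairing M ub y) - conj_functional M f p y"

definition sup_D ::
    "'w measure \<Rightarrow> (nat \<Rightarrow> 'w measure) \<Rightarrow> ('n \<Rightarrow> nat) \<Rightarrow> ('w \<Rightarrow> real ^ 'n) set \<Rightarrow>
     ('w \<Rightarrow> real ^ 'n) set \<Rightarrow> ('w \<Rightarrow> 'b::euclidean_space) set \<Rightarrow>
     ('w \<Rightarrow> (real ^ 'n) \<times> 'b \<Rightarrow> ereal) \<Rightarrow> ('w \<Rightarrow> 'b) \<Rightarrow> ereal" where
  "sup_D M F stage X V Y f ub =
     (SUP (p, y)\<in>adapted_perp M F stage X V \<times> Y. dual_objective M f ub p y)"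

definition primal_feasible ::
    "'w measure \<Rightarrow> (nat \<Rightarrow> 'w measure) \<Rightarrow> ('n \<Rightarrow> nat) \<Rightarrow> ('w \<Rightarrow> (real ^ 'n) \<times> 'b \<Rightarrow> ereal) \<Rightarrow>
     ('w \<Rightarrow> 'b) \<Rightarrow> ('w \<Rightarrow> real ^ 'n) \<Rightarrow> bool" where
  "primal_feasible M F stage f ub x \<longleftrightarrow>
     x \<in> adapted F stage \<and> integral_functional M f x ub < \<infinity>"

definition solves_SP ::
    "'w measure \<Rightarrow> (nat \<Rightarrow> 'w measure) \<Rightarrow> ('n \<Rightarrow> nat) \<Rightarrow> ('w \<Rightarrow> (real ^ 'n) \<times> 'b \<Rightarrow> ereal) \<Rightarrow>
     ('w \<Rightarrow> 'b) \<Rightarrow> ('w \<Rightarrow> real ^ 'n) \<Rightarrow> bool" where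
  "solves_SP M F stage f ub x \<longleftrightarrow>
     x \<in> adapted F stage \<and> integral_functional M f x ub = inf_SP M F stage f ub"

definition dual_feasible ::
    "'w measure \<Rightarrow> (nat \<Rightarrow> 'w measure) \<Rightarrow> ('n \<Rightarrow> nat) \<Rightarrow> ('w \<Rightarrow> real ^ 'n) set \<Rightarrow>
     ('w \<Rightarrow> real ^ 'n) set \<Rightarrow> ('w \<Rightarrow> 'b::euclidean_space) set \<Rightarrow>
     ('w \<Rightarrow> (real ^ 'n) \<times> 'b \<Rightarrow> ereal) \<Rightarrow> ('w \<Rightarrow> real ^ 'n) \<Rightarrow> ('w \<Rightarrow> 'b) \<Rightarrow> bool" where
  "dual_feasible M F stage X V Y f p y \<longleftrightarrow>
     p \<in> adapted_perp M F stage X V \<and> y \<in> Y \<and> conj_functional M f p y < \<infinity>"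

end

theory Submission
  imports Defs
begin

text \<open>For fixed \<open>ub\<close>, the assumption on \<open>dom \<phi>\<close> and an open mapping argument bound \<open>\<phi>(\<cdot>, ub)\<close> from above
  near the origin of a closed subspace, so Hahn--Banach yields a continuous subgradient \<open>v + s\<close>, with
  \<open>v\<close> in \<open>V\<close> and \<open>s\<close> singular, that vanishes on adapted processes. Going backwards in time, the recourse
  condition allows replacing \<open>s\<close> by \<open>s \<circ> E\<^sub>t\<close>, which removes the singular part stage by stage and leaves
  some \<open>p\<close> in \<open>X\<^sub>a\<^sup>\<bottom>\<close>. The condition on \<open>dom\<^sub>u Ef\<close> gives in the same way a subgradient in \<open>u\<close>, whose
  singular part may be dropped at once. Interchanging infimum and integral turns the resulting
  inequality into a dual bound, and weak duality for arbitrary adapted processes closes the gap.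

  The open mapping argument is applied to the sublevel sets of the integral of the positive part of
  \<open>f\<close> only: there Fatou's lemma applies without any integrable lower bound on \<open>f\<close>.\<close>

section \<open>Spaces with a complete sequence of seminorms\<close>

text \<open>The recourse condition speaks about \<open>ub\<close> only. This forces the order of the
  multipliers: the singular part of the subgradient in \<open>z\<close> is removed while
  \<open>u\<close> stays at \<open>ub\<close>, and \<open>y\<close> is sought afterwards with
  \<open>p\<close> fixed. The obstacle is orthogonality. Pasting on small sets separates a singular
  functional from an integral, but a pasted process is in general no longer adapted, so
  \<open>s\<close> cannot simply be dropped from \<open>v + s\<close>: the sum vanishes on adapted
  processes, \<open>v\<close> alone need not. In \<open>u\<close> there is no such constraint. A
  recourse \<open>zb\<close> with the same past as \<open>E t x\<close> is what permits exchanging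
  the value of \<open>s\<close> at \<open>x\<close> for that at \<open>E t x\<close>.

  The spaces consist of representatives, so the seminorms do not separate points and limits are
  unique only up to null sets. Category and open mapping arguments are therefore carried out with
  sequences on sets of functions, and adaptedness is used modulo null sets.\<close>

locale complete_seminorms =
  fixes X :: "'a::real_vector set" and \<rho> :: "nat \<Rightarrow> 'a \<Rightarrow> real"
  assumes subspace_X: "subspace X"
    and seminorm: "seminorm_on X (\<rho> k)"
    and complete: "range s \<subseteq> X \<Longrightarrow>
      (\<And>k e. 0 < e \<Longrightarrow> \<exists>n0. \<forall>i\<ge>n0. \<forall>j\<ge>n0. \<rho> k (s i - s j) < e) \<Longrightarrow>
      \<exists>x\<in>X. \<forall>k. (\<lambda>i::nat. \<rho> k (s i - x)) \<longlonglongrightarrow> 0"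
begin

lemmas mem_add [simp, intro] = subspace_add[OF subspace_X]
lemmas mem_diff [simp, intro] = subspace_diff[OF subspace_X]
lemmas mem_neg [simp, intro] = subspace_neg[OF subspace_X]
lemmas mem_scale [simp, intro] = subspace_scale[OF subspace_X]
lemmas mem_zero [simp, intro] = subspace_0[OF subspace_X]

text \<open>Partial sums make the seminorms increase with the index, so every neighbourhood of a
  point contains a single ball \<open>nrm k (x - a) \<le> e\<close>.\<close>

definition nrm :: "nat \<Rightarrow> 'a \<Rightarrow> real" where
  "nrm k x = (\<Sum>j\<le>k. \<rho> j x)"

definition converges :: "(nat \<Rightarrow> 'a) \<Rightarrow> 'a \<Rightarrow> bool" where
  "converges s x \<longleftrightarrow> (\<forall>k. (\<lambda>i. \<rho> k (s i - x)) \<longlonglongrightarrow> 0)"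

lemma rho_nonneg: "x \<in> X \<Longrightarrow> 0 \<le> \<rho> k x"
  using seminorm unfolding seminorm_on_def by blast

lemma nrm_nonneg [simp]: "x \<in> X \<Longrightarrow> 0 \<le> nrm k x"
  unfolding nrm_def by (simp add: rho_nonneg sum_nonneg)

lemma nrm_scale: "x \<in> X \<Longrightarrow> nrm k (c *\<^sub>R x) = \<bar>c\<bar> * nrm k x"
  using seminorm unfolding nrm_def seminorm_on_def by (simp add: sum_distrib_left)

lemma nrm_triangle: "x \<in> X \<Longrightarrow> y \<in> X \<Longrightarrow> nrm k (x + y) \<le> nrm k x + nrm k y"
  using seminorm unfolding nrm_def seminorm_on_def by (simp add: sum.distrib[symmetric] sum_mono)

lemma nrm_minus: "x \<in> X \<Longrightarrow> nrm k (- x) = nrm k x"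
  using nrm_scale[of x k "-1"] by simp

lemma nrm_0 [simp]: "nrm k 0 = 0"
  using nrm_scale[of 0 k 0] by simp

lemma nrm_commute: "x \<in> X \<Longrightarrow> y \<in> X \<Longrightarrow> nrm k (x - y) = nrm k (y - x)"
  using nrm_minus[of "x - y" k] by simp

lemma nrm_triangle_via:
  "x \<in> X \<Longrightarrow> y \<in> X \<Longrightarrow> z \<in> X \<Longrightarrow> nrm k (x - z) \<le> nrm k (x - y) + nrm k (y - z)"
  using nrm_triangle[of "x - y" "y - z" k] by simp

lemma nrm_mono: "x \<in> X \<Longrightarrow> k \<le> k' \<Longrightarrow> nrm k x \<le> nrm k' x"
  unfolding nrm_def by (intro sum_mono2) (auto simp: rho_nonneg)

lemma rho_le_nrm: "x \<in> X \<Longrightarrow> \<rho> k x \<le> nrm k x"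
  unfolding nrm_def by (intro member_le_sum) (auto simp: rho_nonneg)

lemma converges_nrm: "converges s x \<Longrightarrow> (\<lambda>i. nrm k (s i - x)) \<longlonglongrightarrow> 0"
  unfolding converges_def nrm_def by (intro tendsto_null_sum) auto

lemma convergesI_nrm:
  assumes "\<And>i. s i \<in> X" "x \<in> X" "\<And>k. (\<lambda>i. nrm k (s i - x)) \<longlonglongrightarrow> 0"
  shows "converges s x"
  unfolding converges_def
proof
  fix k
  show "(\<lambda>i. \<rho> k (s i - x)) \<longlonglongrightarrow> 0"
    by (rule tendsto_sandwich[OF _ _ tendsto_const assms(3)[of k]])
      (auto simp: rho_nonneg rho_le_nrm assms)
qed

text \<open>The index of the seminorm grows together with the accuracy; as
  \<open>nrm k \<le> nrm i\<close> on \<open>X\<close> for \<open>k \<le> i\<close>, this diagonal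
  bound controls every fixed seminorm.\<close>

lemma convergesI_le_inverse:
  assumes "\<And>i. s i \<in> X" "x \<in> X" "\<And>i. nrm i (s i - x) \<le> inverse (real (Suc i))"
  shows "converges s x"
proof (rule convergesI_nrm[OF assms(1,2)])
  fix k
  have "\<forall>\<^sub>F i in sequentially. nrm k (s i - x) \<le> inverse (real (Suc i))"
    using eventually_ge_at_top[of k]
  proof eventually_elim
    case (elim i)
    then show ?case using nrm_mono[of "s i - x" k i] assms(1)[of i] assms(2) assms(3)[of i] by auto
  qed
  then show "(\<lambda>i. nrm k (s i - x)) \<longlonglongrightarrow> 0"
    by (intro tendsto_sandwich[OF _ _ tendsto_const LIMSEQ_inverse_real_of_nat])
      (use assms in auto)
qed

lemma complete_nrm:
  assumes "\<And>i. s i \<in> X"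
    and "\<And>k e. 0 < e \<Longrightarrow> \<exists>n0. \<forall>i\<ge>n0. \<forall>j\<ge>n0. nrm k (s i - s j) < e"
  shows "\<exists>x\<in>X. converges s x"
  unfolding converges_def
proof (rule complete)
  show "range s \<subseteq> X" using assms(1) by auto
  fix k and e :: real assume "0 < e"
  then obtain n0 where n0: "\<And>i j. i \<ge> n0 \<Longrightarrow> j \<ge> n0 \<Longrightarrow> nrm k (s i - s j) < e"
    using assms(2) by meson
  show "\<exists>n0. \<forall>i\<ge>n0. \<forall>j\<ge>n0. \<rho> k (s i - s j) < e"
  proof (intro exI[of _ n0] allI impI)
    fix i j assume "i \<ge> n0" "j \<ge> n0"
    from n0[OF this] show "\<rho> k (s i - s j) < e"
      using rho_le_nrm[of "s i - s j" k] assms(1) by auto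
  qed
qed

lemma nrm_limit_le:
  assumes "converges s x" "x \<in> X" "y \<in> X" "\<And>i. s i \<in> X" "\<And>i. i \<ge> N \<Longrightarrow> nrm k (s i - y) \<le> e"
  shows "nrm k (x - y) \<le> e"
proof -
  have "nrm k (x - y) \<le> nrm k (s i - x) + e" if "i \<ge> N" for i
    using nrm_triangle_via[of x "s i" y k] assms(5)[OF that] nrm_commute[of x "s i" k] assms by auto
  moreover have "(\<lambda>i. nrm k (s i - x) + e) \<longlonglongrightarrow> 0 + e"
    by (intro tendsto_intros converges_nrm assms(1))
  ultimately show ?thesis
    by (intro Lim_bounded2[of "\<lambda>i. nrm k (s i - x) + e" e N]) auto
qed

text \<open>Were no set to contain a ball, nested balls could be chosen with the ball of step
  \<open>n + 1\<close> missing \<open>D n\<close>; their centres form a Cauchy sequence whose limit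
  lies in no \<open>D n\<close>, against the cover. Closedness is sequential, since this is what the
  limit arguments for functions supply.\<close>

lemma baire:
  fixes D :: "nat \<Rightarrow> 'a set"
  assumes closed: "\<And>n s x. (\<And>i. s i \<in> D n) \<Longrightarrow> (\<And>i. s i \<in> X) \<Longrightarrow> x \<in> X \<Longrightarrow> converges s x \<Longrightarrow> x \<in> D n"
    and cover: "\<And>x. x \<in> X \<Longrightarrow> \<exists>n. x \<in> D n"
  obtains n a k e where "a \<in> X" "0 < e" "\<And>x. x \<in> X \<Longrightarrow> nrm k (x - a) \<le> e \<Longrightarrow> x \<in> D n"
proof -
  define B where "B = (\<lambda>(a, k, e). {x\<in>X. nrm k (x - a) \<le> e})"
  have "\<exists>n a k e. a \<in> X \<and> 0 < e \<and> B (a, k, e) \<subseteq> D n"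
  proof (rule ccontr)
    assume "\<not> ?thesis"
    then have neg: "\<exists>x. x \<in> B (a, k, e) \<and> x \<notin> D n" if "a \<in> X" "0 < e" for a k e n
      using that by blast
    define P where "P = (\<lambda>(a, k::nat, e::real). a \<in> X \<and> 0 < e)"
    \<comment> \<open>The last two conjuncts let the indices tend to infinity and the radii to zero,
      which makes the centres Cauchy in every seminorm.\<close>
    define Q where "Q = (\<lambda>n (c::'a \<times> nat \<times> real) c'. B c' \<subseteq> B c \<and> B c' \<inter> D n = {}
        \<and> fst (snd c') \<ge> n \<and> snd (snd c') \<le> inverse (real (Suc n)))"
    have step: "\<exists>c'. P c' \<and> Q n c c'" if Pc: "P c" for c n
    proof -
      obtain a k e where c: "c = (a, k, e)" by (cases c)
      with Pc have a: "a \<in> X" "0 < e" by (auto simp: P_def)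
      \<comment> \<open>Half the radius leaves room for a ball around \<open>x\<close> inside the
        given ball.\<close>
      obtain x where x: "x \<in> B (a, k, e/2)" "x \<notin> D n" using neg[of a "e/2" k n] a by auto
      have xX: "x \<in> X" and xa: "nrm k (x - a) \<le> e/2" using x by (auto simp: B_def)
      \<comment> \<open>Otherwise every ball of index \<open>i\<close> and radius 1/(i+1) around
        \<open>x\<close> meets \<open>D n\<close>, and points of these intersections converge to
        \<open>x\<close>, which would then belong to \<open>D n\<close>.\<close>
      have "\<exists>k' e'. 0 < e' \<and> B (x, k', e') \<inter> D n = {}"
      proof (rule ccontr)
        assume "\<not> ?thesis"
        then have "\<exists>y. y \<in> B (x, i, inverse (real (Suc i))) \<inter> D n" for i
          by (metis ex_in_conv inverse_positive_iff_positive of_nat_0_less_iff zero_less_Suc)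
        then obtain y where y: "\<And>i. y i \<in> B (x, i, inverse (real (Suc i))) \<inter> D n" by metis
        have "converges y x" by (rule convergesI_le_inverse) (use y xX in \<open>auto simp: B_def\<close>)
        then have "x \<in> D n" by (rule closed[rotated 3]) (use y xX in \<open>auto simp: B_def\<close>)
        with x show False by simp
      qed
      then obtain k' e' where e': "0 < e'" "B (x, k', e') \<inter> D n = {}" by blast
      define k'' where "k'' = k + k' + n"
      define e'' where "e'' = min (e/2) (min e' (inverse (real (Suc n))))"
      have "B (x, k'', e'') \<subseteq> B (a, k, e)"
      proof
        fix y assume "y \<in> B (x, k'', e'')"
        then have y: "y \<in> X" "nrm k'' (y - x) \<le> e/2" by (auto simp: B_def e''_def)
        then have "nrm k (y - x) \<le> e/2" using nrm_mono[of "y - x" k k''] xX by (auto simp: k''_def)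
        then show "y \<in> B (a, k, e)" using nrm_triangle_via[of y x a k] y xX a xa by (auto simp: B_def)
      qed
      moreover have "B (x, k'', e'') \<subseteq> B (x, k', e')"
      proof
        fix y assume "y \<in> B (x, k'', e'')"
        then have y: "y \<in> X" "nrm k'' (y - x) \<le> e'" by (auto simp: B_def e''_def)
        then show "y \<in> B (x, k', e')" using nrm_mono[of "y - x" k' k''] xX by (auto simp: k''_def B_def)
      qed
      ultimately have "P (x, k'', e'') \<and> Q n c (x, k'', e'')"
        using e' a xX unfolding P_def Q_def c by (auto simp: k''_def e''_def)
      then show ?thesis by blast
    qed
    have "\<exists>g. \<forall>n. P (g n) \<and> Q n (g n) (g (Suc n))"
    proof (rule dependent_nat_choice)
      have "P (0, 0, 1)" by (simp add: P_def)
      then show "\<exists>c. P c" by blast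
    qed (rule step)
    then obtain g where g: "\<And>n. P (g n)" "\<And>n. Q n (g n) (g (Suc n))" by blast
    define a where "a n = fst (g n)" for n
    define k where "k n = fst (snd (g n))" for n
    define e where "e n = snd (snd (g n))" for n
    have g_eq: "g n = (a n, k n, e n)" for n by (simp add: a_def k_def e_def)
    have aX: "a n \<in> X" and e0: "0 < e n" for n using g(1)[of n] by (auto simp: P_def g_eq)
    have anti: "B (g m) \<subseteq> B (g n)" if "n \<le> m" for n m
      using that by (induction rule: dec_induct) (use g(2) in \<open>auto simp: Q_def\<close>)
    have aB: "a m \<in> B (g n)" if "n \<le> m" for n m
    proof -
      have "a m \<in> B (g m)" using aX[of m] e0[of m] by (simp add: B_def g_eq)
      with anti[OF that] show ?thesis by blast
    qed
    have "\<exists>x\<in>X. converges a x"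
    proof (rule complete_nrm[OF aX])
      fix j and d :: real assume "0 < d"
      then obtain n where n: "inverse (real (Suc n)) < d/2" using reals_Archimedean half_gt_zero by blast
      define N where "N = n + j"
      have eN: "e (Suc N) < d/2"
      proof -
        have "e (Suc N) \<le> inverse (real (Suc N))" using g(2)[of N] by (simp add: Q_def g_eq)
        also have "\<dots> \<le> inverse (real (Suc n))" by (simp add: N_def)
        finally show ?thesis using n by simp
      qed
      have kN: "j \<le> k (Suc N)" using g(2)[of N] by (simp add: Q_def g_eq N_def)
      have *: "nrm j (a i - a (Suc N)) < d/2" if "i \<ge> Suc N" for i
      proof -
        have "nrm (k (Suc N)) (a i - a (Suc N)) \<le> e (Suc N)" using aB[OF that] by (simp add: B_def g_eq)
        then show ?thesis using nrm_mono[of "a i - a (Suc N)", OF _ kN] eN aX by fastforce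
      qed
      have "nrm j (a i - a i') < d" if "i \<ge> Suc N" "i' \<ge> Suc N" for i i'
        using *[OF that(1)] *[OF that(2)] nrm_triangle_via[of "a i" "a (Suc N)" "a i'" j]
          nrm_commute[of "a i'" "a (Suc N)" j] aX by fastforce
      then show "\<exists>n0. \<forall>i\<ge>n0. \<forall>i'\<ge>n0. nrm j (a i - a i') < d" by blast
    qed
    then obtain x where x: "x \<in> X" "converges a x" by blast
    have xB: "x \<in> B (g n)" for n
      using nrm_limit_le[OF x(2,1) aX[of n] aX, of n "k n" "e n"] aB[of n] x(1) by (auto simp: B_def g_eq)
    obtain n where "x \<in> D n" using cover[OF x(1)] by blast
    with xB[of "Suc n"] g(2)[of n] show False by (auto simp: Q_def)
  qed
  then obtain n a k e where "a \<in> X" "0 < e" "B (a, k, e) \<subseteq> D n" by blast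
  then show thesis by (intro that[of a e k n]) (auto simp: B_def)
qed

text \<open>The dilates \<open>D n\<close> of \<open>C\<close> cover the space, so one of them
  contains a ball around some \<open>a\<close>. As \<open>C\<close> need not be symmetric, the ball
  is moved to the origin by means of a point \<open>t *\<^sub>R (- a)\<close> of \<open>C\<close>,
  which exists because \<open>C\<close> is absorbing.\<close>

lemma barrel:
  assumes closed: "\<And>s x. (\<And>i. s i \<in> C) \<Longrightarrow> (\<And>i. s i \<in> X) \<Longrightarrow> x \<in> X \<Longrightarrow> converges s x \<Longrightarrow> x \<in> C"
    and convex: "convex C" and zero: "0 \<in> C"
    and absorbing: "\<And>x. x \<in> X \<Longrightarrow> \<exists>t>0. t *\<^sub>R x \<in> C"
  obtains k e where "0 < e" "\<And>x. x \<in> X \<Longrightarrow> nrm k x \<le> e \<Longrightarrow> x \<in> C"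
proof -
  have shrink: "s *\<^sub>R x \<in> C" if "t *\<^sub>R x \<in> C" "0 \<le> s" "s \<le> t" "0 < t" for s t x
    using convexD[OF convex that(1) zero, of "s/t" "1 - s/t"] that by simp
  define D where "D n = {x. inverse (real (Suc n)) *\<^sub>R x \<in> C}" for n
  obtain n a k e where a: "a \<in> X" "0 < e" and ball: "\<And>x. x \<in> X \<Longrightarrow> nrm k (x - a) \<le> e \<Longrightarrow> x \<in> D n"
  proof (rule baire[of D])
    fix n s x assume s: "\<And>i::nat. s i \<in> D n" "\<And>i. s i \<in> X" "x \<in> X" "converges s x"
    have "converges (\<lambda>i. inverse (real (Suc n)) *\<^sub>R s i) (inverse (real (Suc n)) *\<^sub>R x)"
    proof (rule convergesI_nrm)
      fix k
      have "nrm k (inverse (real (Suc n)) *\<^sub>R s i - inverse (real (Suc n)) *\<^sub>R x) = inverse (real (Suc n)) * nrm k (s i - x)" for i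
        using nrm_scale[of "s i - x" k "inverse (real (Suc n))"] s by (simp add: scaleR_diff_right)
      then show "(\<lambda>i. nrm k (inverse (real (Suc n)) *\<^sub>R s i - inverse (real (Suc n)) *\<^sub>R x)) \<longlonglongrightarrow> 0"
        using tendsto_mult_right_zero[OF converges_nrm[OF s(4)]] by simp
    qed (use s in auto)
    then have "inverse (real (Suc n)) *\<^sub>R x \<in> C"
      by (rule closed[rotated 3]) (use s in \<open>auto simp: D_def\<close>)
    then show "x \<in> D n" by (simp add: D_def)
  next
    fix x assume "x \<in> X"
    then obtain t where t: "0 < t" "t *\<^sub>R x \<in> C" using absorbing by blast
    obtain n where "inverse (real (Suc n)) < t" using reals_Archimedean t by blast
    then show "\<exists>n. x \<in> D n" using shrink[OF t(2), of "inverse (real (Suc n))"] t by (auto simp: D_def)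
  qed blast
  obtain t where t: "0 < t" "t *\<^sub>R (- a) \<in> C" using absorbing[of "- a"] a by auto
  define r where "r = inverse (real (Suc n))"
  \<comment> \<open>With the weights \<open>t/(r+t)\<close> and \<open>r/(r+t)\<close> the multiples
    of \<open>a\<close> cancel and the factor \<open>lam\<close> of \<open>b\<close>
    remains.\<close>
  define lam where "lam = r * t / (r + t)"
  have r0: "0 < r" by (simp add: r_def)
  have lam0: "0 < lam" using r0 t by (simp add: lam_def)
  have small: "lam *\<^sub>R b \<in> C" if b: "b \<in> X" "nrm k b \<le> e" for b
  proof -
    have "r *\<^sub>R (a + b) \<in> C" using ball[of "a + b"] a b by (simp add: D_def r_def)
    from convexD[OF convex this t(2), of "t/(r+t)" "r/(r+t)"]
    have "(t/(r+t)) *\<^sub>R r *\<^sub>R (a + b) + (r/(r+t)) *\<^sub>R t *\<^sub>R (- a) \<in> C"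
      using r0 t by (simp add: add_divide_distrib[symmetric] add.commute)
    moreover have "(t/(r+t)) *\<^sub>R r *\<^sub>R (a + b) + (r/(r+t)) *\<^sub>R t *\<^sub>R (- a) = lam *\<^sub>R b"
      by (simp add: lam_def algebra_simps)
    ultimately show ?thesis by simp
  qed
  show thesis
  proof (rule that[of "lam * e" k])
    show "0 < lam * e" using lam0 a by simp
    fix x assume x: "x \<in> X" "nrm k x \<le> lam * e"
    then have "nrm k (inverse lam *\<^sub>R x) \<le> e" using lam0 by (simp add: nrm_scale field_simps)
    with small[of "inverse lam *\<^sub>R x"] x lam0 show "x \<in> C" by simp
  qed
qed

lemma converges_geometric:
  assumes "\<And>i. s i \<in> X" "\<And>k m. k \<le> m \<Longrightarrow> nrm k (s (Suc m) - s m) \<le> (1/2)^m"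
  shows "\<exists>x\<in>X. converges s x"
proof (rule complete_nrm[OF assms(1)])
  fix k and e :: real assume e: "0 < e"
  \<comment> \<open>The subtracted term \<open>2 * (1/2)^m\<close> is the tail of the geometric
    series; keeping it lets the induction close.\<close>
  have tel: "nrm k (s m - s n) \<le> 2 * (1/2)^n - 2 * (1/2)^m" if "k \<le> n" "n \<le> m" for n m
    using that(2)
  proof (induction m rule: dec_induct)
    case (step m)
    have "nrm k (s (Suc m) - s n) \<le> nrm k (s (Suc m) - s m) + nrm k (s m - s n)"
      by (rule nrm_triangle_via) (use assms in auto)
    also have "\<dots> \<le> (1/2)^m + (2 * (1/2)^n - 2 * (1/2)^m)"
      using assms(2)[of k m] that(1) step by (intro add_mono) auto
    finally show ?case by simp
  qed simp
  obtain n where n: "(1/2)^n < e/4" using real_arch_pow_inv[of "e/4" "1/2"] e by auto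
  have half: "nrm k (s m - s (n + k)) < e/2" if "n + k \<le> m" for m
  proof -
    have "nrm k (s m - s (n + k)) \<le> 2 * (1/2)^(n+k)" using tel[of "n + k" m] that
      by (smt (verit) le_add2 zero_le_divide_1_iff zero_le_power)
    also have "\<dots> \<le> 2 * (1/2)^n" by (simp add: power_decreasing)
    finally show ?thesis using n by simp
  qed
  have "nrm k (s i - s j) < e" if "i \<ge> n + k" "j \<ge> n + k" for i j
    using half[OF that(1)] half[OF that(2)] nrm_triangle_via[of "s i" "s (n+k)" "s j" k]
      nrm_commute[of "s j" "s (n+k)" k] assms(1) by fastforce
  then show "\<exists>n0. \<forall>i\<ge>n0. \<forall>j\<ge>n0. nrm k (s i - s j) < e" by blast
qed

text \<open>The closed linear subspaces spanned by the domains become spaces of the same kind, so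
  the category argument applies inside them.\<close>

lemma complete_seminorms_subset:
  assumes "subspace L" "L \<subseteq> X"
    and closed: "\<And>s x. (\<And>i. s i \<in> L) \<Longrightarrow> x \<in> X \<Longrightarrow> converges s x \<Longrightarrow> x \<in> L"
  shows "complete_seminorms L \<rho>"
proof
  show "seminorm_on L (\<rho> k)" for k
    using seminorm[of k] assms(2) unfolding seminorm_on_def by blast
  fix s :: "nat \<Rightarrow> 'a"
  assume s: "range s \<subseteq> L" "\<And>k e. 0 < e \<Longrightarrow> \<exists>n0. \<forall>i\<ge>n0. \<forall>j\<ge>n0. \<rho> k (s i - s j) < e"
  obtain x where "x \<in> X" "converges s x"
    using complete[of s, OF _ s(2)] s(1) assms(2) unfolding converges_def by blast
  then show "\<exists>x\<in>L. \<forall>k. (\<lambda>i. \<rho> k (s i - x)) \<longlonglongrightarrow> 0"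
    using closed[of s x] s(1) unfolding converges_def by blast
qed (rule assms(1))

end

text \<open>The weights \<open>(1/2)^Suc i\<close> leave a rest of \<open>(1/2)^m\<close>, which
  \<open>z\<close> carries. Induction splits off the first point and halves the combination of the
  shifted sequence, hence the generalization over \<open>r\<close>.\<close>

lemma convex_geometric_combination:
  assumes "convex R" "\<And>i. r i \<in> R" "z \<in> R"
  shows "(\<Sum>i<m. (1/2)^Suc i *\<^sub>R r i) + (1/2)^m *\<^sub>R z \<in> R"
  using assms(2)
proof (induction m arbitrary: r)
  case (Suc m)
  let ?y = "(\<Sum>i<m. (1/2)^Suc i *\<^sub>R r (Suc i)) + (1/2)^m *\<^sub>R z"
  have "?y \<in> R" using Suc.IH[of "\<lambda>i. r (Suc i)"] Suc.prems by blast
  then have "(1/2) *\<^sub>R r 0 + (1/2) *\<^sub>R ?y \<in> R"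
    by (intro convexD[OF assms(1)] Suc.prems) auto
  also have "(1/2) *\<^sub>R r 0 + (1/2) *\<^sub>R ?y = (\<Sum>i<Suc m. (1/2)^Suc i *\<^sub>R r i) + (1/2)^Suc m *\<^sub>R z"
    by (subst sum.lessThan_Suc_shift) (simp add: scaleR_add_right scaleR_sum_right)
  finally show ?case .
qed (use assms(3) in simp)

text \<open>Points of the domain are approximated by points with preimages in smaller and smaller balls
  around \<^term>\<open>w0\<close>; halving the remainder in every step writes a point as an infinite convex
  combination, and the preimages converge by completeness.\<close>

lemma convex_open_mapping:
  fixes W :: "'a::real_vector set" and E :: "'b::real_vector set"
  assumes "complete_seminorms W \<sigma>" and "complete_seminorms E \<rho>"
    and sub: "R \<subseteq> W \<times> E" and conv: "convex R" and base: "(w0, 0) \<in> R"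
    and closed: "\<And>s t x y. (\<And>i. (s i, t i) \<in> R) \<Longrightarrow> x \<in> W \<Longrightarrow> y \<in> E \<Longrightarrow>
      complete_seminorms.converges \<sigma> s x \<Longrightarrow> complete_seminorms.converges \<rho> t y \<Longrightarrow> (x, y) \<in> R"
    and absorbing: "\<And>e. e \<in> E \<Longrightarrow> \<exists>t>0. \<exists>w. (w, t *\<^sub>R e) \<in> R"
  obtains k \<epsilon> where "0 < \<epsilon>"
    "\<And>e. e \<in> E \<Longrightarrow> complete_seminorms.nrm \<rho> k e \<le> \<epsilon> \<Longrightarrow> \<exists>w. (w, e) \<in> R"
proof -
  interpret W: complete_seminorms W \<sigma> by fact
  interpret E: complete_seminorms E \<rho> by fact
  have w0: "w0 \<in> W" using base sub by auto
  \<comment> \<open>\<open>P k\<close> collects the points with a preimage in the unit ball of index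
    \<open>k\<close> around \<open>w0\<close>, and \<open>K k\<close> is its closure. Each
    \<open>K k\<close> is shown to be a barrel.\<close>
  define P where "P k = {e. \<exists>w. (w, e) \<in> R \<and> W.nrm k (w - w0) \<le> 1}" for k
  define K where "K k = {e\<in>E. \<forall>j. \<forall>d>0. \<exists>e'\<in>P k. E.nrm j (e - e') < d}" for k
  have PE: "P k \<subseteq> E" for k using sub by (auto simp: P_def)
  have P_convex: "convex (P k)" for k
  proof (rule convexI)
    fix e e' and u v :: real assume e: "e \<in> P k" "e' \<in> P k" and uv: "0 \<le> u" "0 \<le> v" "u + v = 1"
    then obtain w w' where w: "(w, e) \<in> R" "W.nrm k (w - w0) \<le> 1" "(w', e') \<in> R" "W.nrm k (w' - w0) \<le> 1"
      by (auto simp: P_def)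
    have W: "w \<in> W" "w' \<in> W" using w sub by auto
    have "(u *\<^sub>R w + v *\<^sub>R w', u *\<^sub>R e + v *\<^sub>R e') \<in> R"
      using convexD[OF conv w(1,3) uv] by simp
    moreover have "W.nrm k (u *\<^sub>R w + v *\<^sub>R w' - w0) \<le> 1"
    proof -
      have "u *\<^sub>R w + v *\<^sub>R w' - w0 = u *\<^sub>R (w - w0) + v *\<^sub>R (w' - w0)"
        using uv(3) by (simp add: algebra_simps flip: scaleR_add_left)
      then have "W.nrm k (u *\<^sub>R w + v *\<^sub>R w' - w0) \<le> u * W.nrm k (w - w0) + v * W.nrm k (w' - w0)"
        using W.nrm_triangle[of "u *\<^sub>R (w - w0)" "v *\<^sub>R (w' - w0)" k] W w0 uv
        by (simp add: W.nrm_scale)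
      also have "\<dots> \<le> u * 1 + v * 1" using w uv by (intro add_mono mult_left_mono) auto
      finally show ?thesis using uv by simp
    qed
    ultimately show "u *\<^sub>R e + v *\<^sub>R e' \<in> P k" by (auto simp: P_def)
  qed
  have zero_P: "0 \<in> P k" for k using base by (auto simp: P_def intro!: exI[of _ w0])
  have P_K: "P k \<subseteq> K k" for k
  proof
    fix e assume "e \<in> P k"
    then show "e \<in> K k" unfolding K_def using PE by (auto intro!: bexI[of _ e])
  qed
  have "\<exists>j \<epsilon>. 0 < \<epsilon> \<and> (\<forall>e\<in>E. E.nrm j e \<le> \<epsilon> \<longrightarrow> e \<in> K k)" for k
  proof (rule E.barrel[of "K k"])
    show "0 \<in> K k" using zero_P P_K by blast
    show "x \<in> K k" if s: "\<And>i. s i \<in> K k" "\<And>i. s i \<in> E" "x \<in> E" "E.converges s x" for s x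
      unfolding K_def
    proof (intro CollectI conjI allI impI s(3))
      fix j and d :: real assume d: "0 < d"
      have "\<forall>\<^sub>F i in sequentially. E.nrm j (s i - x) < d/2"
        using E.converges_nrm[OF s(4), of j] d by (intro order_tendstoD(2)) auto
      then obtain i where i: "E.nrm j (s i - x) < d/2" using eventually_happens' sequentially_bot by blast
      obtain e' where e': "e' \<in> P k" "E.nrm j (s i - e') < d/2"
        using s(1)[of i] half_gt_zero[OF d] unfolding K_def by blast
      have "e' \<in> E" using e'(1) PE by blast
      then have "E.nrm j (x - e') < d"
        using i e'(2) E.nrm_triangle_via[of x "s i" e' j] E.nrm_commute[of x "s i" j] s(2)[of i] s(3) by simp
      with e'(1) show "\<exists>e'\<in>P k. E.nrm j (x - e') < d" by blast
    qed
    show "convex (K k)"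
    proof (rule convexI)
      fix e e' and u v :: real assume e: "e \<in> K k" "e' \<in> K k" and uv: "0 \<le> u" "0 \<le> v" "u + v = 1"
      show "u *\<^sub>R e + v *\<^sub>R e' \<in> K k"
        unfolding K_def
      proof (intro CollectI conjI allI impI)
        show "u *\<^sub>R e + v *\<^sub>R e' \<in> E" using e by (auto simp: K_def)
        fix j and d :: real assume d: "0 < d"
        obtain p where p: "p \<in> P k" "E.nrm j (e - p) < d" using e(1) d unfolding K_def by blast
        obtain p' where p': "p' \<in> P k" "E.nrm j (e' - p') < d" using e(2) d unfolding K_def by blast
        have mem: "e \<in> E" "e' \<in> E" "p \<in> E" "p' \<in> E" using e p p' PE by (auto simp: K_def)
        have "u *\<^sub>R e + v *\<^sub>R e' - (u *\<^sub>R p + v *\<^sub>R p') = u *\<^sub>R (e - p) + v *\<^sub>R (e' - p')"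
          by (simp add: algebra_simps)
        then have "E.nrm j (u *\<^sub>R e + v *\<^sub>R e' - (u *\<^sub>R p + v *\<^sub>R p')) \<le> u * E.nrm j (e - p) + v * E.nrm j (e' - p')"
          using E.nrm_triangle[of "u *\<^sub>R (e - p)" "v *\<^sub>R (e' - p')" j] mem uv by (simp add: E.nrm_scale)
        also have "\<dots> < d" using convex_bound_lt[OF p(2) p'(2) uv] .
        finally show "\<exists>q\<in>P k. E.nrm j (u *\<^sub>R e + v *\<^sub>R e' - q) < d"
          using convexD[OF P_convex p(1) p'(1) uv] by blast
      qed
    qed
    show "\<exists>t>0. t *\<^sub>R x \<in> K k" if x: "x \<in> E" for x
    proof -
      obtain t w where t: "0 < t" "(w, t *\<^sub>R x) \<in> R" using absorbing[OF x] by blast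
      have w: "w \<in> W" using t sub by auto
      \<comment> \<open>Moving the preimage towards \<open>w0\<close> by this factor brings it into
        the unit ball; the image shrinks by the same factor because \<open>w0\<close> is paired with
        zero.\<close>
      define s where "s = inverse (1 + W.nrm k (w - w0))"
      have N: "0 \<le> W.nrm k (w - w0)" using w w0 by simp
      have s: "0 < s" "s \<le> 1" using N by (auto simp: s_def inverse_le_1_iff)
      have "s * W.nrm k (w - w0) \<le> 1" using N by (simp add: s_def field_simps)
      moreover have "w0 + s *\<^sub>R (w - w0) - w0 = s *\<^sub>R (w - w0)" by simp
      ultimately have "W.nrm k (w0 + s *\<^sub>R (w - w0) - w0) \<le> 1" using w w0 s by (simp add: W.nrm_scale)
      moreover have "(w0 + s *\<^sub>R (w - w0), (s * t) *\<^sub>R x) \<in> R"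
        using convexD[OF conv t(2) base, of s "1 - s"] s by (simp add: algebra_simps)
      ultimately have "(s * t) *\<^sub>R x \<in> P k" by (auto simp: P_def)
      then show ?thesis using s t P_K by (intro exI[of _ "s * t"]) auto
    qed
  qed blast
  then obtain J \<epsilon> where J: "\<And>k. 0 < \<epsilon> k" "\<And>k e. e \<in> E \<Longrightarrow> E.nrm (J k) e \<le> \<epsilon> k \<Longrightarrow> e \<in> K k"
    by metis
  \<comment> \<open>Half of \<open>\<epsilon> 0\<close> is taken because the first remainder is
    \<open>2 *\<^sub>R e\<close>.\<close>
  have "\<exists>w. (w, e) \<in> R" if e: "e \<in> E" "E.nrm (J 0) e \<le> \<epsilon> 0 / 2" for e
  proof -
    \<comment> \<open>A pair holds the approximant chosen last and the current remainder. Remainders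
      are doubled after each subtraction and bounded by one in seminorms of growing index, so
      multiplied by powers of 1/2 they tend to zero.\<close>
    define Q where "Q n p = (snd p \<in> K n \<and> (n = 0 \<longrightarrow> snd p = 2 *\<^sub>R e) \<and> (n > 0 \<longrightarrow> E.nrm (n - 1) (snd p) \<le> 1))" for n and p :: "'b \<times> 'b"
    define S where "S n p p' = (fst p' \<in> P n \<and> snd p' = 2 *\<^sub>R (snd p - fst p'))" for n and p p' :: "'b \<times> 'b"
    have "\<exists>g. \<forall>n. Q n (g n) \<and> S n (g n) (g (Suc n))"
    proof (rule dependent_nat_choice)
      have "2 *\<^sub>R e \<in> K 0" using J(2)[of "2 *\<^sub>R e" 0] e by (simp add: E.nrm_scale)
      then show "\<exists>p. Q 0 p" by (auto simp: Q_def)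
    next
      fix p n assume "Q n p"
      then have r: "snd p \<in> K n" by (simp add: Q_def)
      \<comment> \<open>This index dominates both the one that secures membership in
        \<open>K (Suc n)\<close> and the one in which the next remainder is bounded; the factor 1/2
        in the accuracy pays for the doubling.\<close>
      define j where "j = J (Suc n) + n"
      have "0 < min (\<epsilon> (Suc n)) 1 / 2" using J(1)[of "Suc n"] by simp
      then obtain q where q: "q \<in> P n" "E.nrm j (snd p - q) < min (\<epsilon> (Suc n)) 1 / 2"
        using r unfolding K_def by blast
      have mem: "snd p - q \<in> E" using r q PE by (auto simp: K_def)
      have "E.nrm (J (Suc n)) (snd p - q) \<le> E.nrm j (snd p - q)" "E.nrm n (snd p - q) \<le> E.nrm j (snd p - q)"
        using mem by (auto simp: j_def intro: E.nrm_mono)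
      then have "E.nrm (J (Suc n)) (2 *\<^sub>R (snd p - q)) \<le> \<epsilon> (Suc n)" "E.nrm n (2 *\<^sub>R (snd p - q)) \<le> 1"
        using q(2) mem by (auto simp: E.nrm_scale)
      then have "Q (Suc n) (q, 2 *\<^sub>R (snd p - q)) \<and> S n p (q, 2 *\<^sub>R (snd p - q))"
        using J(2)[of "2 *\<^sub>R (snd p - q)" "Suc n"] mem q(1) by (simp add: Q_def S_def)
      then show "\<exists>p'. Q (Suc n) p' \<and> S n p p'" by blast
    qed
    then obtain g where g: "\<And>n. Q n (g n)" "\<And>n. S n (g n) (g (Suc n))" by blast
    define r where "r n = snd (g n)" for n
    define d where "d n = fst (g (Suc n))" for n
    have r0: "r 0 = 2 *\<^sub>R e" and r_Suc: "r (Suc n) = 2 *\<^sub>R (r n - d n)"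
      and r_small: "E.nrm n (r (Suc n)) \<le> 1" and rE: "r n \<in> E" for n
      using g(1)[of 0] g(1)[of "Suc n"] g(2)[of n] g(1)[of n]
      by (auto simp: Q_def S_def r_def d_def K_def)
    have dP: "d n \<in> P n" for n using g(2)[of n] by (simp add: S_def d_def)
    then have "\<exists>w. (w, d n) \<in> R \<and> W.nrm n (w - w0) \<le> 1" for n by (auto simp: P_def)
    then obtain w where w: "\<And>n. (w n, d n) \<in> R" "\<And>n. W.nrm n (w n - w0) \<le> 1" by metis
    have wW: "w n \<in> W" and dE: "d n \<in> E" for n using w(1)[of n] sub by auto
    define A where "A m = (\<Sum>i<m. (1/2)^Suc i *\<^sub>R w i) + (1/2)^m *\<^sub>R w0" for m
    define B where "B m = (\<Sum>i<m. (1/2)^Suc i *\<^sub>R d i)" for m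
    have sum_pair: "(\<Sum>i<m. (1/2)^Suc i *\<^sub>R (w i, d i)) = (\<Sum>i<m. (1/2)^Suc i *\<^sub>R w i, \<Sum>i<m. (1/2)^Suc i *\<^sub>R d i)" for m
      by (induction m) (simp_all add: zero_prod_def)
    have AB: "(A m, B m) \<in> R" for m
      using convex_geometric_combination[OF conv, of "\<lambda>i. (w i, d i)" "(w0, 0)" m] w(1) base
      unfolding sum_pair by (simp add: A_def B_def)
    have AW: "A m \<in> W" and BE: "B m \<in> E" for m using AB[of m] sub by auto
    have B_eq: "e - B m = (1/2)^Suc m *\<^sub>R r m" for m
    proof (induction m)
      case (Suc m)
      have "e - B (Suc m) = (1/2)^Suc m *\<^sub>R r m - (1/2)^Suc m *\<^sub>R d m"
        using Suc by (simp add: B_def)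
      then show ?case by (simp add: r_Suc scaleR_diff_right)
    qed (simp add: B_def r0)
    have "\<exists>x\<in>W. W.converges A x"
    proof (rule W.converges_geometric[OF AW])
      fix k m :: nat assume "k \<le> m"
      \<comment> \<open>All multiples of \<open>w0\<close> outside the first summand have
        coefficient zero, as \<open>2 * (1/2)^Suc m = (1/2)^m\<close>.\<close>
      have "A (Suc m) - A m = (1/2)^Suc m *\<^sub>R (w m - w0) + ((1/2)^m - 2 * (1/2)^Suc m) *\<^sub>R w0 - ((1/2)^m - 2 * (1/2)^Suc m) *\<^sub>R w0
          + (2 * (1/2)^Suc m - (1/2)^m) *\<^sub>R w0"
        by (simp add: A_def algebra_simps flip: scaleR_add_left)
      then have "A (Suc m) - A m = (1/2)^Suc m *\<^sub>R (w m - w0)" by simp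
      moreover have "W.nrm k (w m - w0) \<le> 1"
        using W.nrm_mono[of "w m - w0" k m] \<open>k \<le> m\<close> w(2)[of m] wW[of m] w0 by auto
      ultimately have "W.nrm k (A (Suc m) - A m) \<le> (1/2)^Suc m"
        using wW[of m] w0 by (simp add: W.nrm_scale)
      also have "\<dots> \<le> (1/2)^m" by simp
      finally show "W.nrm k (A (Suc m) - A m) \<le> (1/2)^m" .
    qed
    then obtain x where x: "x \<in> W" "W.converges A x" by blast
    have "E.converges B e"
    proof (rule E.convergesI_nrm[OF BE e(1)])
      fix k
      have "\<forall>\<^sub>F m in sequentially. E.nrm k (B m - e) \<le> (1/2)^m"
        using eventually_gt_at_top[of k]
      proof eventually_elim
        case (elim m)
        then obtain n where m: "m = Suc n" "k \<le> n" by (cases m) auto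
        have "E.nrm k (B m - e) = (1/2)^Suc m * E.nrm k (r m)"
          using E.nrm_commute[OF BE e(1), of k m] rE[of m] by (simp add: B_eq E.nrm_scale)
        also have "\<dots> \<le> (1/2)^Suc m * 1"
          using E.nrm_mono[OF rE[of m] m(2)] r_small[of n] m by (intro mult_left_mono) auto
        also have "\<dots> \<le> (1/2)^m" by simp
        finally show ?case .
      qed
      then show "(\<lambda>m. E.nrm k (B m - e)) \<longlonglongrightarrow> 0"
        by (intro tendsto_sandwich[OF _ _ tendsto_const LIMSEQ_power_zero[of "1/2::real"]])
          (use BE e in auto)
    qed
    then have "(x, e) \<in> R" using closed[OF AB x(1) e(1) x(2)] by blast
    then show ?thesis ..
  qed
  then show thesis using J(1)[of 0] by (intro that[of "\<epsilon> 0 / 2" "J 0"]) auto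
qed

section \<open>The Hahn--Banach theorem and subgradients\<close>

definition sublinear_on :: "'a::real_vector set \<Rightarrow> ('a \<Rightarrow> real) \<Rightarrow> bool" where
  "sublinear_on X q \<longleftrightarrow> (\<forall>x\<in>X. \<forall>y\<in>X. q (x + y) \<le> q x + q y) \<and> (\<forall>x\<in>X. \<forall>s>0. q (s *\<^sub>R x) = s * q x)"

definition linear_on_subspace :: "'a::real_vector set \<Rightarrow> ('a \<Rightarrow> real) \<Rightarrow> bool" where
  "linear_on_subspace X l \<longleftrightarrow>
     (\<forall>x\<in>X. \<forall>x'\<in>X. \<forall>a b. l (a *\<^sub>R x + b *\<^sub>R x') = a * l x + b * l x')"

lemma sublinear_on_0:
  assumes "sublinear_on X q" "0 \<in> X" shows "q 0 = 0"
proof -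
  have "q (2 *\<^sub>R 0) = 2 * q 0" using assms unfolding sublinear_on_def
    by (metis zero_less_numeral)
  then show ?thesis by simp
qed

text \<open>Covers three infima: the lower bound of a chain, the modification of a minimal
  functional, and an infimal convolution. In \<open>scale\<close> an inequality suffices, because
  the reverse one follows with the inverse factor.\<close>

lemma sublinear_on_INF:
  fixes g :: "'i \<Rightarrow> 'a::real_vector \<Rightarrow> real"
  assumes X: "subspace X" and I: "I \<noteq> {}"
    and bdd: "\<And>x. x \<in> X \<Longrightarrow> bdd_below ((\<lambda>i. g i x) ` I)"
    and add: "\<And>i j x y. i \<in> I \<Longrightarrow> j \<in> I \<Longrightarrow> x \<in> X \<Longrightarrow> y \<in> X \<Longrightarrow> \<exists>k\<in>I. g k (x + y) \<le> g i x + g j y"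
    and scale: "\<And>i x s. i \<in> I \<Longrightarrow> x \<in> X \<Longrightarrow> 0 < s \<Longrightarrow> \<exists>k\<in>I. g k (s *\<^sub>R x) \<le> s * g i x"
  shows "sublinear_on X (\<lambda>x. INF i\<in>I. g i x)"
proof -
  let ?q = "\<lambda>x. INF i\<in>I. g i x"
  have le: "?q (s *\<^sub>R x) \<le> s * ?q x" if x: "x \<in> X" and s: "0 < s" for x s
  proof -
    have sx: "s *\<^sub>R x \<in> X" using x X by (rule subspace_scale[rotated])
    have "?q (s *\<^sub>R x) / s \<le> ?q x"
    proof (rule cINF_greatest[OF I])
      fix i assume "i \<in> I"
      from scale[OF this x s] obtain k where k: "k \<in> I" "g k (s *\<^sub>R x) \<le> s * g i x" by blast
      have "?q (s *\<^sub>R x) \<le> g k (s *\<^sub>R x)" by (rule cINF_lower[OF bdd[OF sx] k(1)])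
      with k s show "?q (s *\<^sub>R x) / s \<le> g i x" by (simp add: field_simps)
    qed
    with s show ?thesis by (simp add: field_simps)
  qed
  have "?q (x + y) \<le> ?q x + ?q y" if xy: "x \<in> X" "y \<in> X" for x y
  proof -
    have S: "x + y \<in> X" using xy X by (simp add: subspace_add)
    have "?q (x + y) - g j y \<le> ?q x" if j: "j \<in> I" for j
    proof (rule cINF_greatest[OF I])
      fix i assume "i \<in> I"
      from add[OF this j xy] obtain k where k: "k \<in> I" "g k (x + y) \<le> g i x + g j y" by blast
      have "?q (x + y) \<le> g k (x + y)" by (rule cINF_lower[OF bdd[OF S] k(1)])
      with k show "?q (x + y) - g j y \<le> g i x" by simp
    qed
    then have "?q (x + y) - ?q x \<le> ?q y"
      by (intro cINF_greatest[OF I]) (simp add: algebra_simps)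
    then show ?thesis by simp
  qed
  moreover have "?q (s *\<^sub>R x) = s * ?q x" if x: "x \<in> X" and s: "0 < s" for x s
  proof (rule antisym[OF le[OF x s]])
    have "?q (inverse s *\<^sub>R s *\<^sub>R x) \<le> inverse s * ?q (s *\<^sub>R x)"
      using le[of "s *\<^sub>R x" "inverse s"] x s X by (simp add: subspace_scale)
    then show "s * ?q x \<le> ?q (s *\<^sub>R x)" using s by (simp add: field_simps)
  qed
  ultimately show ?thesis unfolding sublinear_on_def by blast
qed

text \<open>By Zorn's lemma there is a minimal sublinear functional below \<^term>\<open>q\<close>; minimality against
  \<open>x \<mapsto> inf\<^sub>t (p (x + t y) - t p y)\<close> makes it additive.\<close>

theorem hahn_banach:
  assumes X: "subspace X" and q: "sublinear_on X q"
  obtains l where "linear_on_subspace X l" "\<And>x. x \<in> X \<Longrightarrow> l x \<le> q x"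
proof -
  note mem = subspace_add[OF X] subspace_scale[OF X] subspace_neg[OF X] subspace_0[OF X]
  \<comment> \<open>Values outside \<open>X\<close> are fixed to zero, so the pointwise order of
    total functions compares values on \<open>X\<close> only.\<close>
  define A where "A = {p. sublinear_on X p \<and> (\<forall>x\<in>X. p x \<le> q x) \<and> (\<forall>x. x \<notin> X \<longrightarrow> p x = 0)}"
  have lower: "- p (- x) \<le> p x" if "sublinear_on X p" "x \<in> X" for p x
  proof -
    have "p (x + - x) \<le> p x + p (- x)" using that mem unfolding sublinear_on_def by blast
    then show ?thesis using sublinear_on_0[OF that(1)] mem by simp
  qed
  have restrict: "sublinear_on X (\<lambda>x. if x \<in> X then p x else 0)" if "sublinear_on X p" for p
    using that mem unfolding sublinear_on_def by auto
  have "\<exists>m\<in>A. \<forall>a\<in>A. a \<le> m \<longrightarrow> a = m"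
  proof (rule predicate_Zorn)
    show "partial_order_on A (relation_of (\<lambda>p p'. p' \<le> p) A)"
      by (rule partial_order_on_relation_ofI) auto
    fix C assume C: "C \<in> Chains (relation_of (\<lambda>p p'. p' \<le> p) A)"
    have CA: "C \<subseteq> A" using C by (auto simp: Chains_def relation_of_def)
    have chain: "p \<le> p' \<or> p' \<le> p" if "p \<in> C" "p' \<in> C" for p p'
      using C that by (auto simp: Chains_def relation_of_def)
    show "\<exists>u\<in>A. \<forall>a\<in>C. u \<le> a"
    proof (cases "C = {}")
      case True
      have "(\<lambda>x. if x \<in> X then q x else 0) \<in> A" using restrict[OF q] by (auto simp: A_def)
      with True show ?thesis by blast
    next
      case False
      let ?u = "\<lambda>x. INF p\<in>C. p x"
      \<comment> \<open>Sublinearity makes \<open>- q (- x)\<close> a common lower bound of all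
        members, so the infimum over the chain is finite.\<close>
      have bdd: "bdd_below ((\<lambda>p. p x) ` C)" if "x \<in> X" for x
      proof (rule bdd_belowI2)
        fix p assume "p \<in> C"
        then have "sublinear_on X p" "p (- x) \<le> q (- x)" using CA that mem by (auto simp: A_def)
        with lower[OF _ that] show "- q (- x) \<le> p x" by fastforce
      qed
      have "sublinear_on X ?u"
      proof (rule sublinear_on_INF[OF X False bdd])
        fix p p' x y assume p: "p \<in> C" "p' \<in> C" "x \<in> X" "y \<in> X"
        have sub: "r (x + y) \<le> r x + r y" if "r \<in> C" for r
          using that CA p(3,4) by (auto simp: A_def sublinear_on_def)
        from chain[OF p(1,2)] show "\<exists>k\<in>C. k (x + y) \<le> p x + p' y"
        proof
          assume "p \<le> p'"
          then have "p y \<le> p' y" by (rule le_funD)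
          then show ?thesis using sub[OF p(1)] p(1) by (intro bexI[of _ p]) auto
        next
          assume "p' \<le> p"
          then have "p' x \<le> p x" by (rule le_funD)
          then show ?thesis using sub[OF p(2)] p(2) by (intro bexI[of _ p']) auto
        qed
      next
        fix p x and s :: real assume p: "p \<in> C" "x \<in> X" "0 < s"
        then have "p (s *\<^sub>R x) = s * p x" using CA by (auto simp: A_def sublinear_on_def)
        with p show "\<exists>k\<in>C. k (s *\<^sub>R x) \<le> s * p x" by (intro bexI[of _ p]) auto
      qed
      moreover have u_le: "?u x \<le> p x" if "p \<in> C" "x \<in> X" for p x
        by (rule cINF_lower[OF bdd[OF that(2)] that(1)])
      moreover have "?u x \<le> q x" if "x \<in> X" for x
      proof -
        obtain p where p: "p \<in> C" using False by blast
        then have "p x \<le> q x" using CA that by (auto simp: A_def)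
        with u_le[OF p that] show ?thesis by simp
      qed
      ultimately have "(\<lambda>x. if x \<in> X then ?u x else 0) \<in> A" using restrict by (auto simp: A_def)
      moreover have "(\<lambda>x. if x \<in> X then ?u x else 0) \<le> p" if "p \<in> C" for p
      proof (rule le_funI)
        fix x show "(if x \<in> X then ?u x else 0) \<le> p x"
          using u_le[OF that, of x] that CA by (auto simp: A_def)
      qed
      ultimately show ?thesis by blast
    qed
  qed
  then obtain p where p: "p \<in> A" and min: "\<And>a. a \<in> A \<Longrightarrow> a \<le> p \<Longrightarrow> a = p" by blast
  have sub: "sublinear_on X p" using p by (simp add: A_def)
  have p_add: "p (x + y) \<le> p x + p y" if "x \<in> X" "y \<in> X" for x y
    using that sub by (auto simp: sublinear_on_def)
  have p_scale: "p (s *\<^sub>R x) = s * p x" if "x \<in> X" "0 \<le> s" for x s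
    using that sub sublinear_on_0[OF sub] mem by (cases "s = 0") (auto simp: sublinear_on_def)
  have super: "p x + p y \<le> p (x + y)" if x: "x \<in> X" and y: "y \<in> X" for x y
  proof -
    let ?g = "\<lambda>t x. p (x + t *\<^sub>R y) - t * p y"
    let ?r = "\<lambda>x. INF t\<in>{0..}. ?g t x"
    have bdd: "bdd_below ((\<lambda>t. ?g t x) ` {0..})" if x: "x \<in> X" for x
    proof (rule bdd_belowI2)
      fix t :: real assume t: "t \<in> {0..}"
      have "p (x + t *\<^sub>R y + - x) \<le> p (x + t *\<^sub>R y) + p (- x)" using x y mem by (intro p_add) auto
      then show "- p (- x) \<le> ?g t x" using p_scale[OF y, of t] t by simp
    qed
    have "sublinear_on X ?r"
    proof (rule sublinear_on_INF[OF X _ bdd])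
      fix s t :: real and a b assume st: "s \<in> {0..}" "t \<in> {0..}" and ab: "a \<in> X" "b \<in> X"
      have "p ((a + s *\<^sub>R y) + (b + t *\<^sub>R y)) \<le> p (a + s *\<^sub>R y) + p (b + t *\<^sub>R y)"
        using ab y mem by (intro p_add) auto
      then have "?g (s + t) (a + b) \<le> ?g s a + ?g t b" by (simp add: algebra_simps)
      then show "\<exists>k\<in>{0..}. ?g k (a + b) \<le> ?g s a + ?g t b" using st by (intro bexI[of _ "s + t"]) auto
    next
      fix t s :: real and a assume t: "t \<in> {0..}" and a: "a \<in> X" and s: "0 < s"
      have "p (s *\<^sub>R (a + t *\<^sub>R y)) = s * p (a + t *\<^sub>R y)"
        using a y mem s by (intro p_scale) auto
      then have "?g (s * t) (s *\<^sub>R a) \<le> s * ?g t a" by (simp add: algebra_simps)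
      then show "\<exists>k\<in>{0..}. ?g k (s *\<^sub>R a) \<le> s * ?g t a" using t s by (intro bexI[of _ "s * t"]) auto
    qed auto
    moreover have r_le: "?r a \<le> p a" if "a \<in> X" for a
      using cINF_lower[OF bdd[OF that], of 0] by simp
    moreover have "p a \<le> q a" if "a \<in> X" for a using p that by (simp add: A_def)
    ultimately have "(\<lambda>x. if x \<in> X then ?r x else 0) \<in> A"
      using restrict unfolding A_def by (auto intro: order_trans)
    moreover have "(\<lambda>x. if x \<in> X then ?r x else 0) \<le> p"
      using r_le p by (auto simp: le_fun_def A_def)
    ultimately have "(\<lambda>x. if x \<in> X then ?r x else 0) = p" by (rule min)
    from fun_cong[OF this, of x] x have "p x = ?r x" by simp
    also have "\<dots> \<le> ?g 1 x" by (rule cINF_lower[OF bdd[OF x]]) simp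
    finally show ?thesis by simp
  qed
  have add_eq: "p (x + y) = p x + p y" if "x \<in> X" "y \<in> X" for x y
    using p_add[OF that] super[OF that] by simp
  have neg: "p (- x) = - p x" if "x \<in> X" for x
    using add_eq[of x "- x"] that mem sublinear_on_0[OF sub] by simp
  have scale_eq: "p (a *\<^sub>R x) = a * p x" if "x \<in> X" for a x
    using p_scale[OF that, of a] p_scale[of "- x" "- a"] neg[OF that] that mem by (cases "0 \<le> a") auto
  have "linear_on_subspace X p"
    unfolding linear_on_subspace_def using add_eq scale_eq mem by simp
  then show thesis using p by (intro that) (auto simp: A_def)
qed

context complete_seminorms
begin

text \<open>The functional is obtained from the infimal convolution of the positively homogeneous hull of
  \<open>G - c\<close> with a multiple of the seminorm.\<close>

lemma subgradient:
  assumes G: "convex G" "G \<subseteq> L \<times> UNIV" and L: "subspace L" "L \<subseteq> X"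
    and low: "\<And>r. (0, r) \<in> G \<Longrightarrow> c \<le> r"
    and ball: "0 < \<epsilon>" "\<And>e. e \<in> L \<Longrightarrow> nrm k e \<le> \<epsilon> \<Longrightarrow> (e, n) \<in> G"
  obtains l C where "linear_on_subspace X l" "\<And>x. x \<in> X \<Longrightarrow> l x \<le> C * nrm k x"
    "\<And>d r. (d, r) \<in> G \<Longrightarrow> c + l d \<le> r"
proof -
  have zero: "(0, n) \<in> G" using ball(2)[of 0] ball(1) L(1) by (simp add: subspace_0)
  have nc: "c \<le> n" using low zero by blast
  \<comment> \<open>Slope of the segment from height \<open>c\<close> at the origin to height
    \<open>n\<close> at distance \<open>\<epsilon>\<close>.\<close>
  define C where "C = (n - c) / \<epsilon>"
  have C0: "0 \<le> C" using nc ball(1) by (simp add: C_def)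
  have GX: "d \<in> X" "d \<in> L" if "(d, r) \<in> G" for d r using that G(2) L(2) by auto
  have below: "- C * nrm k d \<le> r - c" if d: "(d, r) \<in> G" for d r
  proof -
    \<comment> \<open>The origin is a convex combination of \<open>d\<close> and the point
      \<open>(- s) *\<^sub>R d\<close> of the ball, above which the height \<open>n\<close> is
      available; comparison with the lower bound \<open>c\<close> at the origin gives the
      estimate.\<close>
    have *: "- (n - c) \<le> s * (r - c)" if s: "0 < s" "s * nrm k d \<le> \<epsilon>" for s
    proof -
      have "((- s) *\<^sub>R d, n) \<in> G"
        using GX[OF d] L(1) s by (intro ball(2)) (simp_all add: nrm_scale nrm_minus subspace_scale subspace_neg)
      from convexD[OF G(1) d this, of "s/(1+s)" "1/(1+s)"]
      have "(0, (s * r + n) / (1 + s)) \<in> G"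
        using s by (simp add: zero_prod_def add_divide_distrib[symmetric] add.commute)
      from low[OF this] s show ?thesis by (simp add: field_simps)
    qed
    have N: "0 \<le> nrm k d" using GX[OF d] by simp
    show ?thesis
    proof (cases "nrm k d = 0")
      case True
      have "c \<le> r"
      proof (rule ccontr)
        assume "\<not> c \<le> r"
        \<comment> \<open>When the seminorm of \<open>d\<close> vanishes every positive
          \<open>s\<close> is admissible; this one violates the bound \<open>- (n - c)\<close> by
          one.\<close>
        then have "((n - c + 1) / (c - r)) * (r - c) = - (n - c + 1)" by (simp add: field_simps)
        moreover have "0 < (n - c + 1) / (c - r)" using \<open>\<not> c \<le> r\<close> nc by simp
        ultimately show False using *[of "(n - c + 1) / (c - r)"] True ball(1) by simp
      qed
      then show ?thesis using True by simp
    next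
      case False
      with N have pos: "0 < nrm k d" by simp
      have "- (n - c) \<le> \<epsilon> / nrm k d * (r - c)" by (rule *) (use pos ball(1) in auto)
      then have "- (n - c) * nrm k d \<le> \<epsilon> * (r - c)" using pos by (simp add: field_simps)
      then show ?thesis using ball(1) by (simp add: C_def field_simps)
    qed
  qed
  \<comment> \<open>A triple \<open>(s, d, r)\<close> stands for the point
    \<open>s *\<^sub>R (d, r - c)\<close> of the cone generated by \<open>G\<close> lowered by
    \<open>c\<close>. The sum of two such points has the factor \<open>s + s'\<close> and an
    averaged base point, which lies in \<open>G\<close> by convexity.\<close>
  define I where "I = {0::real<..} \<times> G"
  define g where "g = (\<lambda>(s::real, d, r) e. s * (r - c) + C * nrm k (e - s *\<^sub>R d))"
  let ?q = "\<lambda>e. INF i\<in>I. g i e"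
  have bdd: "bdd_below ((\<lambda>i. g i e) ` I)" if e: "e \<in> X" for e
  proof (rule bdd_belowI2)
    fix i assume "i \<in> I"
    then obtain s d r where i: "i = (s, d, r)" "0 < s" "(d, r) \<in> G" by (auto simp: I_def)
    have d: "d \<in> X" using GX i by blast
    have "s * nrm k d \<le> nrm k e + nrm k (e - s *\<^sub>R d)"
      using nrm_triangle_via[of "s *\<^sub>R d" e 0 k] nrm_commute[of e "s *\<^sub>R d" k] d e i by (simp add: nrm_scale)
    then have "C * (s * nrm k d) \<le> C * (nrm k e + nrm k (e - s *\<^sub>R d))" using C0 by (rule mult_left_mono)
    moreover have "s * (- C * nrm k d) \<le> s * (r - c)" using i(2) by (intro mult_left_mono below[OF i(3)]) auto
    ultimately show "- C * nrm k e \<le> g i e" by (simp add: g_def i algebra_simps)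
  qed
  have "sublinear_on X ?q"
  proof (rule sublinear_on_INF[OF subspace_X _ bdd])
    show "I \<noteq> {}" using zero by (auto simp: I_def)
  next
    fix i j x y assume ij: "i \<in> I" "j \<in> I" and xy: "x \<in> X" "y \<in> X"
    obtain s d r where i: "i = (s, d, r)" "0 < s" "(d, r) \<in> G" using ij by (auto simp: I_def)
    obtain s' d' r' where j: "j = (s', d', r')" "0 < s'" "(d', r') \<in> G" using ij by (auto simp: I_def)
    have d: "d \<in> X" "d' \<in> X" using GX i j by blast+
    define d'' where "d'' = (s/(s+s')) *\<^sub>R d + (s'/(s+s')) *\<^sub>R d'"
    define r'' where "r'' = (s/(s+s')) * r + (s'/(s+s')) * r'"
    have G'': "(d'', r'') \<in> G"
      using convexD[OF G(1) i(3) j(3), of "s/(s+s')" "s'/(s+s')"] i(2) j(2)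
      by (simp add: d''_def r''_def add_divide_distrib[symmetric])
    have w: "(s + s') * (s/(s+s')) = s" "(s + s') * (s'/(s+s')) = s'" using i(2) j(2) by auto
    have "(s + s') * r'' = ((s + s') * (s/(s+s'))) * r + ((s + s') * (s'/(s+s'))) * r'"
      unfolding r''_def by (simp only: distrib_left mult.assoc)
    then have "(s + s') * r'' = s * r + s' * r'" unfolding w .
    then have sd: "(s + s') *\<^sub>R d'' = s *\<^sub>R d + s' *\<^sub>R d'" and sr: "(s + s') * (r'' - c) = s * (r - c) + s' * (r' - c)"
      unfolding d''_def scaleR_add_right scaleR_scaleR w by (simp_all add: algebra_simps)
    have "nrm k (x + y - (s + s') *\<^sub>R d'') \<le> nrm k (x - s *\<^sub>R d) + nrm k (y - s' *\<^sub>R d')"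
      using nrm_triangle[of "x - s *\<^sub>R d" "y - s' *\<^sub>R d'" k] d xy
      unfolding sd by (simp add: algebra_simps)
    then have "C * nrm k (x + y - (s + s') *\<^sub>R d'') \<le> C * (nrm k (x - s *\<^sub>R d) + nrm k (y - s' *\<^sub>R d'))"
      using C0 by (rule mult_left_mono)
    then have "g (s + s', d'', r'') (x + y) \<le> g i x + g j y"
      unfolding g_def i j prod.case sr by (simp only: distrib_left)
    moreover have "(s + s', d'', r'') \<in> I" using G'' i j by (simp add: I_def)
    ultimately show "\<exists>k\<in>I. g k (x + y) \<le> g i x + g j y" by blast
  next
    fix i x and t :: real assume ix: "i \<in> I" "x \<in> X" "0 < t"
    obtain s d r where i: "i = (s, d, r)" "0 < s" "(d, r) \<in> G" using ix by (auto simp: I_def)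
    have "nrm k (t *\<^sub>R x - (t * s) *\<^sub>R d) = t * nrm k (x - s *\<^sub>R d)"
      using nrm_scale[of "x - s *\<^sub>R d" k t] GX[OF i(3)] ix by (simp add: scaleR_diff_right)
    then have "g (t * s, d, r) (t *\<^sub>R x) \<le> t * g i x" by (simp add: g_def i algebra_simps)
    moreover have "(t * s, d, r) \<in> I" using i ix by (simp add: I_def)
    ultimately show "\<exists>k\<in>I. g k (t *\<^sub>R x) \<le> t * g i x" by blast
  qed
  from hahn_banach[OF subspace_X this] obtain l
    where l: "linear_on_subspace X l" "\<And>x. x \<in> X \<Longrightarrow> l x \<le> ?q x" by blast
  have l_le: "l x \<le> s * (r - c) + C * nrm k (x - s *\<^sub>R d)" if "x \<in> X" "0 < s" "(d, r) \<in> G" for x s d r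
  proof -
    have "?q x \<le> g (s, d, r) x" using that by (intro cINF_lower[OF bdd]) (auto simp: I_def)
    with l(2)[OF that(1)] show ?thesis by (simp add: g_def)
  qed
  show thesis
  proof (rule that[OF l(1)])
    fix x assume x: "x \<in> X"
    have "l x \<le> C * nrm k x + e" if e: "0 < e" for e
    proof -
      \<comment> \<open>The point \<open>(0, n)\<close> of \<open>G\<close> with a small factor
        costs at most \<open>e\<close>; the added 1 keeps the denominator positive when
        \<open>n = c\<close>.\<close>
      have "l x \<le> e / (n - c + 1) * (n - c) + C * nrm k x"
        using l_le[OF x _ zero, of "e / (n - c + 1)"] e nc by simp
      also have "e / (n - c + 1) * (n - c) \<le> e" using e nc by (simp add: field_simps)
      finally show ?thesis by simp
    qed
    then show "l x \<le> C * nrm k x" by (rule field_le_epsilon)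
  next
    fix d r assume d: "(d, r) \<in> G"
    show "c + l d \<le> r" using l_le[OF GX(1)[OF d], of 1 d r] d by simp
  qed
qed

section \<open>The topology generated by the seminorms and its continuous functionals\<close>

definition seminorm_topology :: "'a topology" where
  "seminorm_topology = topology_generated_by {{x'\<in>X. \<rho> k (x' - x) < \<epsilon>} | k x \<epsilon>. x \<in> X \<and> 0 < \<epsilon>}"

lemma rho_triangle: "x \<in> X \<Longrightarrow> y \<in> X \<Longrightarrow> \<rho> k (x + y) \<le> \<rho> k x + \<rho> k y"
  using seminorm unfolding seminorm_on_def by blast

lemma rho_0: "\<rho> k 0 = 0"
  using rho_nonneg[of 0 k] rho_le_nrm[of 0 k] by simp

lemma topspace_seminorm_topology: "topspace seminorm_topology = X"
proof -
  have "\<Union> {{x'\<in>X. \<rho> k (x' - x) < \<epsilon>} | k x \<epsilon>. x \<in> X \<and> 0 < \<epsilon>} = X"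
  proof
    show "X \<subseteq> \<Union> {{x'\<in>X. \<rho> k (x' - x) < \<epsilon>} | k x \<epsilon>. x \<in> X \<and> 0 < \<epsilon>}"
    proof
      fix x assume x: "x \<in> X"
      then have "x \<in> {x'\<in>X. \<rho> 0 (x' - x) < 1}" by (simp add: rho_0)
      moreover have "{x'\<in>X. \<rho> 0 (x' - x) < 1} \<in> {{x'\<in>X. \<rho> k (x' - x) < \<epsilon>} | k x \<epsilon>. x \<in> X \<and> 0 < \<epsilon>}"
        using x zero_less_one by blast
      ultimately show "x \<in> \<Union> {{x'\<in>X. \<rho> k (x' - x) < \<epsilon>} | k x \<epsilon>. x \<in> X \<and> 0 < \<epsilon>}"
        by (rule UnionI[rotated])
    qed
  qed auto
  then show ?thesis
    by (simp add: seminorm_topology_def topology_generated_by_topspace)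
qed

text \<open>Induction along the generation of the topology: finite intersections and unions preserve
  membership from some index on, and the generating balls yield to the triangle inequality.
  Closedness and continuity thereby become statements about sequences.\<close>

lemma openin_converges:
  assumes "openin seminorm_topology W" "x \<in> W" "converges s x" "\<And>i. s i \<in> X"
  shows "\<forall>\<^sub>F i in sequentially. s i \<in> W"
proof -
  have "generate_topology_on {{x'\<in>X. \<rho> k (x' - x) < \<epsilon>} | k x \<epsilon>. x \<in> X \<and> 0 < \<epsilon>} W"
    using assms(1) by (simp add: seminorm_topology_def openin_topology_generated_by_iff)
  then show ?thesis
    using assms(2)
  proof (induction rule: generate_topology_on.induct)
    case (UN K)
    then obtain k where k: "k \<in> K" "x \<in> k" by blast
    from UN.IH[OF k] show ?case by eventually_elim (use k in blast)
  next
    case (Basis S)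
    then obtain k c \<epsilon> where S: "S = {x'\<in>X. \<rho> k (x' - c) < \<epsilon>}" "c \<in> X" by auto
    with Basis have x: "x \<in> X" "\<rho> k (x - c) < \<epsilon>" by auto
    have "\<forall>\<^sub>F i in sequentially. \<rho> k (s i - x) < \<epsilon> - \<rho> k (x - c)"
      using assms(3) x unfolding converges_def by (intro order_tendstoD(2)[of _ 0]) auto
    then show ?case
    proof eventually_elim
      case (elim i)
      then show ?case using rho_triangle[of "s i - x" "x - c" k] assms(4)[of i] x S by simp
    qed
  qed (auto simp: eventually_conj_iff)
qed

lemma closedin_converges:
  assumes "closedin seminorm_topology C" "\<And>i. s i \<in> C" "x \<in> X" "converges s x"
  shows "x \<in> C"
proof (rule ccontr)
  assume "x \<notin> C"
  have C: "C \<subseteq> X" "openin seminorm_topology (X - C)"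
    using assms(1) by (auto simp: closedin_def topspace_seminorm_topology)
  have "\<forall>\<^sub>F i in sequentially. s i \<in> X - C"
    by (rule openin_converges[OF C(2) _ assms(4)]) (use \<open>x \<notin> C\<close> assms C in auto)
  then show False using assms(2) by (auto dest: eventually_happens')
qed

lemma topological_dual_linear:
  "l \<in> topological_dual X seminorm_topology \<Longrightarrow> linear_on_subspace X l"
  by (simp add: topological_dual_def linear_on_subspace_def)

lemma topological_dual_converges:
  assumes "l \<in> topological_dual X seminorm_topology" "\<And>i. s i \<in> X" "x \<in> X" "converges s x"
  shows "(\<lambda>i. l (s i)) \<longlonglongrightarrow> l x"
proof (rule topological_tendstoI)
  fix S :: "real set" assume S: "open S" "l x \<in> S"
  have "continuous_map seminorm_topology euclideanreal l" using assms(1) by (simp add: topological_dual_def)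
  then have "openin seminorm_topology {x\<in>X. l x \<in> S}"
    using S(1) by (auto simp: continuous_map_def topspace_seminorm_topology)
  from openin_converges[OF this _ assms(4,2)] show "\<forall>\<^sub>F i in sequentially. l (s i) \<in> S"
    using S assms(3) by (auto elim: eventually_mono)
qed

text \<open>Balls are symmetric, so an upper bound on a ball bounds the absolute value as well;
  scaling turns this into smallness near zero and hence continuity.\<close>

lemma topological_dualI:
  assumes lin: "linear_on_subspace X l" and e: "0 < e"
    and bound: "\<And>x. x \<in> X \<Longrightarrow> nrm k x \<le> e \<Longrightarrow> l x \<le> B"
  shows "l \<in> topological_dual X seminorm_topology"
proof -
  have l_diff: "l (x - y) = l x - l y" and l_scale: "l (a *\<^sub>R x) = a * l x" if "x \<in> X" "y \<in> X" for x y a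
    using lin[unfolded linear_on_subspace_def, rule_format, of x y 1 "-1"]
      lin[unfolded linear_on_subspace_def, rule_format, of x x a 0] that by simp_all
  define C where "C = max B 1"
  have C: "0 < C" and bound': "\<And>x. x \<in> X \<Longrightarrow> nrm k x \<le> e \<Longrightarrow> l x \<le> C" using bound by (force simp: C_def)+
  have small: "\<bar>l x\<bar> < \<delta>" if x: "x \<in> X" "nrm k x < \<delta> * e / C" and \<delta>: "0 < \<delta>" for x \<delta>
  proof -
    \<comment> \<open>A number strictly between zero and \<open>\<delta>\<close>, even when the
      seminorm of \<open>x\<close> vanishes: division by \<open>t\<close> makes sense and the final
      inequality is strict.\<close>
    obtain t where t: "0 < t" "t < \<delta>" "nrm k x \<le> t * e / C"
    proof
      define a where "a = nrm k x * C / e"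
      let ?t = "(a + \<delta>) / 2"
      have "a < \<delta>" using x(2) C e by (simp add: a_def field_simps)
      moreover have N: "0 \<le> a" using x(1) C e by (simp add: a_def)
      ultimately show "0 < ?t" "?t < \<delta>" using \<delta> by simp_all
      have "a \<le> ?t" using \<open>a < \<delta>\<close> by simp
      then have "a * (e / C) \<le> ?t * (e / C)" by (rule mult_right_mono) (use C e in simp)
      then show "nrm k x \<le> ?t * e / C" using C e by (simp add: a_def)
    qed
    have "nrm k ((C / t) *\<^sub>R x) \<le> e" "nrm k ((- (C / t)) *\<^sub>R x) \<le> e"
      using x(1) t(1,3) C by (simp_all only: nrm_scale) (simp_all add: field_simps)
    then have "l ((C / t) *\<^sub>R x) \<le> C" "l ((- (C / t)) *\<^sub>R x) \<le> C" using x(1) by (auto intro!: bound')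
    then have "C * l x \<le> C * t" "C * (- l x) \<le> C * t"
      unfolding l_scale[OF x(1) x(1)] using t(1) by (simp_all add: field_simps)
    then have "\<bar>l x\<bar> \<le> t" unfolding mult_le_cancel_left_pos[OF C] by linarith
    then show ?thesis using t by simp
  qed
  have "openin seminorm_topology {x\<in>X. l x \<in> S}" if S: "open S" for S
  proof (subst openin_subopen, intro ballI)
    fix x assume "x \<in> {x\<in>X. l x \<in> S}"
    then have x: "x \<in> X" "l x \<in> S" by auto
    obtain \<delta> where \<delta>: "0 < \<delta>" "ball (l x) \<delta> \<subseteq> S" using S x(2) by (meson open_contains_ball)
    \<comment> \<open>\<open>nrm k\<close> has \<open>k + 1\<close> summands, each of which gets an
      equal share.\<close>
    define d where "d = \<delta> * e / C / (real k + 1)"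
    have d0: "0 < d" using \<delta> e C by (simp add: d_def)
    let ?T = "\<Inter>j\<in>{..k}. {x'\<in>X. \<rho> j (x' - x) < d}"
    have "openin seminorm_topology {x'\<in>X. \<rho> j (x' - x) < d}" for j
      unfolding seminorm_topology_def by (rule topology_generated_by_Basis) (use x d0 in blast)
    then have "openin seminorm_topology ?T" by (intro openin_Inter) auto
    moreover have "x \<in> ?T" using x d0 by (simp add: rho_0)
    moreover have "?T \<subseteq> {x\<in>X. l x \<in> S}"
    proof
      fix y assume y: "y \<in> ?T"
      then have yX: "y \<in> X" by auto
      have "nrm k (y - x) < (\<Sum>j\<le>k. d)" unfolding nrm_def by (rule sum_strict_mono) (use y in auto)
      also have "\<dots> = \<delta> * e / C" by (simp add: d_def add.commute)
      finally have "\<bar>l (y - x)\<bar> < \<delta>" using small[of "y - x"] x yX \<delta> by simp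
      then have "l y \<in> ball (l x) \<delta>" using l_diff[OF yX x(1)] by (simp add: dist_real_def)
      with \<delta> yX show "y \<in> {x\<in>X. l x \<in> S}" by auto
    qed
    ultimately show "\<exists>T. openin seminorm_topology T \<and> x \<in> T \<and> T \<subseteq> {x\<in>X. l x \<in> S}" by blast
  qed
  then have "continuous_map seminorm_topology euclideanreal l"
    by (auto simp: continuous_map_def topspace_seminorm_topology)
  with lin show ?thesis by (simp add: topological_dual_def linear_on_subspace_def)
qed

end

section \<open>Normal integrands\<close>

lemma infdist_closest_point:
  "closed S \<Longrightarrow> S \<noteq> {} \<Longrightarrow> infdist q S = norm (q - closest_point S q)"
  by (simp add: infdist_eq_setdist setdist_closest_point dist_norm)

text \<open>The projection onto a convex set \<open>S\<close> is the gradient of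
  \<open>q \<mapsto> (|q|\<^sup>2 - infdist q S\<^sup>2) / 2\<close>, a limit of difference quotients of functions that depend
  measurably on \<open>S\<close>.\<close>

lemma measurable_closest_point:
  fixes S :: "'w \<Rightarrow> 'b::euclidean_space set"
  assumes closed: "\<And>\<omega>. \<omega> \<in> space M \<Longrightarrow> closed (S \<omega>)" and convex: "\<And>\<omega>. \<omega> \<in> space M \<Longrightarrow> convex (S \<omega>)"
    and meas: "\<And>W. open W \<Longrightarrow> {\<omega>\<in>space M. S \<omega> \<inter> W \<noteq> {}} \<in> sets M"
  shows "(\<lambda>\<omega>. if S \<omega> = {} then 0 else closest_point (S \<omega>) q) \<in> borel_measurable M"
proof (subst borel_measurable_euclidean_space, intro ballI)
  fix i :: 'b assume "i \<in> Basis"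
  have ne: "{\<omega>\<in>space M. S \<omega> \<noteq> {}} \<in> sets M" using meas[of UNIV] by simp
  then have "space M - {\<omega>\<in>space M. S \<omega> \<noteq> {}} \<in> sets M" by blast
  also have "space M - {\<omega>\<in>space M. S \<omega> \<noteq> {}} = {\<omega>\<in>space M. S \<omega> = {}}" by auto
  finally have empty [measurable]: "Measurable.pred M (\<lambda>\<omega>. S \<omega> = {})" by (simp add: pred_def)
  have [measurable]: "(\<lambda>\<omega>. infdist q (S \<omega>)) \<in> borel_measurable M" for q
  proof (rule borel_measurableI_less)
    fix r
    \<comment> \<open>The distance to the empty set is zero by convention, whence the second
      set.\<close>
    have "{\<omega>\<in>space M. infdist q (S \<omega>) < r} =
      {\<omega>\<in>space M. S \<omega> \<inter> ball q r \<noteq> {}} \<union> {\<omega>\<in>space M. S \<omega> = {} \<and> 0 < r}"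
    proof -
      have "infdist q (S \<omega>) < r \<longleftrightarrow> S \<omega> \<inter> ball q r \<noteq> {}" if "S \<omega> \<noteq> {}" for \<omega>
      proof -
        have "infdist q (S \<omega>) < r \<longleftrightarrow> (\<exists>x\<in>S \<omega>. dist q x < r)"
          unfolding infdist_notempty[OF that] by (rule cINF_less_iff) (use that in auto)
        then show ?thesis by auto
      qed
      then show ?thesis by (auto simp: infdist_def)
    qed
    then show "{\<omega>\<in>space M. infdist q (S \<omega>) < r} \<in> sets M" using meas[of "ball q r"] by simp
  qed
  \<comment> \<open>Where \<open>S \<omega>\<close> is nonempty, \<open>g \<omega> q\<close> is the
    supremum of \<open>q \<bullet> s - (s \<bullet> s) / 2\<close> over its points \<open>s\<close>,
    attained at the projection of \<open>q\<close>. Hence the projections at \<open>q\<close> and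
    \<open>q + h\<close> bound the increment of \<open>g\<close> from below and from above.\<close>
  define g where "g \<omega> q = (q \<bullet> q) / 2 - (infdist q (S \<omega>))\<^sup>2 / 2" for \<omega> and q :: 'b
  define u where "u n \<omega> = (if S \<omega> = {} then 0 else real (Suc n) * (g \<omega> (q + (1 / real (Suc n)) *\<^sub>R i) - g \<omega> q))" for n \<omega>
  have "(\<lambda>\<omega>. (if S \<omega> = {} then 0 else closest_point (S \<omega>) q \<bullet> i)) \<in> borel_measurable M"
  proof (rule borel_measurable_LIMSEQ_real)
    show "u n \<in> borel_measurable M" for n unfolding u_def g_def by measurable
    fix \<omega> assume \<omega>: "\<omega> \<in> space M"
    show "(\<lambda>n. u n \<omega>) \<longlonglongrightarrow> (if S \<omega> = {} then 0 else closest_point (S \<omega>) q \<bullet> i)"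
    proof (cases "S \<omega> = {}")
      case False
      define P where "P = closest_point (S \<omega>)"
      have PS: "P q \<in> S \<omega>" for q using closest_point_in_set[OF closed[OF \<omega>] False] by (simp add: P_def)
      have g_eq: "g \<omega> q = q \<bullet> P q - (P q \<bullet> P q) / 2" for q
        unfolding g_def infdist_closest_point[OF closed[OF \<omega>] False] P_def[symmetric]
        by (simp add: power2_norm_eq_inner inner_diff inner_commute field_simps)
      have g_ge: "q \<bullet> s - (s \<bullet> s) / 2 \<le> g \<omega> q" if "s \<in> S \<omega>" for q s
      proof -
        have "infdist q (S \<omega>) \<le> norm (q - s)" using infdist_le[OF that, of q] by (simp add: dist_norm)
        then have "(infdist q (S \<omega>))\<^sup>2 \<le> (norm (q - s))\<^sup>2" by (intro power_mono infdist_nonneg)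
        then show ?thesis by (simp add: g_def power2_norm_eq_inner inner_diff inner_commute field_simps)
      qed
      have lower: "h \<bullet> P q \<le> g \<omega> (q + h) - g \<omega> q" for h q
        using g_ge[OF PS[of q], of "q + h"] by (simp add: g_eq[of q] inner_add_left)
      have upper: "g \<omega> (q + h) - g \<omega> q \<le> h \<bullet> P (q + h)" for h q
        using lower[of "- h" "q + h"] by simp
      let ?h = "\<lambda>n. (1 / real (Suc n)) *\<^sub>R i"
      have u_eq: "u n \<omega> = real (Suc n) * (g \<omega> (q + ?h n) - g \<omega> q)" for n using False by (simp add: u_def)
      have l: "P q \<bullet> i \<le> u n \<omega>" for n
        using mult_left_mono[OF lower[of "?h n" q], of "real (Suc n)"] by (simp add: u_eq inner_commute)
      have r: "u n \<omega> \<le> P (q + ?h n) \<bullet> i" for n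
        using mult_left_mono[OF upper[of q "?h n"], of "real (Suc n)"] by (simp add: u_eq inner_commute)
      have "(\<lambda>n. q + ?h n) \<longlonglongrightarrow> q + 0 *\<^sub>R i"
        by (intro tendsto_intros LIMSEQ_Suc[OF lim_1_over_n])
      then have "(\<lambda>n. P (q + ?h n)) \<longlonglongrightarrow> P q"
        using isCont_tendsto_compose[OF continuous_at_closest_point[OF convex[OF \<omega>] closed[OF \<omega>] False]]
        by (simp add: P_def)
      then have "(\<lambda>n. P (q + ?h n) \<bullet> i) \<longlonglongrightarrow> P q \<bullet> i" by (intro tendsto_intros)
      then have "(\<lambda>n. u n \<omega>) \<longlonglongrightarrow> P q \<bullet> i"
        by (rule tendsto_sandwich[OF _ _ tendsto_const, rotated 2]) (use l r in auto)
      then show ?thesis using False by (simp add: P_def)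
    qed (simp add: u_def)
  qed
  also have "(\<lambda>\<omega>. (if S \<omega> = {} then 0 else closest_point (S \<omega>) q \<bullet> i)) =
    (\<lambda>\<omega>. (if S \<omega> = {} then 0 else closest_point (S \<omega>) q) \<bullet> i)" by auto
  finally show "(\<lambda>\<omega>. (if S \<omega> = {} then 0 else closest_point (S \<omega>) q) \<bullet> i) \<in> borel_measurable M" .
qed

text \<open>Projecting a countable dense set onto \<open>S \<omega>\<close> gives a dense subset of
  it, since the projection onto a closed convex set is nonexpansive and fixes the points of the
  set.\<close>

lemma castaing_representation:
  fixes S :: "'w \<Rightarrow> 'b::euclidean_space set"
  assumes closed: "\<And>\<omega>. \<omega> \<in> space M \<Longrightarrow> closed (S \<omega>)" and convex: "\<And>\<omega>. \<omega> \<in> space M \<Longrightarrow> convex (S \<omega>)"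
    and meas: "\<And>W. open W \<Longrightarrow> {\<omega>\<in>space M. S \<omega> \<inter> W \<noteq> {}} \<in> sets M"
  obtains s :: "nat \<Rightarrow> 'w \<Rightarrow> 'b" where "\<And>j. s j \<in> borel_measurable M"
    "\<And>\<omega>. \<omega> \<in> space M \<Longrightarrow> S \<omega> \<noteq> {} \<Longrightarrow> closure (range (\<lambda>j. s j \<omega>)) = S \<omega>"
proof -
  obtain D :: "'b set" where D: "countable D" "\<And>X. open X \<Longrightarrow> X \<noteq> {} \<Longrightarrow> \<exists>d\<in>D. d \<in> X"
    by (erule countable_dense_setE)
  have D0: "D \<noteq> {}" using D(2)[of UNIV] by auto
  define s where "s j \<omega> = (if S \<omega> = {} then 0 else closest_point (S \<omega>) (from_nat_into D j))" for j \<omega>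
  show thesis
  proof (rule that[of s])
    show "s j \<in> borel_measurable M" for j
      unfolding s_def by (rule measurable_closest_point[OF closed convex meas])
    fix \<omega> assume \<omega>: "\<omega> \<in> space M" and ne: "S \<omega> \<noteq> {}"
    show "closure (range (\<lambda>j. s j \<omega>)) = S \<omega>"
    proof (rule antisym)
      show "closure (range (\<lambda>j. s j \<omega>)) \<subseteq> S \<omega>"
        using ne closest_point_in_set[OF closed[OF \<omega>] ne] closed[OF \<omega>]
        by (intro closure_minimal) (auto simp: s_def)
      show "S \<omega> \<subseteq> closure (range (\<lambda>j. s j \<omega>))"
      proof
        fix x assume x: "x \<in> S \<omega>"
        show "x \<in> closure (range (\<lambda>j. s j \<omega>))"
          unfolding closure_approachable
        proof (intro allI impI)
          fix e :: real assume e: "0 < e"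
          then obtain d where d: "d \<in> D" "d \<in> ball x e" using D(2)[of "ball x e"] by auto
          then obtain j where j: "from_nat_into D j = d" using from_nat_into_surj[OF D(1)] by blast
          have "dist (s j \<omega>) x = dist (closest_point (S \<omega>) d) (closest_point (S \<omega>) x)"
            using ne closest_point_self[OF x] by (simp add: s_def j)
          also have "\<dots> \<le> dist d x" by (rule closest_point_lipschitz[OF convex[OF \<omega>] closed[OF \<omega>] ne])
          also have "\<dots> < e" using d(2) by (simp add: dist_commute)
          finally show "\<exists>y\<in>range (\<lambda>j. s j \<omega>). dist y x < e" by blast
        qed
      qed
    qed
  qed
qed

lemma epi_empty_iff: "epi g = {} \<longleftrightarrow> (\<forall>x. g x = \<infinity>)"
proof
  assume e: "epi g = {}"
  show "\<forall>x. g x = \<infinity>"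
  proof
    fix x
    have "\<not> g x \<le> ereal r" for r using e by (auto simp: epi_def)
    then show "g x = \<infinity>" by (cases "g x") auto
  qed
qed (auto simp: epi_def)

lemma normal_integrand_representation:
  fixes f :: "'w \<Rightarrow> 'a::euclidean_space \<Rightarrow> ereal"
  assumes "convex_normal_integrand M f"
  obtains \<xi> \<alpha> where "\<And>j::nat. \<xi> j \<in> borel_measurable M" "\<And>j. \<alpha> j \<in> borel_measurable M"
    "\<And>\<omega>. \<omega> \<in> space M \<Longrightarrow> epi (f \<omega>) \<noteq> {} \<Longrightarrow> epi (f \<omega>) = closure (range (\<lambda>j. (\<xi> j \<omega>, \<alpha> j \<omega>)))"
proof -
  obtain s :: "nat \<Rightarrow> 'w \<Rightarrow> 'a \<times> real" where s: "\<And>j. s j \<in> borel_measurable M"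
    "\<And>\<omega>. \<omega> \<in> space M \<Longrightarrow> epi (f \<omega>) \<noteq> {} \<Longrightarrow> closure (range (\<lambda>j. s j \<omega>)) = epi (f \<omega>)"
    by (rule castaing_representation[of M "\<lambda>\<omega>. epi (f \<omega>)"])
      (use assms in \<open>auto simp: convex_normal_integrand_def\<close>)
  show thesis
    by (rule that[of "\<lambda>j \<omega>. fst (s j \<omega>)" "\<lambda>j \<omega>. snd (s j \<omega>)"])
      (use s in \<open>auto simp: borel_prod[symmetric]\<close>)
qed

lemma pred_epi_empty:
  assumes "convex_normal_integrand M f"
  shows "Measurable.pred M (\<lambda>\<omega>. epi (f \<omega>) = {})"
proof -
  have "{\<omega>\<in>space M. epi (f \<omega>) \<inter> UNIV \<noteq> {}} \<in> sets M"
    using assms open_UNIV unfolding convex_normal_integrand_def by blast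
  then have "space M - {\<omega>\<in>space M. epi (f \<omega>) \<noteq> {}} \<in> sets M" by auto
  also have "space M - {\<omega>\<in>space M. epi (f \<omega>) \<noteq> {}} = {\<omega>\<in>space M. epi (f \<omega>) = {}}" by auto
  finally show ?thesis by (simp add: pred_def)
qed

text \<open>\<open>f \<omega> (q \<omega>) \<le> ereal r\<close> means that
  \<open>(q \<omega>, r)\<close> lies in the closed epigraph, that is, some selection comes within
  1/(n+1) of it for every \<open>n\<close>: a countable combination of measurable
  conditions.\<close>

lemma measurable_normal_integrand:
  fixes f :: "'w \<Rightarrow> 'a::euclidean_space \<Rightarrow> ereal"
  assumes f: "convex_normal_integrand M f" and [measurable]: "q \<in> borel_measurable M"
  shows "(\<lambda>\<omega>. f \<omega> (q \<omega>)) \<in> borel_measurable M"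
proof -
  obtain \<xi> \<alpha> where [measurable]: "\<And>j::nat. \<xi> j \<in> borel_measurable M" "\<And>j. \<alpha> j \<in> borel_measurable M"
    and rep: "\<And>\<omega>. \<omega> \<in> space M \<Longrightarrow> epi (f \<omega>) \<noteq> {} \<Longrightarrow> epi (f \<omega>) = closure (range (\<lambda>j. (\<xi> j \<omega>, \<alpha> j \<omega>)))"
    using normal_integrand_representation[OF f] by blast
  note [measurable] = pred_epi_empty[OF f]
  have level: "{\<omega>\<in>space M. f \<omega> (q \<omega>) \<le> ereal r} \<in> sets M" for r
  proof -
    have "{\<omega>\<in>space M. f \<omega> (q \<omega>) \<le> ereal r} =
      {\<omega>\<in>space M. epi (f \<omega>) \<noteq> {} \<and> (\<forall>n. \<exists>j. norm ((\<xi> j \<omega> - q \<omega>, \<alpha> j \<omega> - r)) < inverse (real (Suc n)))}"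
    proof (intro Collect_cong conj_cong refl)
      fix \<omega> assume \<omega>: "\<omega> \<in> space M"
      have "f \<omega> (q \<omega>) \<le> ereal r \<longleftrightarrow> (q \<omega>, r) \<in> epi (f \<omega>)" by (simp add: epi_def)
      moreover have "(q \<omega>, r) \<in> epi (f \<omega>) \<longleftrightarrow> (\<forall>n. \<exists>j. norm ((\<xi> j \<omega> - q \<omega>, \<alpha> j \<omega> - r)) < inverse (real (Suc n)))"
        if ne: "epi (f \<omega>) \<noteq> {}"
      proof -
        have "(q \<omega>, r) \<in> epi (f \<omega>) \<longleftrightarrow> (\<forall>e>0. \<exists>j. norm ((\<xi> j \<omega> - q \<omega>, \<alpha> j \<omega> - r)) < e)"
          unfolding rep[OF \<omega> ne] closure_approachable by (simp add: dist_norm)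
        also have "\<dots> \<longleftrightarrow> (\<forall>n. \<exists>j. norm ((\<xi> j \<omega> - q \<omega>, \<alpha> j \<omega> - r)) < inverse (real (Suc n)))"
        proof (intro iffI allI impI)
          fix e :: real assume e: "0 < e" and *: "\<forall>n. \<exists>j. norm ((\<xi> j \<omega> - q \<omega>, \<alpha> j \<omega> - r)) < inverse (real (Suc n))"
          obtain n where "inverse (real (Suc n)) < e" using reals_Archimedean[OF e] by blast
          with * show "\<exists>j. norm ((\<xi> j \<omega> - q \<omega>, \<alpha> j \<omega> - r)) < e" by (meson less_trans)
        qed auto
        finally show ?thesis .
      qed
      ultimately show "f \<omega> (q \<omega>) \<le> ereal r \<longleftrightarrow>
        epi (f \<omega>) \<noteq> {} \<and> (\<forall>n. \<exists>j. norm ((\<xi> j \<omega> - q \<omega>, \<alpha> j \<omega> - r)) < inverse (real (Suc n)))" by blast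
    qed
    also have "\<dots> \<in> sets M" unfolding norm_Pair by measurable
    finally show ?thesis .
  qed
  show ?thesis
    unfolding borel_measurable_iff_Iic_ereal
  proof
    fix a :: ereal
    show "(\<lambda>\<omega>. f \<omega> (q \<omega>)) -` {..a} \<inter> space M \<in> sets M"
    proof (cases a)
      case (real r)
      then show ?thesis using level[of r] by (simp add: vimage_def Int_def conj_commute)
    next
      case MInf
      have "z \<le> - \<infinity> \<longleftrightarrow> (\<forall>n::nat. z \<le> ereal (- real n))" for z
      proof
        assume *: "\<forall>n::nat. z \<le> ereal (- real n)"
        show "z \<le> - \<infinity>"
        proof (cases z)
          case (real r)
          obtain n :: nat where "- r < real n" using reals_Archimedean2 by blast
          with * real show ?thesis by (auto dest: spec[of _ n])
        qed (use * in auto)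
      qed auto
      then have "(\<lambda>\<omega>. f \<omega> (q \<omega>)) -` {..a} \<inter> space M = (\<Inter>n::nat. {\<omega>\<in>space M. f \<omega> (q \<omega>) \<le> ereal (- real n)})"
        unfolding MInf by auto
      then show ?thesis using level by auto
    next
      case PInf
      have "(\<lambda>\<omega>. f \<omega> (q \<omega>)) -` {..a} \<inter> space M = space M" unfolding PInf by auto
      then show ?thesis by simp
    qed
  qed
qed

text \<open>The conjugate is the supremum of a continuous affine function of \<open>(x, a)\<close>
  over the epigraph, so a dense subset suffices. The value \<open>g x = - \<infinity>\<close> is
  covered, as the whole vertical line over \<open>x\<close> then belongs to the epigraph.\<close>

lemma conjugate_representation:
  fixes g :: "'a::euclidean_space \<Rightarrow> ereal"
  assumes "epi g = closure (range (\<lambda>j::nat. (\<xi> j, \<alpha> j)))"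
  shows "conjugate g v = (SUP j. ereal (\<xi> j \<bullet> v - \<alpha> j))" (is "_ = ?s")
proof (rule antisym)
  have mem: "g (\<xi> j) \<le> ereal (\<alpha> j)" for j
  proof -
    have "(\<xi> j, \<alpha> j) \<in> epi g" unfolding assms by (intro subsetD[OF closure_subset]) simp
    then show ?thesis by (simp add: epi_def)
  qed
  show "?s \<le> conjugate g v"
  proof (rule SUP_least)
    fix j
    have "ereal (\<xi> j \<bullet> v - \<alpha> j) \<le> ereal (\<xi> j \<bullet> v) - g (\<xi> j)"
      using ereal_minus_mono[OF order_refl mem[of j], of "ereal (\<xi> j \<bullet> v)"] by simp
    also have "\<dots> \<le> conjugate g v" unfolding conjugate_def by (rule SUP_upper) simp
    finally show "ereal (\<xi> j \<bullet> v - \<alpha> j) \<le> conjugate g v" .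
  qed
  have *: "ereal (x \<bullet> v - a) \<le> ?s" if "(x, a) \<in> epi g" for x a
  proof (cases ?s)
    case (real r)
    have "closure (range (\<lambda>j. (\<xi> j, \<alpha> j))) \<subseteq> {p. fst p \<bullet> v - snd p \<le> r}"
    proof (rule closure_minimal)
      have "ereal (\<xi> j \<bullet> v - \<alpha> j) \<le> ereal r" for j unfolding real[symmetric] by (rule SUP_upper) simp
      then show "range (\<lambda>j. (\<xi> j, \<alpha> j)) \<subseteq> {p. fst p \<bullet> v - snd p \<le> r}" by auto
      show "closed {p. fst p \<bullet> v - snd p \<le> r}"
        by (intro closed_Collect_le continuous_intros)
    qed
    then show ?thesis using that real assms by auto
  next
    case MInf
    have "ereal (\<xi> 0 \<bullet> v - \<alpha> 0) \<le> ?s" by (rule SUP_upper) simp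
    with MInf show ?thesis by simp
  qed simp
  show "conjugate g v \<le> ?s"
    unfolding conjugate_def
  proof (rule SUP_least)
    fix x
    show "ereal (x \<bullet> v) - g x \<le> ?s"
    proof (cases "g x")
      case (real r)
      then show ?thesis using *[of x r] by (simp add: epi_def)
    next
      case MInf
      have "ereal r \<le> ?s" for r using *[of x "x \<bullet> v - r"] MInf by (simp add: epi_def)
      then have "?s = \<infinity>" by (rule ereal_top)
      then show ?thesis by simp
    qed simp
  qed
qed

lemma measurable_conjugate:
  fixes f :: "'w \<Rightarrow> 'a::euclidean_space \<Rightarrow> ereal"
  assumes f: "convex_normal_integrand M f" and [measurable]: "v \<in> borel_measurable M"
  shows "(\<lambda>\<omega>. conjugate (f \<omega>) (v \<omega>)) \<in> borel_measurable M"
proof -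
  obtain \<xi> \<alpha> where [measurable]: "\<And>j::nat. \<xi> j \<in> borel_measurable M" "\<And>j. \<alpha> j \<in> borel_measurable M"
    and rep: "\<And>\<omega>. \<omega> \<in> space M \<Longrightarrow> epi (f \<omega>) \<noteq> {} \<Longrightarrow> epi (f \<omega>) = closure (range (\<lambda>j. (\<xi> j \<omega>, \<alpha> j \<omega>)))"
    using normal_integrand_representation[OF f] by blast
  note [measurable] = pred_epi_empty[OF f]
  \<comment> \<open>An empty epigraph means that \<open>f \<omega>\<close> is constantly
    \<open>\<infinity>\<close>, with conjugate \<open>- \<infinity>\<close>; the selections carry no
    information there.\<close>
  have "(\<lambda>\<omega>. if epi (f \<omega>) = {} then - \<infinity> else (SUP j. ereal (\<xi> j \<omega> \<bullet> v \<omega> - \<alpha> j \<omega>))) \<in> borel_measurable M"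
    by measurable
  moreover have "conjugate (f \<omega>) (v \<omega>) = (if epi (f \<omega>) = {} then - \<infinity> else (SUP j. ereal (\<xi> j \<omega> \<bullet> v \<omega> - \<alpha> j \<omega>)))"
    if "\<omega> \<in> space M" for \<omega>
    using conjugate_representation[OF rep[OF that]] by (auto simp: epi_empty_iff conjugate_def)
  ultimately show ?thesis by (subst measurable_cong)
qed

lemma e2ennreal_le_iff: "0 \<le> r \<Longrightarrow> e2ennreal z \<le> ennreal r \<longleftrightarrow> z \<le> ereal r"
  by (cases z) (auto simp: ennreal_le_iff e2ennreal_neg top_unique)

text \<open>The positive part exceeds a level \<open>r \<ge> 0\<close> exactly where
  \<open>g\<close> does, so a closed epigraph makes it lower semicontinuous. This is the form in
  which Fatou's lemma meets the integrand.\<close>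

lemma e2ennreal_lsc:
  fixes g :: "'a::euclidean_space \<Rightarrow> ereal"
  assumes "closed (epi g)" "s \<longlonglongrightarrow> q"
  shows "e2ennreal (g q) \<le> liminf (\<lambda>i. e2ennreal (g (s i)))"
  unfolding le_Liminf_iff
proof (intro allI impI)
  fix y assume y: "y < e2ennreal (g q)"
  then obtain r where r: "y = ennreal r" "0 \<le> r" by (cases y) auto
  show "\<forall>\<^sub>F i in sequentially. y < e2ennreal (g (s i))"
  proof (rule ccontr)
    assume "\<not> ?thesis"
    then have "\<exists>\<^sub>F i in sequentially. g (s i) \<le> ereal r"
      by (simp add: not_eventually not_less e2ennreal_le_iff r)
    then have fr: "\<exists>\<^sub>F i in sequentially. (s i, r) \<in> epi g" by (simp add: epi_def)
    have "((\<lambda>i. (s i, r)) \<longlongrightarrow> (q, r)) sequentially" by (intro tendsto_intros assms(2))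
    moreover have "(q, r) \<in> - epi g" using y e2ennreal_le_iff[OF r(2), of "g q"] by (simp add: epi_def r(1) flip: not_le)
    ultimately have "\<forall>\<^sub>F i in sequentially. (s i, r) \<in> - epi g"
      using assms(1) by (intro topological_tendstoD[of _ "(q, r)"]) auto
    with fr show False by (simp add: frequently_def)
  qed
qed

section \<open>Integrals of extended real-valued functions and spaces of random variables\<close>

lemma ext_integral_cong_AE:
  assumes "AE \<omega> in M. g \<omega> = h \<omega>" shows "ext_integral M g = ext_integral M h"
proof -
  have "(\<integral>\<^sup>+\<omega>. e2ennreal (g \<omega>) \<partial>M) = (\<integral>\<^sup>+\<omega>. e2ennreal (h \<omega>) \<partial>M)"
    "(\<integral>\<^sup>+\<omega>. e2ennreal (- g \<omega>) \<partial>M) = (\<integral>\<^sup>+\<omega>. e2ennreal (- h \<omega>) \<partial>M)"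
    by (intro nn_integral_cong_AE; use assms in auto)+
  then show ?thesis by (simp add: ext_integral_def)
qed

lemma ext_integral_ereal:
  assumes "integrable M a" shows "ext_integral M (\<lambda>\<omega>. ereal (a \<omega>)) = ereal (\<integral>\<omega>. a \<omega> \<partial>M)"
proof -
  have fin: "(\<integral>\<^sup>+\<omega>. ennreal (a \<omega>) \<partial>M) < top" "(\<integral>\<^sup>+\<omega>. ennreal (- a \<omega>) \<partial>M) < top"
    using assms by (auto simp: real_integrable_def top.not_eq_extremum)
  have *: "enn2ereal z = ereal (enn2real z)" if "z < top" for z
    using that by (cases z) auto
  show ?thesis
    unfolding ext_integral_def real_lebesgue_integral_def[OF assms]
    using fin by (simp add: *)
qed

lemma ext_integral_mono_AE:
  assumes "AE \<omega> in M. g \<omega> \<le> h \<omega>" shows "ext_integral M g \<le> ext_integral M h"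
proof -
  have p: "(\<integral>\<^sup>+\<omega>. e2ennreal (g \<omega>) \<partial>M) \<le> (\<integral>\<^sup>+\<omega>. e2ennreal (h \<omega>) \<partial>M)"
    using assms by (intro nn_integral_mono_AE) (auto intro: e2ennreal_mono)
  have "AE \<omega> in M. e2ennreal (- h \<omega>) \<le> e2ennreal (- g \<omega>)"
    using assms by eventually_elim (simp add: e2ennreal_mono)
  then have n: "(\<integral>\<^sup>+\<omega>. e2ennreal (- h \<omega>) \<partial>M) \<le> (\<integral>\<^sup>+\<omega>. e2ennreal (- g \<omega>) \<partial>M)"
    by (rule nn_integral_mono_AE)
  show ?thesis
  proof (cases "(\<integral>\<^sup>+\<omega>. e2ennreal (h \<omega>) \<partial>M) = \<infinity>")
    case False
    then have "(\<integral>\<^sup>+\<omega>. e2ennreal (g \<omega>) \<partial>M) \<noteq> \<infinity>" using p by (auto simp: top_unique)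
    with False show ?thesis unfolding ext_integral_def
      using p n by (auto intro!: ereal_minus_mono simp: less_eq_ennreal.rep_eq)
  qed (simp add: ext_integral_def)
qed

lemma ext_integral_le:
  "integrable M a \<Longrightarrow> AE \<omega> in M. g \<omega> \<le> ereal (a \<omega>) \<Longrightarrow> ext_integral M g \<le> ereal (\<integral>\<omega>. a \<omega> \<partial>M)"
  using ext_integral_mono_AE[of g "\<lambda>\<omega>. ereal (a \<omega>)" M] by (simp add: ext_integral_ereal)

lemma ereal_le_enn2real: "e2ennreal z \<noteq> \<infinity> \<Longrightarrow> z \<le> ereal (enn2real (e2ennreal z))"
  by (cases "z \<le> 0"; cases z) (auto simp: e2ennreal_neg ennreal_neg)

text \<open>Translates between sublevel sets of the integral of the positive part, which Fatou's
  lemma shows to be closed, and integrable majorants, which suit convex combinations and pasting.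
  Nonnegativity of \<open>a\<close> makes its integral dominate that of the positive part.\<close>

lemma nn_integral_e2ennreal_le_iff:
  assumes [measurable]: "g \<in> borel_measurable M" and "0 \<le> n"
  shows "(\<integral>\<^sup>+\<omega>. e2ennreal (g \<omega>) \<partial>M) \<le> ennreal n \<longleftrightarrow>
    (\<exists>a. integrable M a \<and> (AE \<omega> in M. g \<omega> \<le> ereal (a \<omega>)) \<and> (\<forall>\<omega>. 0 \<le> a \<omega>) \<and> (\<integral>\<omega>. a \<omega> \<partial>M) \<le> n)"
proof
  assume le: "(\<integral>\<^sup>+\<omega>. e2ennreal (g \<omega>) \<partial>M) \<le> ennreal n"
  then have fin: "(\<integral>\<^sup>+\<omega>. e2ennreal (g \<omega>) \<partial>M) \<noteq> \<infinity>" by (auto simp: top_unique)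
  have AE: "AE \<omega> in M. e2ennreal (g \<omega>) \<noteq> \<infinity>" by (rule nn_integral_noteq_infinite[OF _ fin]) measurable
  let ?a = "\<lambda>\<omega>. enn2real (e2ennreal (g \<omega>))"
  have eq: "(\<integral>\<^sup>+\<omega>. ennreal (?a \<omega>) \<partial>M) = (\<integral>\<^sup>+\<omega>. e2ennreal (g \<omega>) \<partial>M)"
    by (rule nn_integral_cong_AE) (use AE in \<open>auto simp: less_top[symmetric]\<close>)
  have int: "integrable M ?a" by (rule integrableI_nonneg) (use eq fin in \<open>auto simp: less_top[symmetric]\<close>)
  moreover have "(\<integral>\<omega>. ?a \<omega> \<partial>M) \<le> n"
    using le assms(2) nn_integral_eq_integral[OF int] eq by (simp add: ennreal_le_iff)
  moreover have "AE \<omega> in M. g \<omega> \<le> ereal (?a \<omega>)" using AE by eventually_elim (rule ereal_le_enn2real)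
  ultimately show "\<exists>a. integrable M a \<and> (AE \<omega> in M. g \<omega> \<le> ereal (a \<omega>)) \<and> (\<forall>\<omega>. 0 \<le> a \<omega>) \<and> (\<integral>\<omega>. a \<omega> \<partial>M) \<le> n"
    by (intro exI[of _ ?a]) auto
next
  assume "\<exists>a. integrable M a \<and> (AE \<omega> in M. g \<omega> \<le> ereal (a \<omega>)) \<and> (\<forall>\<omega>. 0 \<le> a \<omega>) \<and> (\<integral>\<omega>. a \<omega> \<partial>M) \<le> n"
  then obtain a where a: "integrable M a" "AE \<omega> in M. g \<omega> \<le> ereal (a \<omega>)" "\<And>\<omega>. 0 \<le> a \<omega>" "(\<integral>\<omega>. a \<omega> \<partial>M) \<le> n" by blast
  have "(\<integral>\<^sup>+\<omega>. e2ennreal (g \<omega>) \<partial>M) \<le> (\<integral>\<^sup>+\<omega>. ennreal (a \<omega>) \<partial>M)"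
    by (rule nn_integral_mono_AE) (use a(2,3) in \<open>auto simp: e2ennreal_le_iff\<close>)
  also have "\<dots> = ennreal (\<integral>\<omega>. a \<omega> \<partial>M)" using a by (intro nn_integral_eq_integral) auto
  also have "\<dots> \<le> ennreal n" using a(4) by (rule ennreal_leI)
  finally show "(\<integral>\<^sup>+\<omega>. e2ennreal (g \<omega>) \<partial>M) \<le> ennreal n" .
qed

lemma ext_integral_less_infty_iff:
  assumes [measurable]: "g \<in> borel_measurable M"
  shows "ext_integral M g < \<infinity> \<longleftrightarrow> (\<exists>a. integrable M a \<and> (AE \<omega> in M. g \<omega> \<le> ereal (a \<omega>)))"
proof
  assume "ext_integral M g < \<infinity>"
  then have "(\<integral>\<^sup>+\<omega>. e2ennreal (g \<omega>) \<partial>M) \<noteq> \<infinity>" by (auto simp: ext_integral_def)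
  then obtain n where "(\<integral>\<^sup>+\<omega>. e2ennreal (g \<omega>) \<partial>M) = ennreal n" "0 \<le> n"
    by (cases "(\<integral>\<^sup>+\<omega>. e2ennreal (g \<omega>) \<partial>M)") auto
  then show "\<exists>a. integrable M a \<and> (AE \<omega> in M. g \<omega> \<le> ereal (a \<omega>))"
    using nn_integral_e2ennreal_le_iff[OF assms, of n] by auto
next
  assume "\<exists>a. integrable M a \<and> (AE \<omega> in M. g \<omega> \<le> ereal (a \<omega>))"
  then obtain a where "integrable M a" "AE \<omega> in M. g \<omega> \<le> ereal (a \<omega>)" by blast
  from ext_integral_le[OF this] show "ext_integral M g < \<infinity>" using le_less_trans by auto
qed

text \<open>Countably additive terms die out along the sets attached to a singular functional, while
  the functional keeps its value; this contrast separates the two kinds of terms throughout.\<close>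

lemma (in finite_measure) integral_vanishing_sets:
  fixes g :: "'a \<Rightarrow> real"
  assumes A: "range A \<subseteq> sets M" "decseq A" "(\<lambda>\<nu>::nat. measure M (A \<nu>)) \<longlonglongrightarrow> 0"
    and g: "integrable M g"
  shows "(\<lambda>\<nu>. \<integral>\<omega>. (if \<omega> \<in> A \<nu> then g \<omega> else 0) \<partial>M) \<longlonglongrightarrow> 0"
proof -
  have [measurable]: "A \<nu> \<in> sets M" for \<nu> using A(1) by auto
  have I: "(\<Inter>\<nu>. A \<nu>) \<in> sets M" by measurable
  have "measure M (\<Inter>\<nu>. A \<nu>) \<le> 0"
    by (rule LIMSEQ_le_const[OF A(3)]) (auto intro!: exI[of _ 0] finite_measure_mono)
  then have "(\<Inter>\<nu>. A \<nu>) \<in> null_sets M"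
    using I by (simp add: null_sets_def emeasure_eq_measure measure_le_0_iff)
  then have "AE \<omega> in M. \<omega> \<notin> (\<Inter>\<nu>. A \<nu>)" by (rule AE_not_in)
  then have AE: "AE \<omega> in M. (\<lambda>\<nu>. if \<omega> \<in> A \<nu> then g \<omega> else 0) \<longlonglongrightarrow> 0"
  proof eventually_elim
    case (elim \<omega>)
    then obtain n where n: "\<omega> \<notin> A n" by auto
    have "\<forall>\<^sub>F \<nu> in sequentially. (if \<omega> \<in> A \<nu> then g \<omega> else 0) = 0"
      using eventually_ge_at_top[of n]
    proof eventually_elim
      case (elim \<nu>)
      then have "A \<nu> \<subseteq> A n" using A(2) by (simp add: decseqD)
      with n show ?case by auto
    qed
    then show ?case by (rule tendsto_eventually)
  qed
  have "(\<lambda>\<nu>. \<integral>\<omega>. (if \<omega> \<in> A \<nu> then g \<omega> else 0) \<partial>M) \<longlonglongrightarrow> (\<integral>\<omega>. 0 \<partial>M)"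
    by (rule integral_dominated_convergence[where w="\<lambda>\<omega>. \<bar>g \<omega>\<bar>"]) (use g AE in \<open>auto\<close>)
  then show ?thesis by simp
qed

section \<open>Frechet spaces of random variables and their singular functionals\<close>

locale random_frechet_space = prob_space M + complete_seminorms X \<rho>
  for M :: "'w measure" and X :: "('w \<Rightarrow> real ^ 'k::finite) set" and \<rho> +
  fixes V :: "('w \<Rightarrow> real ^ 'k) set"
  assumes rv_X: "random_variable_space M X" and rv_V: "random_variable_space M V"
    and duality: "separating_duality M X V"
    and null: "x \<in> X \<Longrightarrow> (\<forall>k. \<rho> k x = 0) \<longleftrightarrow> (AE \<omega> in M. x \<omega> = 0)"
    and direct_sum: "dual_is_direct_sum M X V seminorm_topology"
begin

abbreviation dual :: "(('w \<Rightarrow> real ^ 'k) \<Rightarrow> real) set" where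
  "dual \<equiv> topological_dual X seminorm_topology"

abbreviation singular :: "(('w \<Rightarrow> real ^ 'k) \<Rightarrow> real) set" where
  "singular \<equiv> singular_functionals M X seminorm_topology"

lemma subspace_V: "subspace V"
  using rv_V by (simp add: random_variable_space_def)

lemma measurable_X: "x \<in> X \<Longrightarrow> x \<in> borel_measurable M"
  using rv_X by (auto simp: random_variable_space_def)

lemma measurable_V: "v \<in> V \<Longrightarrow> v \<in> borel_measurable M"
  using rv_V by (auto simp: random_variable_space_def)

lemma solid_X:
  assumes "x \<in> X" "y \<in> borel_measurable M" "AE \<omega> in M. \<forall>i. \<bar>y \<omega> $ i\<bar> \<le> \<bar>x \<omega> $ i\<bar>"
  shows "y \<in> X"
  using rv_X assms unfolding random_variable_space_def solid_def by blast

lemma solid_V: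
  assumes "x \<in> V" "y \<in> borel_measurable M" "AE \<omega> in M. \<forall>i. \<bar>y \<omega> $ i\<bar> \<le> \<bar>x \<omega> $ i\<bar>"
  shows "y \<in> V"
  using rv_V assms unfolding random_variable_space_def solid_def by blast

text \<open>Decomposability with the empty set replaces the zero function by an arbitrary bounded
  one.\<close>

lemma Linfty_subset: "Linfty M \<subseteq> X" "Linfty M \<subseteq> V"
proof -
  have "x \<in> S" if S: "random_variable_space M S" and x: "x \<in> Linfty M" for S :: "('w \<Rightarrow> real ^ 'k) set" and x
  proof -
    have "0 \<in> S" using S by (simp add: random_variable_space_def subspace_0)
    moreover have "decomposable M S" using S by (simp add: random_variable_space_def)
    ultimately have "(\<lambda>\<omega>. if \<omega> \<in> {} then 0 \<omega> else x \<omega>) \<in> S"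
      using x sets.empty_sets unfolding decomposable_def by blast
    then show ?thesis by simp
  qed
  then show "Linfty M \<subseteq> X" "Linfty M \<subseteq> V" using rv_X rv_V by auto
qed

lemma X_cong_AE: "x \<in> X \<Longrightarrow> y \<in> borel_measurable M \<Longrightarrow> AE \<omega> in M. y \<omega> = x \<omega> \<Longrightarrow> y \<in> X"
  by (rule solid_X) auto

lemma restrict_X: "x \<in> X \<Longrightarrow> A \<in> sets M \<Longrightarrow> (\<lambda>\<omega>. if \<omega> \<in> A then x \<omega> else 0) \<in> X"
  by (rule solid_X[of x]) (auto intro!: measurable_If_set dest: measurable_X)

text \<open>Decomposability pastes a bounded function only; for two arbitrary elements solidity
  restricts their difference to \<open>A\<close>.\<close>

lemma paste_X:
  assumes "x \<in> X" "y \<in> X" "A \<in> sets M" shows "(\<lambda>\<omega>. if \<omega> \<in> A then x \<omega> else y \<omega>) \<in> X"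
proof -
  have "(\<lambda>\<omega>. if \<omega> \<in> A then (x - y) \<omega> else 0) + y \<in> X"
    by (intro mem_add restrict_X[OF mem_diff] assms)
  also have "(\<lambda>\<omega>. if \<omega> \<in> A then (x - y) \<omega> else 0) + y = (\<lambda>\<omega>. if \<omega> \<in> A then x \<omega> else y \<omega>)"
    by (auto simp: fun_eq_iff)
  finally show ?thesis .
qed

lemma integrable_pairing: "x \<in> X \<Longrightarrow> v \<in> V \<Longrightarrow> integrable M (\<lambda>\<omega>. x \<omega> \<bullet> v \<omega>)"
  using duality by (simp add: separating_duality_def)

lemma pairing_add: "x \<in> X \<Longrightarrow> y \<in> X \<Longrightarrow> v \<in> V \<Longrightarrow> pairing M (x + y) v = pairing M x v + pairing M y v"
  by (simp add: pairing_def inner_add_left integrable_pairing)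

lemma pairing_scale: "pairing M (c *\<^sub>R x) v = c * pairing M x v"
  by (simp add: pairing_def scaleR_fun_def)

lemma pairing_diff: "x \<in> X \<Longrightarrow> y \<in> X \<Longrightarrow> v \<in> V \<Longrightarrow> pairing M (x - y) v = pairing M x v - pairing M y v"
  by (simp add: pairing_def inner_diff_left integrable_pairing)

lemma pairing_add_right: "x \<in> X \<Longrightarrow> v \<in> V \<Longrightarrow> w \<in> V \<Longrightarrow> pairing M x (v + w) = pairing M x v + pairing M x w"
  by (simp add: pairing_def inner_add_right integrable_pairing)

lemma pairing_dual: "v \<in> V \<Longrightarrow> (\<lambda>x. pairing M x v) \<in> dual"
  using direct_sum by (simp add: dual_is_direct_sum_def)

lemma pairing_converges:
  "converges s x \<Longrightarrow> (\<And>i. s i \<in> X) \<Longrightarrow> x \<in> X \<Longrightarrow> v \<in> V \<Longrightarrow>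
    (\<lambda>i. pairing M (s i) v) \<longlonglongrightarrow> pairing M x v"
  using topological_dual_converges[OF pairing_dual] by blast

lemma dual_add: "l \<in> dual \<Longrightarrow> x \<in> X \<Longrightarrow> y \<in> X \<Longrightarrow> l (x + y) = l x + l y"
  using topological_dual_linear[of l] linear_on_subspace_def[of X l] by (metis mult_1 scaleR_one)

lemma dual_diff: "l \<in> dual \<Longrightarrow> x \<in> X \<Longrightarrow> y \<in> X \<Longrightarrow> l (x - y) = l x - l y"
  using dual_add[of l "x - y" y] by simp

lemma dual_scale: "l \<in> dual \<Longrightarrow> x \<in> X \<Longrightarrow> l (c *\<^sub>R x) = c * l x"
  using topological_dual_linear[of l] linear_on_subspace_def[of X l]
  by (metis add.right_neutral mult_zero_left scaleR_zero_left)

lemma dual_null: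
  assumes "l \<in> dual" "x \<in> X" "AE \<omega> in M. x \<omega> = 0" shows "l x = 0"
proof -
  have "converges (\<lambda>_. x) 0" using null[OF assms(2)] assms(3) by (simp add: converges_def)
  from topological_dual_converges[OF assms(1) assms(2) mem_zero this]
  have "l x = l 0" by (simp add: LIMSEQ_const_iff)
  also have "l 0 = 0" using dual_scale[OF assms(1) mem_zero, of 0] by simp
  finally show ?thesis .
qed

lemma dual_cong_AE:
  assumes "l \<in> dual" "x \<in> X" "y \<in> X" "AE \<omega> in M. x \<omega> = y \<omega>" shows "l x = l y"
  using dual_null[OF assms(1), of "x - y"] dual_diff[OF assms(1-3)] assms by auto

lemma singular_dual: "s \<in> singular \<Longrightarrow> s \<in> dual"
  by (simp add: singular_functionals_def)

lemma dual_decompose: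
  assumes "l \<in> dual"
  obtains v s where "v \<in> V" "s \<in> singular" "\<And>x. x \<in> X \<Longrightarrow> l x = pairing M x v + s x"
  using direct_sum assms unfolding dual_is_direct_sum_def by blast

text \<open>Complementary form of the definition: a singular functional reads only the part of
  \<open>x\<close> on sets of vanishing probability.\<close>

lemma singular_vanishing_sets:
  assumes s: "s \<in> singular" and x: "x \<in> X"
  obtains A :: "nat \<Rightarrow> 'w set" where "range A \<subseteq> sets M" "decseq A" "(\<lambda>\<nu>. measure M (A \<nu>)) \<longlonglongrightarrow> 0"
    "\<And>\<nu>. s (\<lambda>\<omega>. if \<omega> \<in> A \<nu> then x \<omega> else 0) = s x"
proof -
  obtain A where A: "range A \<subseteq> sets M" "decseq A" "(\<lambda>\<nu>. measure M (A \<nu>)) \<longlonglongrightarrow> 0"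
    "\<And>\<nu>::nat. s (\<lambda>\<omega>. if \<omega> \<in> A \<nu> then 0 else x \<omega>) = 0"
    using s x unfolding singular_functionals_def by blast
  have "s (\<lambda>\<omega>. if \<omega> \<in> A \<nu> then x \<omega> else 0) = s x" for \<nu>
  proof -
    have "A \<nu> \<in> sets M" using A(1) by auto
    then have R: "(\<lambda>\<omega>. if \<omega> \<in> A \<nu> then x \<omega> else 0) \<in> X" using x restrict_X by blast
    have "(\<lambda>\<omega>. if \<omega> \<in> A \<nu> then 0 else x \<omega>) = x - (\<lambda>\<omega>. if \<omega> \<in> A \<nu> then x \<omega> else 0)"
      by (auto simp: fun_eq_iff)
    then show ?thesis using A(4)[of \<nu>] dual_diff[OF singular_dual[OF s] x R] by simp
  qed
  with A show thesis using that by blast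
qed

text \<open>The sign of \<open>x\<close> is bounded and hence lies in \<open>V\<close>; pairing
  \<open>x\<close> with it produces the norm. So \<open>X\<close> consists of integrable
  functions.\<close>

lemma integrable_norm_X: "x \<in> X \<Longrightarrow> integrable M (\<lambda>\<omega>. norm (x \<omega>))"
  and pairing_sgn: "x \<in> X \<Longrightarrow> pairing M x (\<lambda>\<omega>. sgn (x \<omega>)) = (\<integral>\<omega>. norm (x \<omega>) \<partial>M)"
  and sgn_V: "x \<in> X \<Longrightarrow> (\<lambda>\<omega>. sgn (x \<omega>)) \<in> V"
proof -
  assume x: "x \<in> X"
  then have [measurable]: "x \<in> borel_measurable M" by (rule measurable_X)
  have "(\<lambda>\<omega>. sgn (x \<omega>)) \<in> borel_measurable M" unfolding sgn_div_norm by measurable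
  then have "(\<lambda>\<omega>. sgn (x \<omega>)) \<in> Linfty M"
    by (auto simp: Linfty_def norm_sgn intro!: exI[of _ 1])
  then show V: "(\<lambda>\<omega>. sgn (x \<omega>)) \<in> V" using Linfty_subset by blast
  have eq: "x \<omega> \<bullet> sgn (x \<omega>) = norm (x \<omega>)" for \<omega>
    by (cases "x \<omega> = 0") (simp_all add: sgn_div_norm power2_norm_eq_inner[symmetric] power2_eq_square)
  show "integrable M (\<lambda>\<omega>. norm (x \<omega>))" using integrable_pairing[OF x V] by (simp add: eq)
  show "pairing M x (\<lambda>\<omega>. sgn (x \<omega>)) = (\<integral>\<omega>. norm (x \<omega>) \<partial>M)" by (simp add: pairing_def eq)
qed

lemma integrable_X: "x \<in> X \<Longrightarrow> integrable M x"
  using integrable_norm_X[of x] by (simp add: integrable_norm_iff measurable_X)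

text \<open>The \<open>L\<^sup>1\<close> norm is a supremum of continuous functionals, so its unit ball is a barrel.\<close>

lemma converges_L1:
  assumes s: "\<And>i. s i \<in> X" "x \<in> X" "converges s x"
  shows "(\<lambda>i. \<integral>\<omega>. norm (s i \<omega> - x \<omega>) \<partial>M) \<longlonglongrightarrow> 0"
proof -
  define N where "N x = (\<integral>\<omega>. norm (x \<omega>) \<partial>M)" for x :: "'w \<Rightarrow> real ^ 'k"
  have N_scale: "N (c *\<^sub>R x) = \<bar>c\<bar> * N x" for c x by (simp add: N_def scaleR_fun_def)
  have N_add: "N (x + y) \<le> N x + N y" if "x \<in> X" "y \<in> X" for x y
    unfolding N_def plus_fun_def Bochner_Integration.integral_add[OF integrable_norm_X[OF that(1)] integrable_norm_X[OF that(2)], symmetric]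
    by (intro integral_mono Bochner_Integration.integrable_add integrable_norm Bochner_Integration.integrable_add integrable_X that norm_triangle_ineq)
  have N_pos: "0 \<le> N x" for x by (simp add: N_def)
  obtain k e where ball: "0 < e" "\<And>x. x \<in> X \<Longrightarrow> nrm k x \<le> e \<Longrightarrow> x \<in> {x\<in>X. N x \<le> 1}"
  proof (rule barrel[of "{x\<in>X. N x \<le> 1}"])
    fix s x assume s: "\<And>i::nat. s i \<in> {x\<in>X. N x \<le> 1}" "\<And>i. s i \<in> X" "x \<in> X" "converges s x"
    \<comment> \<open>The limit is tested with its own sign: this functional is at most the norm of
      \<open>s i\<close>, and at \<open>x\<close> it equals the norm.\<close>
    have "pairing M (s i) (\<lambda>\<omega>. sgn (x \<omega>)) \<le> 1" for i
    proof -
      have "pairing M (s i) (\<lambda>\<omega>. sgn (x \<omega>)) \<le> N (s i)"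
        unfolding pairing_def N_def
      proof (intro integral_mono integrable_pairing integrable_norm_X s sgn_V)
        fix \<omega>
        have "s i \<omega> \<bullet> sgn (x \<omega>) \<le> norm (s i \<omega>) * norm (sgn (x \<omega>))" by (rule norm_cauchy_schwarz)
        also have "\<dots> \<le> norm (s i \<omega>) * 1" by (intro mult_left_mono) (auto simp: norm_sgn)
        finally show "s i \<omega> \<bullet> sgn (x \<omega>) \<le> norm (s i \<omega>)" by simp
      qed
      also have "\<dots> \<le> 1" using s(1) by blast
      finally show ?thesis .
    qed
    then have "pairing M x (\<lambda>\<omega>. sgn (x \<omega>)) \<le> 1"
      by (intro LIMSEQ_le_const2[OF pairing_converges[OF s(4,2,3) sgn_V[OF s(3)]]]) auto
    with s(3) show "x \<in> {x\<in>X. N x \<le> 1}" by (simp add: pairing_sgn N_def)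
  next
    show "convex {x\<in>X. N x \<le> 1}"
    proof (rule convexI)
      fix x y and u v :: real assume xy: "x \<in> {x\<in>X. N x \<le> 1}" "y \<in> {x\<in>X. N x \<le> 1}" and uv: "0 \<le> u" "0 \<le> v" "u + v = 1"
      have "N (u *\<^sub>R x + v *\<^sub>R y) \<le> u * N x + v * N y"
        using N_add[of "u *\<^sub>R x" "v *\<^sub>R y"] xy uv by (simp add: N_scale)
      also have "\<dots> \<le> 1" using xy uv by (intro convex_bound_le) auto
      finally show "u *\<^sub>R x + v *\<^sub>R y \<in> {x\<in>X. N x \<le> 1}" using xy by simp
    qed
  next
    show "0 \<in> {x\<in>X. N x \<le> 1}" by (simp add: N_def)
  next
    fix x assume x: "x \<in> X"
    have "inverse (1 + N x) *\<^sub>R x \<in> {x\<in>X. N x \<le> 1}" using x N_pos[of x] by (simp add: N_scale field_simps)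
    then show "\<exists>t>0. t *\<^sub>R x \<in> {x\<in>X. N x \<le> 1}" using N_pos[of x]
      by (intro exI[of _ "inverse (1 + N x)"]) (simp add: add_pos_nonneg)
  qed blast
  have small: "N x \<le> \<delta>" if "x \<in> X" "0 < \<delta>" "nrm k x \<le> e * \<delta>" for x \<delta>
  proof -
    have "nrm k (inverse \<delta> *\<^sub>R x) \<le> e" using that by (simp add: nrm_scale field_simps)
    then have "N (inverse \<delta> *\<^sub>R x) \<le> 1" using ball(2)[of "inverse \<delta> *\<^sub>R x"] that by simp
    then show ?thesis using that by (simp add: N_scale field_simps)
  qed
  have "(\<lambda>i. N (s i - x)) \<longlonglongrightarrow> 0"
  proof (rule LIMSEQ_I)
    fix r :: real assume r: "0 < r"
    have "\<forall>\<^sub>F i in sequentially. nrm k (s i - x) < e * (r/2)"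
      using converges_nrm[OF s(3), of k] ball r by (intro order_tendstoD(2)) auto
    then obtain n where n: "\<And>i. i \<ge> n \<Longrightarrow> nrm k (s i - x) < e * (r/2)" by (auto simp: eventually_sequentially)
    show "\<exists>no. \<forall>i\<ge>no. norm (N (s i - x) - 0) < r"
    proof (intro exI[of _ n] allI impI)
      fix i assume "n \<le> i"
      then have "N (s i - x) \<le> r/2" using small[of "s i - x" "r/2"] n[of i] r s by auto
      then show "norm (N (s i - x) - 0) < r" using N_pos[of "s i - x"] r by simp
    qed
  qed
  then show ?thesis by (simp add: N_def)
qed

end

section \<open>Conditional expectations and weak duality\<close>

text \<open>Both sides equal the integral of the product of the two conditional expectations. The
  difficulty is integrability: \<open>cw\<close> carries over to the product of the conditional
  expectations of the absolute values, and truncation with Fatou's lemma brings it to the product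
  with \<open>w\<close> itself.\<close>

lemma (in sigma_finite_subalgebra) integrable_cond_exp_swap:
  assumes c: "integrable M c" and w: "integrable M w"
    and cw: "integrable M (\<lambda>\<omega>. c \<omega> * real_cond_exp M F (\<lambda>\<omega>. \<bar>w \<omega>\<bar>) \<omega>)"
  shows "integrable M (\<lambda>\<omega>. real_cond_exp M F c \<omega> * w \<omega>)"
    and "(\<integral>\<omega>. real_cond_exp M F c \<omega> * w \<omega> \<partial>M) = (\<integral>\<omega>. c \<omega> * real_cond_exp M F w \<omega> \<partial>M)"
proof -
  note [measurable] = borel_measurable_integrable[OF c] borel_measurable_integrable[OF w]
  let ?h = "real_cond_exp M F (\<lambda>\<omega>. \<bar>c \<omega>\<bar>)" and ?W = "real_cond_exp M F (\<lambda>\<omega>. \<bar>w \<omega>\<bar>)"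
  have ac: "integrable M (\<lambda>\<omega>. \<bar>c \<omega>\<bar>)" and aw: "integrable M (\<lambda>\<omega>. \<bar>w \<omega>\<bar>)" using c w by auto
  have "integrable M (\<lambda>\<omega>. ?W \<omega> * \<bar>c \<omega>\<bar>)"
    by (rule Bochner_Integration.integrable_bound[OF cw]) (auto simp: abs_mult)
  then have "integrable M (\<lambda>\<omega>. ?W \<omega> * ?h \<omega>)" by (rule real_cond_exp_intg(1)) measurable
  then have hW: "integrable M (\<lambda>\<omega>. \<bar>?h \<omega>\<bar> * ?W \<omega>)"
    by (rule Bochner_Integration.integrable_bound) (auto simp: abs_mult)
  have W0: "AE \<omega> in M. 0 \<le> ?W \<omega>" by (rule real_cond_exp_pos) auto
  \<comment> \<open>The truncated factor is bounded, so its product with \<open>w\<close> is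
    integrable and the factor may be pulled out of the conditional expectation.\<close>
  define u where "u n \<omega> = min (real n) \<bar>?h \<omega>\<bar> * \<bar>w \<omega>\<bar>" for n \<omega>
  have u_int: "integrable M (u n)" for n
    unfolding u_def by (rule Bochner_Integration.integrable_bound[OF integrable_mult_right[OF aw, of "real n"]])
      (auto simp: abs_mult intro!: mult_right_mono)
  have u_le': "(\<integral>\<omega>. u n \<omega> \<partial>M) \<le> (\<integral>\<omega>. \<bar>?h \<omega>\<bar> * ?W \<omega> \<partial>M)" for n
  proof -
    have i: "integrable M (\<lambda>\<omega>. min (real n) \<bar>?h \<omega>\<bar> * ?W \<omega>)"
      "(\<integral>\<omega>. min (real n) \<bar>?h \<omega>\<bar> * ?W \<omega> \<partial>M) = (\<integral>\<omega>. u n \<omega> \<partial>M)"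
      using real_cond_exp_intg[of "\<lambda>\<omega>. min (real n) \<bar>?h \<omega>\<bar>" "\<lambda>\<omega>. \<bar>w \<omega>\<bar>"] u_int[of n] unfolding u_def by auto
    show ?thesis unfolding i(2)[symmetric]
      by (rule integral_mono_AE[OF i(1) hW]) (use W0 in \<open>auto intro!: mult_right_mono\<close>)
  qed
  have u_le: "(\<integral>\<^sup>+\<omega>. ennreal (u n \<omega>) \<partial>M) \<le> ennreal (\<integral>\<omega>. \<bar>?h \<omega>\<bar> * ?W \<omega> \<partial>M)" for n
  proof -
    have "(\<integral>\<^sup>+\<omega>. ennreal (u n \<omega>) \<partial>M) = ennreal (\<integral>\<omega>. u n \<omega> \<partial>M)"
      by (rule nn_integral_eq_integral[OF u_int]) (simp add: u_def)
    with ennreal_leI[OF u_le'[of n]] show ?thesis by simp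
  qed
  have lim: "(\<lambda>n. ennreal (u n \<omega>)) \<longlonglongrightarrow> ennreal (\<bar>?h \<omega>\<bar> * \<bar>w \<omega>\<bar>)" for \<omega>
  proof -
    obtain N where "\<bar>?h \<omega>\<bar> \<le> real N" using real_arch_simple by blast
    then have "\<forall>n\<ge>N. ennreal (u n \<omega>) = ennreal (\<bar>?h \<omega>\<bar> * \<bar>w \<omega>\<bar>)" by (auto simp: u_def min_def)
    then show ?thesis by (intro tendsto_eventually) (auto simp: eventually_sequentially)
  qed
  have "(\<integral>\<^sup>+\<omega>. ennreal (\<bar>?h \<omega>\<bar> * \<bar>w \<omega>\<bar>) \<partial>M) = (\<integral>\<^sup>+\<omega>. liminf (\<lambda>n. ennreal (u n \<omega>)) \<partial>M)"
    by (intro nn_integral_cong) (simp add: lim_imp_Liminf[OF _ lim])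
  also have "\<dots> \<le> liminf (\<lambda>n. \<integral>\<^sup>+\<omega>. ennreal (u n \<omega>) \<partial>M)"
    by (rule nn_integral_liminf) (use borel_measurable_integrable[OF u_int] in measurable)
  also have "\<dots> \<le> liminf (\<lambda>n. ennreal (\<integral>\<omega>. \<bar>?h \<omega>\<bar> * ?W \<omega> \<partial>M))"
    by (rule Liminf_mono) (use u_le in auto)
  finally have "(\<integral>\<^sup>+\<omega>. ennreal (\<bar>?h \<omega>\<bar> * \<bar>w \<omega>\<bar>) \<partial>M) < \<infinity>"
    by (simp add: Liminf_const le_less_trans[OF _ ennreal_less_top])
  then have hw: "integrable M (\<lambda>\<omega>. \<bar>?h \<omega>\<bar> * \<bar>w \<omega>\<bar>)" by (intro integrableI_nonneg) auto
  have le: "AE \<omega> in M. \<bar>real_cond_exp M F g \<omega>\<bar> \<le> real_cond_exp M F (\<lambda>\<omega>. \<bar>g \<omega>\<bar>) \<omega>" if g: "integrable M g" for g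
  proof -
    have "AE \<omega> in M. real_cond_exp M F g \<omega> \<le> real_cond_exp M F (\<lambda>\<omega>. \<bar>g \<omega>\<bar>) \<omega>"
      by (rule real_cond_exp_mono) (use g in auto)
    moreover have "AE \<omega> in M. real_cond_exp M F (\<lambda>\<omega>. - 1 * g \<omega>) \<omega> \<le> real_cond_exp M F (\<lambda>\<omega>. \<bar>g \<omega>\<bar>) \<omega>"
      by (rule real_cond_exp_mono) (use g in auto)
    moreover have "AE \<omega> in M. real_cond_exp M F (\<lambda>\<omega>. - 1 * g \<omega>) \<omega> = - 1 * real_cond_exp M F g \<omega>"
      by (rule real_cond_exp_cmult[OF g])
    ultimately show ?thesis by eventually_elim auto
  qed
  show i1: "integrable M (\<lambda>\<omega>. real_cond_exp M F c \<omega> * w \<omega>)"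
    by (rule Bochner_Integration.integrable_bound[OF hw])
      (use le[OF c] in \<open>auto simp: abs_mult intro!: mult_right_mono\<close>)
  have "AE \<omega> in M. norm (real_cond_exp M F w \<omega> * c \<omega>) \<le> norm (c \<omega> * ?W \<omega>)"
    using le[OF w]
  proof eventually_elim
    case (elim \<omega>)
    then have "\<bar>real_cond_exp M F w \<omega>\<bar> \<le> \<bar>?W \<omega>\<bar>" by linarith
    then have "\<bar>c \<omega>\<bar> * \<bar>real_cond_exp M F w \<omega>\<bar> \<le> \<bar>c \<omega>\<bar> * \<bar>?W \<omega>\<bar>" by (rule mult_left_mono) simp
    then show ?case by (simp add: abs_mult mult.commute)
  qed
  then have i2: "integrable M (\<lambda>\<omega>. real_cond_exp M F w \<omega> * c \<omega>)"
    by (rule Bochner_Integration.integrable_bound[OF cw, rotated]) measurable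
  show "(\<integral>\<omega>. real_cond_exp M F c \<omega> * w \<omega> \<partial>M) = (\<integral>\<omega>. c \<omega> * real_cond_exp M F w \<omega> \<partial>M)"
    using real_cond_exp_intg(2)[OF i1] real_cond_exp_intg(2)[OF i2] by (simp add: mult.commute)
qed

lemma borel_measurable_vec_iff:
  fixes x :: "'w \<Rightarrow> real ^ 'k::finite"
  shows "x \<in> borel_measurable M \<longleftrightarrow> (\<forall>i. (\<lambda>\<omega>. x \<omega> $ i) \<in> borel_measurable M)"
  unfolding borel_measurable_euclidean_space[of x] by (auto simp: Basis_vec_def inner_axis)

lemma borel_measurable_vec_component [measurable (raw)]:
  fixes x :: "'w \<Rightarrow> real ^ 'k::finite"
  shows "x \<in> borel_measurable M \<Longrightarrow> (\<lambda>\<omega>. x \<omega> $ i) \<in> borel_measurable M"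
  by (simp add: borel_measurable_vec_iff)

context random_frechet_space
begin

lemma axis_X: "x \<in> X \<Longrightarrow> g \<in> borel_measurable M \<Longrightarrow> (AE \<omega> in M. \<bar>g \<omega>\<bar> \<le> \<bar>x \<omega> $ i\<bar>) \<Longrightarrow> (\<lambda>\<omega>. axis i (g \<omega>)) \<in> X"
  by (rule solid_X[of x]) (auto simp: axis_def borel_measurable_vec_iff elim!: eventually_mono)

text \<open>Solidity puts the componentwise absolute values into \<open>X\<close> and
  \<open>V\<close>; their integrable pairing dominates every single product, whereas in
  \<open>x \<bullet> v\<close> the terms might cancel.\<close>

lemma integrable_component_mult:
  assumes "x \<in> X" "v \<in> V" shows "integrable M (\<lambda>\<omega>. x \<omega> $ i * v \<omega> $ i)"
proof (rule Bochner_Integration.integrable_bound)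
  have "(\<lambda>\<omega>. \<chi> i. \<bar>x \<omega> $ i\<bar>) \<in> X"
    by (rule solid_X[OF assms(1)]) (use measurable_X[OF assms(1)] in \<open>auto simp: borel_measurable_vec_iff intro!: borel_measurable_abs\<close>)
  moreover have "(\<lambda>\<omega>. \<chi> i. \<bar>v \<omega> $ i\<bar>) \<in> V"
    by (rule solid_V[OF assms(2)]) (use measurable_V[OF assms(2)] in \<open>auto simp: borel_measurable_vec_iff intro!: borel_measurable_abs\<close>)
  ultimately show "integrable M (\<lambda>\<omega>. (\<chi> i. \<bar>x \<omega> $ i\<bar>) \<bullet> (\<chi> i. \<bar>v \<omega> $ i\<bar>))" by (rule integrable_pairing)
  show "(\<lambda>\<omega>. x \<omega> $ i * v \<omega> $ i) \<in> borel_measurable M"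
    using measurable_X[OF assms(1)] measurable_V[OF assms(2)] by measurable
  have "\<bar>a $ i * b $ i\<bar> \<le> (\<Sum>i\<in>UNIV. \<bar>a $ i\<bar> * \<bar>b $ i\<bar>)" for a b :: "real ^ 'k"
    unfolding abs_mult by (rule member_le_sum) auto
  then show "AE \<omega> in M. norm (x \<omega> $ i * v \<omega> $ i) \<le> norm ((\<chi> i. \<bar>x \<omega> $ i\<bar>) \<bullet> (\<chi> i. \<bar>v \<omega> $ i\<bar>))"
    by (auto simp: inner_vec_def intro: order_trans[OF _ abs_ge_self])
qed

lemma pairing_sum: "x \<in> X \<Longrightarrow> v \<in> V \<Longrightarrow> pairing M x v = (\<Sum>i\<in>UNIV. \<integral>\<omega>. x \<omega> $ i * v \<omega> $ i \<partial>M)"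
  by (simp add: pairing_def inner_vec_def integrable_component_mult)

lemma integrable_component: "x \<in> X \<Longrightarrow> integrable M (\<lambda>\<omega>. x \<omega> $ i)"
  by (rule Bochner_Integration.integrable_bound[OF integrable_norm_X[of x]])
    (auto intro: component_le_norm_cart borel_measurable_vec_component dest: measurable_X)

lemma integrable_component_V: "v \<in> V \<Longrightarrow> integrable M (\<lambda>\<omega>. v \<omega> $ i)"
proof -
  assume v: "v \<in> V"
  have "(\<lambda>_. 1) \<in> Linfty M" by (auto simp: Linfty_def)
  then have "(\<lambda>_. 1) \<in> X" using Linfty_subset(1) by blast
  from integrable_component_mult[OF this v, of i] show ?thesis by simp
qed

end

section \<open>The stochastic program: adapted processes, majorants and closedness\<close>

locale stochastic_program =
  X: random_frechet_space M X \<rho> V + U: random_frechet_space M U \<sigma> Y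
  for M :: "'w measure" and X V :: "('w \<Rightarrow> real ^ 'n::finite) set" and \<rho>
    and U Y :: "('w \<Rightarrow> real ^ 'm::finite) set" and \<sigma> +
  fixes T :: nat and F :: "nat \<Rightarrow> 'w measure" and stage :: "'n \<Rightarrow> nat"
    and f :: "'w \<Rightarrow> (real ^ 'n) \<times> (real ^ 'm) \<Rightarrow> ereal" and ub :: "'w \<Rightarrow> real ^ 'm"
  assumes filtration: "finite_filtration M T F" and stage_le: "stage i \<le> T"
    and normal: "convex_normal_integrand M f"
    and cond_exp_X: "t \<le> T \<Longrightarrow> x \<in> X \<Longrightarrow> cond_exp_vec M (F t) x \<in> X"
    and ub: "ub \<in> U"
begin

lemma subalg: "t \<le> T \<Longrightarrow> subalgebra M (F t)"
  using filtration by (simp add: finite_filtration_def)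

lemma sigma_finite_subalgebra: "t \<le> T \<Longrightarrow> sigma_finite_subalgebra M (F t)"
  using subalg by (intro finite_measure_subalgebra_is_sigma_finite)
    (simp add: finite_measure_subalgebra_def finite_measure_subalgebra_axioms_def X.finite_measure_axioms)

lemma measurable_F_mono: "g \<in> borel_measurable (F s) \<Longrightarrow> s \<le> t \<Longrightarrow> t \<le> T \<Longrightarrow> g \<in> borel_measurable (F t)"
  using filtration subalg[of s] subalg[of t] unfolding finite_filtration_def subalgebra_def
  by (intro measurable_mono[THEN subsetD, of _ _ "F s" "F t"]) auto

lemma adapted_component: "x \<in> adapted F stage \<Longrightarrow> stage i \<le> t \<Longrightarrow> t \<le> T \<Longrightarrow> (\<lambda>\<omega>. x \<omega> $ i) \<in> borel_measurable (F t)"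
  unfolding adapted_def by (auto intro: measurable_F_mono)

lemma adapted_measurable: "x \<in> adapted F stage \<Longrightarrow> x \<in> borel_measurable M"
proof -
  assume x: "x \<in> adapted F stage"
  have "(\<lambda>\<omega>. x \<omega> $ i) \<in> borel_measurable M" for i
    using adapted_component[OF x order_refl stage_le] subalg[OF stage_le] by (rule measurable_from_subalg[rotated])
  then show ?thesis by (simp add: borel_measurable_vec_iff)
qed

lemma subspace_adapted: "subspace (adapted F stage)"
  unfolding subspace_def adapted_def
  by (auto simp: scaleR_fun_def intro!: borel_measurable_add borel_measurable_times)

lemma subspace_perp: "subspace (adapted_perp M F stage X V)"
proof (rule subspaceI)
  show "0 \<in> adapted_perp M F stage X V"
    using X.subspace_V by (auto simp: adapted_perp_def pairing_def subspace_0)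
qed (use X.subspace_V in \<open>auto simp: adapted_perp_def X.pairing_add_right subspace_add subspace_scale\<close>,
     auto simp: pairing_def scaleR_fun_def)

lemma bounded_adapted_X:
  assumes "x \<in> borel_measurable M" "\<And>i. \<exists>C. \<forall>\<omega>\<in>space M. \<bar>x \<omega> $ i\<bar> \<le> C"
  shows "x \<in> X"
proof -
  obtain C where C: "\<And>i \<omega>. \<omega> \<in> space M \<Longrightarrow> \<bar>x \<omega> $ i\<bar> \<le> C i" using assms(2) by metis
  have "AE \<omega> in M. norm (x \<omega>) \<le> (\<Sum>i\<in>UNIV. C i)"
    by (rule AE_I2) (rule order_trans[OF norm_le_l1_cart], rule sum_mono, rule C)
  with assms(1) show ?thesis using X.Linfty_subset by (auto simp: Linfty_def)
qed

text \<open>Truncation at stopping times, one stage after the other, reduces the claim to bounded adapted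
  processes; the upper bound allows passing to the limit.\<close>

lemma adapted_perp_integral:
  assumes p: "p \<in> adapted_perp M F stage X V" and x: "x \<in> adapted F stage"
    and a: "integrable M a" "AE \<omega> in M. x \<omega> \<bullet> p \<omega> \<le> a \<omega>"
  shows "integrable M (\<lambda>\<omega>. x \<omega> \<bullet> p \<omega>) \<and> (\<integral>\<omega>. x \<omega> \<bullet> p \<omega> \<partial>M) = 0"
proof -
  \<comment> \<open>The claim for processes whose components before stage \<open>j\<close> are
    bounded: at \<open>Suc T\<close> all of them are, and at 0 the restriction is void.\<close>
  define P where "P j \<longleftrightarrow> (\<forall>x a. x \<in> adapted F stage \<longrightarrow>
    (\<forall>i. stage i < j \<longrightarrow> (\<exists>C. \<forall>\<omega>\<in>space M. \<bar>x \<omega> $ i\<bar> \<le> C)) \<longrightarrow> integrable M a \<longrightarrow>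
    (AE \<omega> in M. x \<omega> \<bullet> p \<omega> \<le> a \<omega>) \<longrightarrow> integrable M (\<lambda>\<omega>. x \<omega> \<bullet> p \<omega>) \<and> (\<integral>\<omega>. x \<omega> \<bullet> p \<omega> \<partial>M) = 0)" for j
  have pV: "p \<in> V" using p by (simp add: adapted_perp_def)
  note [measurable] = X.measurable_V[OF pV]
  have bounded: "integrable M (\<lambda>\<omega>. x \<omega> \<bullet> p \<omega>) \<and> (\<integral>\<omega>. x \<omega> \<bullet> p \<omega> \<partial>M) = 0"
    if "x \<in> adapted F stage" "\<And>i. \<exists>C. \<forall>\<omega>\<in>space M. \<bar>x \<omega> $ i\<bar> \<le> C" for x
  proof -
    have "x \<in> X" using bounded_adapted_X adapted_measurable that by blast
    then have "integrable M (\<lambda>\<omega>. x \<omega> \<bullet> p \<omega>)" "pairing M x p = 0"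
      using p that(1) X.integrable_pairing[OF _ pV] by (simp_all add: adapted_perp_def)
    then show ?thesis by (simp add: pairing_def)
  qed
  have "P j" if "j \<le> Suc T" for j
    using that
  proof (induction rule: inc_induct)
    case base
    show ?case unfolding P_def using stage_le by (auto intro!: bounded simp: less_Suc_eq_le)
  next
    case (step j)
    then have j: "j \<le> T" by simp
    show ?case unfolding P_def
    proof (intro allI impI)
      fix x a assume x: "x \<in> adapted F stage" and bnd: "\<forall>i. stage i < j \<longrightarrow> (\<exists>C. \<forall>\<omega>\<in>space M. \<bar>x \<omega> $ i\<bar> \<le> C)"
        and a: "integrable M a" and le: "AE \<omega> in M. x \<omega> \<bullet> p \<omega> \<le> a \<omega>"
      note [measurable] = adapted_measurable[OF x]
      define xb where "xb \<omega> = (\<chi> i. if stage i < j then x \<omega> $ i else 0)" for \<omega>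
      have xb: "xb \<in> adapted F stage" using x by (auto simp: adapted_def xb_def intro!: measurable_If)
      note [measurable] = adapted_measurable[OF xb]
      define \<beta> where "\<beta> \<omega> = xb \<omega> \<bullet> p \<omega>" for \<omega>
      have \<beta>: "integrable M \<beta>" "(\<integral>\<omega>. \<beta> \<omega> \<partial>M) = 0"
      proof -
        have "\<exists>C. \<forall>\<omega>\<in>space M. \<bar>xb \<omega> $ i\<bar> \<le> C" for i
          using bnd by (cases "stage i < j") (auto simp: xb_def)
        from bounded[OF xb this] show "integrable M \<beta>" "(\<integral>\<omega>. \<beta> \<omega> \<partial>M) = 0" by (auto simp: \<beta>_def[abs_def])
      qed
      \<comment> \<open>The event that the block of stage \<open>j\<close> is bounded by
        \<open>\<nu>\<close> is known at every stage from \<open>j\<close> on, so switching these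
        stages off outside it keeps the process adapted.\<close>
      define A where "A \<nu> = {\<omega>\<in>space M. \<forall>i\<in>{i. stage i = j}. \<bar>x \<omega> $ i\<bar> \<le> real \<nu>}" for \<nu> :: nat
      have sp: "space (F t) = space M" if "t \<le> T" for t using subalg[OF that] by (simp add: subalgebra_def)
      have A_F: "A \<nu> \<in> sets (F t)" if t: "j \<le> t" "t \<le> T" for \<nu> t
      proof -
        have "{\<omega>\<in>space (F t). \<forall>i\<in>{i. stage i = j}. \<bar>x \<omega> $ i\<bar> \<le> real \<nu>} \<in> sets (F t)"
        proof (rule sets.sets_Collect_finite_All)
          fix i assume "i \<in> {i. stage i = j}"
          then have "(\<lambda>\<omega>. x \<omega> $ i) \<in> borel_measurable (F t)" using t by (intro adapted_component[OF x]) auto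
          then show "{\<omega>\<in>space (F t). \<bar>x \<omega> $ i\<bar> \<le> real \<nu>} \<in> sets (F t)"
            by (intro borel_measurable_le borel_measurable_abs) auto
        qed simp
        then show ?thesis unfolding A_def sp[OF t(2)] .
      qed
      have [measurable]: "A \<nu> \<in> sets M" for \<nu> using A_F[OF order_refl j] subalg[OF j] unfolding subalgebra_def by blast
      define \<eta> where "\<eta> \<omega> = (x \<omega> - xb \<omega>) \<bullet> p \<omega>" for \<omega>
      have \<eta>_meas [measurable]: "\<eta> \<in> borel_measurable M" unfolding \<eta>_def by measurable
      have cut: "integrable M (\<lambda>\<omega>. if \<omega> \<in> A \<nu> then \<eta> \<omega> else 0) \<and> (\<integral>\<omega>. (if \<omega> \<in> A \<nu> then \<eta> \<omega> else 0) \<partial>M) = 0" for \<nu>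
      proof -
        \<comment> \<open>Off \<open>A \<nu>\<close> the components from stage \<open>j\<close> on
          are zero and the earlier ones are kept, so \<open>y\<close> is bounded up to and including
          stage \<open>j\<close>.\<close>
        define y where "y \<omega> = (if \<omega> \<in> A \<nu> then x \<omega> else xb \<omega>)" for \<omega>
        have y_eq: "y \<omega> \<bullet> p \<omega> = \<beta> \<omega> + (if \<omega> \<in> A \<nu> then \<eta> \<omega> else 0)" for \<omega>
          by (simp add: y_def \<beta>_def \<eta>_def inner_diff_left)
        have "y \<in> adapted F stage"
          unfolding adapted_def
        proof (intro CollectI allI)
          fix i
          have [measurable]: "(\<lambda>\<omega>. x \<omega> $ i) \<in> borel_measurable (F (stage i))" using x by (simp add: adapted_def)
          show "(\<lambda>\<omega>. y \<omega> $ i) \<in> borel_measurable (F (stage i))"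
          proof (cases "stage i < j")
            case True
            then have "(\<lambda>\<omega>. y \<omega> $ i) = (\<lambda>\<omega>. x \<omega> $ i)" by (auto simp: y_def xb_def)
            then show ?thesis by simp
          next
            case False
            have [measurable]: "A \<nu> \<in> sets (F (stage i))" using A_F False stage_le by simp
            have "(\<lambda>\<omega>. y \<omega> $ i) = (\<lambda>\<omega>. if \<omega> \<in> A \<nu> then x \<omega> $ i else 0)" using False by (auto simp: y_def xb_def)
            then show ?thesis by simp
          qed
        qed
        moreover have "\<exists>C. \<forall>\<omega>\<in>space M. \<bar>y \<omega> $ i\<bar> \<le> C" if "stage i < Suc j" for i
        proof (cases "stage i < j")
          case True
          with bnd obtain C where "\<forall>\<omega>\<in>space M. \<bar>x \<omega> $ i\<bar> \<le> C" by blast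
          with True show ?thesis by (intro exI[of _ C]) (auto simp: y_def xb_def)
        next
          case False
          with that have "stage i = j" by simp
          then show ?thesis by (intro exI[of _ "real \<nu>"]) (auto simp: y_def xb_def A_def)
        qed
        moreover have "integrable M (\<lambda>\<omega>. \<bar>a \<omega>\<bar> + \<bar>\<beta> \<omega>\<bar>)" using a \<beta> by auto
        moreover have "AE \<omega> in M. y \<omega> \<bullet> p \<omega> \<le> \<bar>a \<omega>\<bar> + \<bar>\<beta> \<omega>\<bar>"
          using le by eventually_elim (auto simp: y_def \<beta>_def)
        ultimately have y: "integrable M (\<lambda>\<omega>. y \<omega> \<bullet> p \<omega>)" "(\<integral>\<omega>. y \<omega> \<bullet> p \<omega> \<partial>M) = 0"
          using step.IH unfolding P_def by blast+
        have eq: "(\<lambda>\<omega>. if \<omega> \<in> A \<nu> then \<eta> \<omega> else 0) = (\<lambda>\<omega>. y \<omega> \<bullet> p \<omega> - \<beta> \<omega>)"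
          by (auto simp: y_eq)
        show ?thesis unfolding eq using y \<beta> by auto
      qed
      \<comment> \<open>Since \<open>b - \<eta>\<close> is almost surely nonnegative, monotone
        convergence along \<open>A \<nu>\<close> applies; the integrals of \<open>\<eta>\<close>
        over these sets vanish, and both the integrability of \<open>\<eta>\<close> and its zero
        mean come out.\<close>
      define b where "b \<omega> = \<bar>a \<omega>\<bar> + \<bar>\<beta> \<omega>\<bar>" for \<omega>
      have b: "integrable M b" using a \<beta> by (auto simp: b_def[abs_def])
      note [measurable] = borel_measurable_integrable[OF b]
      have \<eta>_le: "AE \<omega> in M. \<eta> \<omega> \<le> b \<omega>"
        using le by eventually_elim (auto simp: \<eta>_def \<beta>_def b_def inner_diff_left)
      have A_mono: "A \<nu> \<subseteq> A \<mu>" if "\<nu> \<le> \<mu>" for \<nu> \<mu> using that by (auto simp: A_def intro: order_trans)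
      have A_ex: "\<exists>N. \<forall>\<nu>\<ge>N. \<omega> \<in> A \<nu>" if "\<omega> \<in> space M" for \<omega>
      proof -
        obtain N where N: "norm (x \<omega>) \<le> real N" using real_arch_simple by blast
        have "\<omega> \<in> A N" using that component_le_norm_cart[of "x \<omega>"] N by (auto simp: A_def intro: order_trans)
        then show ?thesis using A_mono by blast
      qed
      have lim: "(\<lambda>\<nu>. if \<omega> \<in> A \<nu> then g \<omega> else 0) \<longlonglongrightarrow> g \<omega>" if "\<omega> \<in> space M" for g :: "'w \<Rightarrow> real" and \<omega>
        using A_ex[OF that] by (intro tendsto_eventually) (auto simp: eventually_sequentially)
      have bA: "integrable M (\<lambda>\<omega>. if \<omega> \<in> A \<nu> then b \<omega> else 0)" for \<nu>
        by (rule Bochner_Integration.integrable_bound[OF b]) auto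
      have split: "(\<lambda>\<omega>. if \<omega> \<in> A \<nu> then b \<omega> - \<eta> \<omega> else 0) = (\<lambda>\<omega>. (if \<omega> \<in> A \<nu> then b \<omega> else 0) - (if \<omega> \<in> A \<nu> then \<eta> \<omega> else 0))" for \<nu>
        by auto
      have b_lim: "(\<lambda>\<nu>. \<integral>\<omega>. (if \<omega> \<in> A \<nu> then b \<omega> else 0) \<partial>M) \<longlonglongrightarrow> (\<integral>\<omega>. b \<omega> \<partial>M)"
        by (rule integral_dominated_convergence[where w="\<lambda>\<omega>. \<bar>b \<omega>\<bar>"]) (use b lim in auto)
      have bn: "(\<lambda>\<nu>. \<integral>\<omega>. (if \<omega> \<in> A \<nu> then b \<omega> - \<eta> \<omega> else 0) \<partial>M) \<longlonglongrightarrow> (\<integral>\<omega>. b \<omega> \<partial>M)"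
        unfolding split using cut bA b_lim by (simp add: Bochner_Integration.integral_diff)
      have mono: "AE \<omega> in M. mono (\<lambda>\<nu>. if \<omega> \<in> A \<nu> then b \<omega> - \<eta> \<omega> else 0)"
        using \<eta>_le by eventually_elim (use A_mono in \<open>auto simp: mono_def\<close>)
      have int: "integrable M (\<lambda>\<omega>. if \<omega> \<in> A \<nu> then b \<omega> - \<eta> \<omega> else 0)" for \<nu>
        unfolding split using cut[of \<nu>] by (intro Bochner_Integration.integrable_diff bA) simp
      have AE_lim: "AE \<omega> in M. (\<lambda>\<nu>. if \<omega> \<in> A \<nu> then b \<omega> - \<eta> \<omega> else 0) \<longlonglongrightarrow> b \<omega> - \<eta> \<omega>"
        using lim by (rule AE_I2)
      have meas: "(\<lambda>\<omega>. b \<omega> - \<eta> \<omega>) \<in> borel_measurable M" by measurable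
      have int_diff: "integrable M (\<lambda>\<omega>. b \<omega> - \<eta> \<omega>)"
        by (rule integrable_monotone_convergence[OF int mono AE_lim bn meas])
      moreover have "(\<integral>\<omega>. b \<omega> - \<eta> \<omega> \<partial>M) = (\<integral>\<omega>. b \<omega> \<partial>M)"
        by (rule integral_monotone_convergence[OF int mono AE_lim bn meas])
      ultimately have "integrable M (\<lambda>\<omega>. b \<omega> - (b \<omega> - \<eta> \<omega>))" "(\<integral>\<omega>. b \<omega> - (b \<omega> - \<eta> \<omega>) \<partial>M) = 0"
        using b by (simp_all only: Bochner_Integration.integral_diff[OF b int_diff] Bochner_Integration.integrable_diff)
      then have \<eta>: "integrable M \<eta>" "(\<integral>\<omega>. \<eta> \<omega> \<partial>M) = 0" by simp_all
      have "x \<omega> \<bullet> p \<omega> = \<beta> \<omega> + \<eta> \<omega>" for \<omega> by (simp add: \<beta>_def \<eta>_def inner_diff_left)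
      then show "integrable M (\<lambda>\<omega>. x \<omega> \<bullet> p \<omega>) \<and> (\<integral>\<omega>. x \<omega> \<bullet> p \<omega> \<partial>M) = 0" using \<beta> \<eta> by simp
    qed
  qed
  then have "P 0" by simp
  with x a show ?thesis unfolding P_def by blast
qed

abbreviation E :: "nat \<Rightarrow> ('w \<Rightarrow> real ^ 'n) \<Rightarrow> 'w \<Rightarrow> real ^ 'n" where
  "E t \<equiv> cond_exp_vec M (F t)"

text \<open>\<open>Ef(x, u) < \<infinity>\<close> if and only if there is an integrable majorant, and lower bounds for all integrals of
  majorants express lower bounds for \<open>Ef\<close> without distinguishing infinite values.\<close>

definition majorant :: "('w \<Rightarrow> real ^ 'n) \<Rightarrow> ('w \<Rightarrow> real ^ 'm) \<Rightarrow> ('w \<Rightarrow> real) \<Rightarrow> bool" where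
  "majorant x u a \<longleftrightarrow> x \<in> X \<and> u \<in> U \<and> integrable M a \<and> (AE \<omega> in M. f \<omega> (x \<omega>, u \<omega>) \<le> ereal (a \<omega>))"

text \<open>Unlike \<^term>\<open>X \<inter> adapted F stage\<close>, this is closed under almost sure equality and under
  convergence, as \<^term>\<open>F t\<close> need not contain the null sets.\<close>

definition Xa :: "('w \<Rightarrow> real ^ 'n) set" where
  "Xa = {x\<in>X. \<exists>y\<in>adapted F stage. AE \<omega> in M. x \<omega> = y \<omega>}"

lemma measurable_f:
  assumes "x \<in> borel_measurable M" "u \<in> borel_measurable M"
  shows "(\<lambda>\<omega>. f \<omega> (x \<omega>, u \<omega>)) \<in> borel_measurable M"
  by (rule measurable_normal_integrand[OF normal]) (rule borel_measurable_Pair[OF assms])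

lemma dom_Ef_iff: "(x, u) \<in> dom_Ef M f X U \<longleftrightarrow> (\<exists>a. majorant x u a)"
proof (cases "x \<in> X \<and> u \<in> U")
  case True
  then show ?thesis
    using ext_integral_less_infty_iff[OF measurable_f, of x u] X.measurable_X[of x] U.measurable_X[of u]
    by (simp add: dom_Ef_def integral_functional_def majorant_def)
qed (auto simp: dom_Ef_def majorant_def)

lemma majorant_cong_AE:
  assumes "majorant x u a" "y \<in> borel_measurable M" "AE \<omega> in M. y \<omega> = x \<omega>"
  shows "majorant y u a"
proof -
  have "AE \<omega> in M. f \<omega> (x \<omega>, u \<omega>) \<le> ereal (a \<omega>)" using assms by (simp add: majorant_def)
  with assms(3) have "AE \<omega> in M. f \<omega> (y \<omega>, u \<omega>) \<le> ereal (a \<omega>)" by eventually_elim simp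
  then show ?thesis using assms X.X_cong_AE[of x y] by (simp add: majorant_def)
qed

lemma majorant_mono:
  "majorant x u a \<Longrightarrow> integrable M b \<Longrightarrow> (\<And>\<omega>. a \<omega> \<le> b \<omega>) \<Longrightarrow> majorant x u b"
  unfolding majorant_def by (force elim!: eventually_mono intro: order_trans)

lemma convex_epi_f: "\<omega> \<in> space M \<Longrightarrow> convex (epi (f \<omega>))" and closed_epi_f: "\<omega> \<in> space M \<Longrightarrow> closed (epi (f \<omega>))"
  using normal by (auto simp: convex_normal_integrand_def)

lemma majorant_convex:
  assumes "majorant x u a" "majorant x' u' a'" "0 \<le> s" "0 \<le> t" "s + t = 1"
  shows "majorant (s *\<^sub>R x + t *\<^sub>R x') (s *\<^sub>R u + t *\<^sub>R u') (\<lambda>\<omega>. s * a \<omega> + t * a' \<omega>)"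
proof -
  have "AE \<omega> in M. f \<omega> (x \<omega>, u \<omega>) \<le> ereal (a \<omega>)" "AE \<omega> in M. f \<omega> (x' \<omega>, u' \<omega>) \<le> ereal (a' \<omega>)"
    using assms by (auto simp: majorant_def)
  with AE_space have "AE \<omega> in M. f \<omega> ((s *\<^sub>R x + t *\<^sub>R x') \<omega>, (s *\<^sub>R u + t *\<^sub>R u') \<omega>) \<le> ereal (s * a \<omega> + t * a' \<omega>)"
  proof eventually_elim
    case (elim \<omega>)
    then have "((x \<omega>, u \<omega>), a \<omega>) \<in> epi (f \<omega>)" "((x' \<omega>, u' \<omega>), a' \<omega>) \<in> epi (f \<omega>)" by (auto simp: epi_def)
    from convexD[OF convex_epi_f[OF elim(1)] this assms(3-5)] show ?case by (simp add: epi_def scaleR_fun_def)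
  qed
  then show ?thesis using assms by (auto simp: majorant_def)
qed

lemma majorant_paste:
  assumes "majorant x u a" "majorant x' u' a'" "A \<in> sets M"
  shows "majorant (\<lambda>\<omega>. if \<omega> \<in> A then x \<omega> else x' \<omega>) (\<lambda>\<omega>. if \<omega> \<in> A then u \<omega> else u' \<omega>)
    (\<lambda>\<omega>. if \<omega> \<in> A then a \<omega> else a' \<omega>)"
proof -
  have ae: "AE \<omega> in M. f \<omega> (x \<omega>, u \<omega>) \<le> ereal (a \<omega>)" "AE \<omega> in M. f \<omega> (x' \<omega>, u' \<omega>) \<le> ereal (a' \<omega>)"
    and int: "integrable M a" "integrable M a'"
    using assms by (auto simp: majorant_def)
  have "integrable M (\<lambda>\<omega>. \<bar>a \<omega>\<bar> + \<bar>a' \<omega>\<bar>)" using int by auto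
  then have "integrable M (\<lambda>\<omega>. if \<omega> \<in> A then a \<omega> else a' \<omega>)"
    by (rule Bochner_Integration.integrable_bound)
      (use assms(3) int in \<open>auto intro!: measurable_If_set\<close>)
  moreover have "AE \<omega> in M. f \<omega> (if \<omega> \<in> A then x \<omega> else x' \<omega>, if \<omega> \<in> A then u \<omega> else u' \<omega>) \<le> ereal (if \<omega> \<in> A then a \<omega> else a' \<omega>)"
    using ae by eventually_elim auto
  ultimately show ?thesis
    using X.paste_X[of x x' A] U.paste_X[of u u' A] assms unfolding majorant_def by simp
qed

lemma subspace_Xa: "subspace Xa"
proof (rule subspaceI)
  show "0 \<in> Xa" using subspace_adapted by (auto simp: Xa_def subspace_0 intro!: bexI[of _ 0])
  fix x y assume "x \<in> Xa" "y \<in> Xa"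
  then obtain x' y' where *: "x' \<in> adapted F stage" "y' \<in> adapted F stage" "x \<in> X" "y \<in> X"
    and ae: "AE \<omega> in M. x \<omega> = x' \<omega>" "AE \<omega> in M. y \<omega> = y' \<omega>" by (auto simp: Xa_def)
  have "AE \<omega> in M. (x + y) \<omega> = (x' + y') \<omega>" using ae by eventually_elim simp
  then show "x + y \<in> Xa" using * subspace_adapted subspace_add[of _ x' y'] by (auto simp: Xa_def simp del: plus_fun_apply)
next
  fix x and c :: real assume "x \<in> Xa"
  then obtain x' where *: "x' \<in> adapted F stage" "x \<in> X" and ae: "AE \<omega> in M. x \<omega> = x' \<omega>" by (auto simp: Xa_def)
  have "AE \<omega> in M. (c *\<^sub>R x) \<omega> = (c *\<^sub>R x') \<omega>" using ae by eventually_elim (simp add: scaleR_fun_def)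
  then show "c *\<^sub>R x \<in> Xa" using * subspace_adapted subspace_scale[of _ x' c] by (auto simp: Xa_def)
qed

lemma adapted_Xa: "x \<in> X \<Longrightarrow> x \<in> adapted F stage \<Longrightarrow> x \<in> Xa"
  by (auto simp: Xa_def)

text \<open>If \<open>x - z\<close> only agrees almost surely with an adapted \<open>y\<close>, then
  \<open>x\<close> is replaced by \<open>z + y\<close>, which has the same majorant. So the domain
  may be described by \<open>Xa\<close>.\<close>

lemma dom_value_function_iff:
  "(z, u) \<in> dom_value_function M F stage X U f \<longleftrightarrow>
    z \<in> X \<and> u \<in> U \<and> (\<exists>x a. x - z \<in> Xa \<and> majorant x u a)"
proof
  assume "(z, u) \<in> dom_value_function M F stage X U f"
  then have zu: "z \<in> X" "u \<in> U" and "value_function M F stage X f z u < \<infinity>" by (auto simp: dom_value_function_def)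
  then obtain x where x: "x \<in> X" "x - z \<in> adapted F stage" "integral_functional M f x u < \<infinity>"
    unfolding value_function_def INF_less_iff by auto
  then have "(x, u) \<in> dom_Ef M f X U" using zu by (simp add: dom_Ef_def)
  then show "z \<in> X \<and> u \<in> U \<and> (\<exists>x a. x - z \<in> Xa \<and> majorant x u a)"
    using x zu adapted_Xa[of "x - z"] dom_Ef_iff by auto
next
  assume "z \<in> X \<and> u \<in> U \<and> (\<exists>x a. x - z \<in> Xa \<and> majorant x u a)"
  then obtain x a where zu: "z \<in> X" "u \<in> U" and x: "x - z \<in> Xa" "majorant x u a" by blast
  then obtain y where y: "y \<in> adapted F stage" "AE \<omega> in M. (x - z) \<omega> = y \<omega>" by (auto simp: Xa_def)
  have "majorant (z + y) u a"
  proof (rule majorant_cong_AE[OF x(2)])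
    show "z + y \<in> borel_measurable M" using X.measurable_X[OF zu(1)] adapted_measurable[OF y(1)]
      by (simp add: plus_fun_def)
    show "AE \<omega> in M. (z + y) \<omega> = x \<omega>" using y(2) by eventually_elim (simp add: algebra_simps)
  qed
  then have "(z + y, u) \<in> dom_Ef M f X U" using dom_Ef_iff by blast
  then have "z + y \<in> X" "integral_functional M f (z + y) u < \<infinity>" by (auto simp: dom_Ef_def)
  then have "value_function M F stage X f z u < \<infinity>"
    unfolding value_function_def INF_less_iff using y by (intro bexI[of _ "z + y"]) auto
  then show "(z, u) \<in> dom_value_function M F stage X U f" using zu by (simp add: dom_value_function_def)
qed

text \<open>Convergence implies convergence in mean in both spaces; the sequences are treated as one
  sequence of pairs, so that a single subsequence serves both.\<close>

lemma converges_AE_subseq: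
  assumes s: "\<And>i. s i \<in> X" "x \<in> X" "X.converges s x" and t: "\<And>i. t i \<in> U" "u \<in> U" "U.converges t u"
  obtains r :: "nat \<Rightarrow> nat" where "strict_mono r"
    "AE \<omega> in M. (\<lambda>n. (s (r n) \<omega>, t (r n) \<omega>)) \<longlonglongrightarrow> (x \<omega>, u \<omega>)"
proof -
  let ?d = "\<lambda>i \<omega>. (s i \<omega> - x \<omega>, t i \<omega> - u \<omega>)"
  note [measurable] = X.measurable_X[OF s(1)] X.measurable_X[OF s(2)] U.measurable_X[OF t(1)] U.measurable_X[OF t(2)]
  have int: "integrable M (\<lambda>\<omega>. norm (s i \<omega> - x \<omega>) + norm (t i \<omega> - u \<omega>))" for i
    using X.integrable_norm_X[OF X.mem_diff[OF s(1,2)]] U.integrable_norm_X[OF U.mem_diff[OF t(1,2)]]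
    by simp
  have le: "norm (?d i \<omega>) \<le> norm (s i \<omega> - x \<omega>) + norm (t i \<omega> - u \<omega>)" for i \<omega> by (rule norm_Pair_le)
  have d_int: "integrable M (?d i)" for i
    by (rule Bochner_Integration.integrable_bound[OF int]) (use le in auto)
  have lim: "(\<lambda>i. (\<integral>\<omega>. norm (s i \<omega> - x \<omega>) \<partial>M) + (\<integral>\<omega>. norm (t i \<omega> - u \<omega>) \<partial>M)) \<longlonglongrightarrow> 0 + 0"
    by (intro tendsto_add X.converges_L1 U.converges_L1 s t)
  have bound: "(\<integral>\<omega>. norm (?d i \<omega>) \<partial>M) \<le> (\<integral>\<omega>. norm (s i \<omega> - x \<omega>) \<partial>M) + (\<integral>\<omega>. norm (t i \<omega> - u \<omega>) \<partial>M)" for i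
  proof -
    have "(\<integral>\<omega>. norm (?d i \<omega>) \<partial>M) \<le> (\<integral>\<omega>. norm (s i \<omega> - x \<omega>) + norm (t i \<omega> - u \<omega>) \<partial>M)"
      by (intro integral_mono integrable_norm d_int int le)
    also have "\<dots> = (\<integral>\<omega>. norm (s i \<omega> - x \<omega>) \<partial>M) + (\<integral>\<omega>. norm (t i \<omega> - u \<omega>) \<partial>M)"
      using X.integrable_norm_X[OF X.mem_diff[OF s(1,2)]] U.integrable_norm_X[OF U.mem_diff[OF t(1,2)]]
      by (intro Bochner_Integration.integral_add) simp_all
    finally show ?thesis .
  qed
  have "(\<lambda>i. \<integral>\<omega>. norm (?d i \<omega>) \<partial>M) \<longlonglongrightarrow> 0"
    by (rule tendsto_sandwich[OF always_eventually always_eventually tendsto_const lim[simplified]])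
      (use bound in auto)
  from tendsto_L1_AE_subseq[OF d_int this] obtain r :: "nat \<Rightarrow> nat" where r: "strict_mono r"
    "AE \<omega> in M. (\<lambda>n. ?d (r n) \<omega>) \<longlonglongrightarrow> 0" by blast
  have "AE \<omega> in M. (\<lambda>n. (s (r n) \<omega>, t (r n) \<omega>)) \<longlonglongrightarrow> (x \<omega>, u \<omega>)"
    using r(2)
  proof eventually_elim
    case (elim \<omega>)
    from tendsto_add[OF elim tendsto_const[of "(x \<omega>, u \<omega>)"]] show ?case by simp
  qed
  with r(1) show thesis by (rule that)
qed

lemma U_converges_const: "U.converges (\<lambda>_. u) u"
  by (simp add: U.converges_def U.rho_0)

lemma level_set_closed:
  assumes s: "\<And>i. s i \<in> X" "x \<in> X" "X.converges s x" and t: "\<And>i. t i \<in> U" "u \<in> U" "U.converges t u"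
    and le: "\<And>i. (\<integral>\<^sup>+\<omega>. e2ennreal (f \<omega> (s i \<omega>, t i \<omega>)) \<partial>M) \<le> c"
  shows "(\<integral>\<^sup>+\<omega>. e2ennreal (f \<omega> (x \<omega>, u \<omega>)) \<partial>M) \<le> c"
proof -
  obtain r :: "nat \<Rightarrow> nat" where r: "AE \<omega> in M. (\<lambda>n. (s (r n) \<omega>, t (r n) \<omega>)) \<longlonglongrightarrow> (x \<omega>, u \<omega>)"
    using converges_AE_subseq[OF s t] by blast
  note m = X.measurable_X[OF s(1)] U.measurable_X[OF t(1)]
  have "AE \<omega> in M. e2ennreal (f \<omega> (x \<omega>, u \<omega>)) \<le> liminf (\<lambda>n. e2ennreal (f \<omega> (s (r n) \<omega>, t (r n) \<omega>)))"
    using r AE_space by eventually_elim (rule e2ennreal_lsc[OF closed_epi_f])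
  then have "(\<integral>\<^sup>+\<omega>. e2ennreal (f \<omega> (x \<omega>, u \<omega>)) \<partial>M) \<le> (\<integral>\<^sup>+\<omega>. liminf (\<lambda>n. e2ennreal (f \<omega> (s (r n) \<omega>, t (r n) \<omega>))) \<partial>M)"
    by (rule nn_integral_mono_AE)
  also have "\<dots> \<le> liminf (\<lambda>n. \<integral>\<^sup>+\<omega>. e2ennreal (f \<omega> (s (r n) \<omega>, t (r n) \<omega>)) \<partial>M)"
    by (rule nn_integral_liminf) (intro measurable_compose[OF measurable_f measurable_e2ennreal] m)
  also have "\<dots> \<le> liminf (\<lambda>n. c)" by (rule Liminf_mono) (use le in auto)
  finally show ?thesis by (simp add: Liminf_const)
qed

text \<open>The adapted version of the limit is the componentwise \<open>lim\<close> of adapted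
  versions along a subsequence, which is measurable for \<open>F (stage i)\<close> even where that
  sequence diverges.\<close>

lemma Xa_closed:
  assumes s: "\<And>i. s i \<in> Xa" and x: "x \<in> X" "X.converges s x" shows "x \<in> Xa"
proof -
  have sX: "s i \<in> X" for i using s by (auto simp: Xa_def)
  \<comment> \<open>The constant sequence \<open>ub\<close> merely fills the second
    component.\<close>
  obtain r :: "nat \<Rightarrow> nat" where r: "AE \<omega> in M. (\<lambda>n. (s (r n) \<omega>, ub \<omega>)) \<longlonglongrightarrow> (x \<omega>, ub \<omega>)"
    using converges_AE_subseq[OF sX x ub ub U_converges_const] by blast
  obtain y where y: "\<And>i. y i \<in> adapted F stage" "\<And>i. AE \<omega> in M. s i \<omega> = y i \<omega>"
    using s by (simp add: Xa_def Bex_def) metis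
  define z where "z \<omega> = (\<chi> i. lim (\<lambda>n. y (r n) \<omega> $ i))" for \<omega>
  have "z \<in> adapted F stage"
    using y(1) by (auto simp: adapted_def z_def intro!: borel_measurable_lim_metric)
  moreover have "AE \<omega> in M. \<forall>i. s i \<omega> = y i \<omega>" using y(2) by (simp add: AE_all_countable)
  with r have "AE \<omega> in M. x \<omega> = z \<omega>"
  proof eventually_elim
    case (elim \<omega>)
    have "(\<lambda>n. y (r n) \<omega>) \<longlonglongrightarrow> x \<omega>" using tendsto_fst[OF elim(1)] elim(2) by simp
    then have "lim (\<lambda>n. y (r n) \<omega> $ i) = x \<omega> $ i" for i by (intro limI tendsto_vec_nth)
    then show ?case by (simp add: z_def vec_eq_iff)
  qed
  ultimately show ?thesis using x by (auto simp: Xa_def)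
qed

section \<open>Conditional expectation as an operator on the space of strategies\<close>

lemma E_component [simp]: "E t x \<omega> $ i = real_cond_exp M (F t) (\<lambda>\<omega>. x \<omega> $ i) \<omega>"
  by (simp add: cond_exp_vec_def)

lemma E_linear:
  assumes t: "t \<le> T" and x: "x \<in> X" "y \<in> X"
  shows "AE \<omega> in M. E t (a *\<^sub>R x + b *\<^sub>R y) \<omega> = (a *\<^sub>R E t x + b *\<^sub>R E t y) \<omega>"
proof -
  interpret S: sigma_finite_subalgebra M "F t" by (rule sigma_finite_subalgebra[OF t])
  have "AE \<omega> in M. real_cond_exp M (F t) (\<lambda>\<omega>. a * x \<omega> $ i + b * y \<omega> $ i) \<omega>
      = a * real_cond_exp M (F t) (\<lambda>\<omega>. x \<omega> $ i) \<omega> + b * real_cond_exp M (F t) (\<lambda>\<omega>. y \<omega> $ i) \<omega>" for i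
  proof -
    have i: "integrable M (\<lambda>\<omega>. x \<omega> $ i)" "integrable M (\<lambda>\<omega>. y \<omega> $ i)" using x by (auto intro: X.integrable_component)
    from S.real_cond_exp_add[OF integrable_mult_right[OF i(1), of a] integrable_mult_right[OF i(2), of b]]
      S.real_cond_exp_cmult[OF i(1), of a] S.real_cond_exp_cmult[OF i(2), of b]
    show ?thesis by eventually_elim simp
  qed
  then have "AE \<omega> in M. \<forall>i. real_cond_exp M (F t) (\<lambda>\<omega>. a * x \<omega> $ i + b * y \<omega> $ i) \<omega>
      = a * real_cond_exp M (F t) (\<lambda>\<omega>. x \<omega> $ i) \<omega> + b * real_cond_exp M (F t) (\<lambda>\<omega>. y \<omega> $ i) \<omega>"
    by (simp add: AE_all_countable)
  then show ?thesis by eventually_elim (simp add: vec_eq_iff scaleR_fun_def)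
qed

lemma pairing_E:
  assumes t: "t \<le> T" and x: "x \<in> X" and v: "v \<in> Linfty M"
  shows "E t v \<in> V" "pairing M (E t x) v = pairing M x (E t v)"
proof -
  interpret S: sigma_finite_subalgebra M "F t" by (rule sigma_finite_subalgebra[OF t])
  obtain C where C: "AE \<omega> in M. norm (v \<omega>) \<le> C" and [measurable]: "v \<in> borel_measurable M"
    using v by (auto simp: Linfty_def)
  have vV: "v \<in> V" using v X.Linfty_subset by blast
  have vi: "integrable M (\<lambda>\<omega>. v \<omega> $ i)" for i by (rule X.integrable_component_V[OF vV])
  have b: "AE \<omega> in M. \<bar>v \<omega> $ i\<bar> \<le> C" for i
    using C by eventually_elim (rule order_trans[OF component_le_norm_cart])
  have "AE \<omega> in M. real_cond_exp M (F t) (\<lambda>\<omega>. v \<omega> $ i) \<omega> \<le> C" for i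
  proof (rule S.real_cond_exp_le_c[OF vi])
    show "AE \<omega> in M. v \<omega> $ i \<le> C" using b[of i] by eventually_elim linarith
  qed
  moreover have "AE \<omega> in M. - C \<le> real_cond_exp M (F t) (\<lambda>\<omega>. v \<omega> $ i) \<omega>" for i
  proof (rule S.real_cond_exp_ge_c[OF vi])
    show "AE \<omega> in M. - C \<le> v \<omega> $ i" using b[of i] by eventually_elim linarith
  qed
  ultimately have Eb: "AE \<omega> in M. \<bar>E t v \<omega> $ i\<bar> \<le> C" for i
    by (rule_tac eventually_elim2[of _ _ "\<lambda>\<omega>. - C \<le> E t v \<omega> $ i"]) (auto simp: abs_le_iff)
  have Em: "E t v \<in> borel_measurable M" by (simp add: borel_measurable_vec_iff)
  have "AE \<omega> in M. \<forall>i. \<bar>E t v \<omega> $ i\<bar> \<le> C" using Eb by (simp only: AE_all_countable) blast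
  then have "AE \<omega> in M. norm (E t v \<omega>) \<le> (\<Sum>i\<in>(UNIV::'n set). C)"
    by eventually_elim (rule order_trans[OF norm_le_l1_cart], rule sum_mono, blast)
  with Em have "E t v \<in> Linfty M" by (auto simp: Linfty_def)
  then show EV: "E t v \<in> V" using X.Linfty_subset by blast
  have "(\<integral>\<omega>. E t x \<omega> $ i * v \<omega> $ i \<partial>M) = (\<integral>\<omega>. x \<omega> $ i * E t v \<omega> $ i \<partial>M)" for i
  proof -
    have xi: "integrable M (\<lambda>\<omega>. x \<omega> $ i)" by (rule X.integrable_component[OF x])
    have "integrable M (\<lambda>\<omega>. v \<omega> $ i * real_cond_exp M (F t) (\<lambda>\<omega>. \<bar>x \<omega> $ i\<bar>) \<omega>)"
    proof (rule Bochner_Integration.integrable_bound)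
      show "integrable M (\<lambda>\<omega>. C * real_cond_exp M (F t) (\<lambda>\<omega>. \<bar>x \<omega> $ i\<bar>) \<omega>)"
        using xi by (intro integrable_mult_right S.real_cond_exp_int) auto
      show "AE \<omega> in M. norm (v \<omega> $ i * real_cond_exp M (F t) (\<lambda>\<omega>. \<bar>x \<omega> $ i\<bar>) \<omega>) \<le> norm (C * real_cond_exp M (F t) (\<lambda>\<omega>. \<bar>x \<omega> $ i\<bar>) \<omega>)"
        using b[of i] by eventually_elim (auto simp: abs_mult intro!: mult_right_mono)
    qed measurable
    from S.integrable_cond_exp_swap(2)[OF vi xi this] show ?thesis by (simp add: mult.commute)
  qed
  then show "pairing M (E t x) v = pairing M x (E t v)"
    using X.pairing_sum[OF cond_exp_X[OF t x] vV] X.pairing_sum[OF x EV] by simp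
qed

text \<open>Closed graph argument: \<open>E\<^sub>t\<close> has a closed graph in \<open>X \<times> X\<close>, as it is symmetric with respect
  to bounded test functions.\<close>

lemma dual_cond_exp:
  assumes t: "t \<le> T" and s: "s \<in> X.dual"
  shows "(\<lambda>x. s (E t x)) \<in> X.dual"
proof -
  \<comment> \<open>The inverse of the graph, taken modulo null sets and cut down to where
    \<open>s\<close> is bounded by one; a ball in its projection is a ball on which the composition
    with \<open>s\<close> is bounded.\<close>
  define R where "R = {(w, e). w \<in> X \<and> e \<in> X \<and> (AE \<omega> in M. w \<omega> = E t e \<omega>) \<and> \<bar>s w\<bar> \<le> 1}"
  have graph: "(E t e, e) \<in> R" if "e \<in> X" "\<bar>s (E t e)\<bar> \<le> 1" for e
    using that cond_exp_X[OF t] by (simp add: R_def)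
  have s_eq: "s (E t e) = s w" if "(w, e) \<in> R" for w e
    using that X.dual_cong_AE[OF s, of w "E t e"] cond_exp_X[OF t] by (auto simp: R_def)
  have lin: "s (E t (a *\<^sub>R x + b *\<^sub>R y)) = a * s (E t x) + b * s (E t y)" if xy: "x \<in> X" "y \<in> X" for a b x y
  proof -
    have "s (E t (a *\<^sub>R x + b *\<^sub>R y)) = s (a *\<^sub>R E t x + b *\<^sub>R E t y)"
      by (rule X.dual_cong_AE[OF s]) (use xy cond_exp_X[OF t] E_linear[OF t xy] in auto)
    also have "\<dots> = a * s (E t x) + b * s (E t y)"
      using xy cond_exp_X[OF t] by (simp add: X.dual_add[OF s] X.dual_scale[OF s])
    finally show ?thesis .
  qed
  obtain k \<epsilon> where ball: "0 < \<epsilon>" "\<And>e. e \<in> X \<Longrightarrow> X.nrm k e \<le> \<epsilon> \<Longrightarrow> \<exists>w. (w, e) \<in> R"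
  proof (rule convex_open_mapping[OF X.complete_seminorms_axioms X.complete_seminorms_axioms, of R "E t 0"])
    show "R \<subseteq> X \<times> X" by (auto simp: R_def)
    show "convex R"
    proof (rule convexI)
      fix p q and u v :: real assume pq: "p \<in> R" "q \<in> R" and uv: "0 \<le> u" "0 \<le> v" "u + v = 1"
      obtain w e w' e' where p: "p = (w, e)" and q: "q = (w', e')" by fastforce
      have mem: "w \<in> X" "e \<in> X" "w' \<in> X" "e' \<in> X" and le: "\<bar>s w\<bar> \<le> 1" "\<bar>s w'\<bar> \<le> 1"
        and ae: "AE \<omega> in M. w \<omega> = E t e \<omega>" "AE \<omega> in M. w' \<omega> = E t e' \<omega>"
        using pq by (auto simp: R_def p q)
      have "AE \<omega> in M. (u *\<^sub>R w + v *\<^sub>R w') \<omega> = E t (u *\<^sub>R e + v *\<^sub>R e') \<omega>"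
        using ae E_linear[OF t mem(2,4), of u v] by eventually_elim (simp add: scaleR_fun_def)
      moreover have "\<bar>u * s w + v * s w'\<bar> \<le> 1"
      proof -
        have "\<bar>u * s w + v * s w'\<bar> \<le> u * \<bar>s w\<bar> + v * \<bar>s w'\<bar>"
          using uv by (intro order_trans[OF abs_triangle_ineq]) (simp add: abs_mult)
        also have "\<dots> \<le> 1" by (rule convex_bound_le[OF le uv])
        finally show ?thesis .
      qed
      ultimately show "u *\<^sub>R p + v *\<^sub>R q \<in> R"
        using mem by (simp add: R_def p q X.dual_add[OF s] X.dual_scale[OF s])
    qed
    \<comment> \<open>The base point is \<open>E t 0\<close>, so that \<open>graph\<close> applies
      to it; linearity with zero coefficients gives the value of \<open>s\<close> there.\<close>
    have "s (E t 0) = 0" using lin[of 0 0 0 0] by simp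
    then show "(E t 0, 0) \<in> R" by (intro graph) auto
    show "\<exists>c>0. \<exists>w. (w, c *\<^sub>R e) \<in> R" if e: "e \<in> X" for e
    proof -
      let ?c = "inverse (1 + \<bar>s (E t e)\<bar>)"
      have c: "0 < ?c" by (simp add: add_pos_nonneg)
      have eq: "s (E t (?c *\<^sub>R e)) = ?c * s (E t e)" using lin[OF e e, of ?c 0] by simp
      have "\<bar>s (E t (?c *\<^sub>R e))\<bar> \<le> 1" unfolding eq by (simp add: abs_mult field_simps)
      with c e show ?thesis by (intro exI[of _ ?c]) (auto intro!: exI[of _ "E t (?c *\<^sub>R e)"] graph)
    qed
    fix p q x y assume R: "\<And>i::nat. (p i, q i) \<in> R" and xy: "x \<in> X" "y \<in> X"
      and conv: "X.converges p x" "X.converges q y"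
    have mem: "p i \<in> X" "q i \<in> X" "\<bar>s (p i)\<bar> \<le> 1" "AE \<omega> in M. p i \<omega> = E t (q i) \<omega>" for i using R[of i] by (auto simp: R_def)
    have "(\<lambda>i. \<bar>s (p i)\<bar>) \<longlonglongrightarrow> \<bar>s x\<bar>"
      by (intro tendsto_rabs X.topological_dual_converges[OF s mem(1) xy(1) conv(1)])
    then have sx: "\<bar>s x\<bar> \<le> 1" by (rule LIMSEQ_le_const2) (use mem in auto)
    have Ey: "E t y \<in> X" by (rule cond_exp_X[OF t xy(2)])
    define d where "d = x - E t y"
    have d: "d \<in> X" using xy Ey by (simp add: d_def)
    \<comment> \<open>Testing the defect \<open>d\<close> with its own sign, a bounded function,
      shows that its norm has integral zero.\<close>
    define v where "v = (\<lambda>\<omega>. sgn (d \<omega>))"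
    have v: "v \<in> Linfty M" unfolding v_def Linfty_def
      using X.measurable_V[OF X.sgn_V[OF d]] by (auto simp: norm_sgn intro!: exI[of _ 1])
    have vV: "v \<in> V" unfolding v_def by (rule X.sgn_V[OF d])
    have "pairing M (p i) v = pairing M (q i) (E t v)" for i
    proof -
      have "pairing M (p i) v = pairing M (E t (q i)) v"
        by (rule X.dual_cong_AE[OF X.pairing_dual[OF vV]]) (use mem cond_exp_X[OF t] in auto)
      then show ?thesis by (simp add: pairing_E[OF t mem(2) v])
    qed
    then have "(\<lambda>i. pairing M (q i) (E t v)) \<longlonglongrightarrow> pairing M x v"
      using X.pairing_converges[OF conv(1) mem(1) xy(1) vV] by simp
    moreover have "(\<lambda>i. pairing M (q i) (E t v)) \<longlonglongrightarrow> pairing M y (E t v)"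
      by (rule X.pairing_converges[OF conv(2) mem(2) xy(2) pairing_E(1)[OF t xy(2) v]])
    ultimately have "pairing M x v = pairing M (E t y) v"
      using pairing_E(2)[OF t xy(2) v] LIMSEQ_unique by fastforce
    then have "pairing M d v = 0" unfolding d_def by (simp add: X.pairing_diff[OF xy(1) Ey vV])
    then have "(\<integral>\<omega>. norm (d \<omega>) \<partial>M) = 0" using X.pairing_sgn[OF d] by (simp add: v_def)
    then have "AE \<omega> in M. norm (d \<omega>) = 0"
      using integral_nonneg_eq_0_iff_AE[OF X.integrable_norm_X[OF d]] by simp
    then have "AE \<omega> in M. x \<omega> = E t y \<omega>" by eventually_elim (simp add: d_def)
    then show "(x, y) \<in> R" using xy sx by (simp add: R_def)
  qed blast
  show ?thesis
  proof (rule X.topological_dualI[OF _ ball(1)])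
    show "linear_on_subspace X (\<lambda>x. s (E t x))" unfolding linear_on_subspace_def using lin by blast
    fix x assume "x \<in> X" "X.nrm k x \<le> \<epsilon>"
    then obtain w where "(w, x) \<in> R" using ball(2) by blast
    with s_eq[OF this] show "s (E t x) \<le> 1" by (auto simp: R_def)
  qed
qed

end

section \<open>Dual multipliers\<close>

lemma pos_iff: "v \<in> pos C \<longleftrightarrow> (\<exists>r>0. \<exists>c\<in>C. v = r *\<^sub>R c)"
  by (auto simp: pos_def)

lemma (in complete_seminorms) converges_diff:
  assumes s: "\<And>i. s i \<in> X" "x \<in> X" "converges s x" and t: "\<And>i. t i \<in> X" "y \<in> X" "converges t y"
  shows "converges (\<lambda>i. s i - t i) (x - y)"
proof (rule convergesI_nrm)
  fix k
  have "(\<lambda>i. nrm k (s i - x) + nrm k (t i - y)) \<longlonglongrightarrow> 0 + 0"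
    by (intro tendsto_add converges_nrm s t)
  then have lim: "(\<lambda>i. nrm k (s i - x) + nrm k (t i - y)) \<longlonglongrightarrow> 0" by simp
  have le: "nrm k (s i - t i - (x - y)) \<le> nrm k (s i - x) + nrm k (t i - y)" for i
  proof -
    have eq: "s i - t i - (x - y) = (s i - x) + (y - t i)" by simp
    show ?thesis unfolding eq nrm_commute[OF t(1,2), of k i] by (rule nrm_triangle) (use s t in auto)
  qed
  have ge: "0 \<le> nrm k (s i - t i - (x - y))" for i using s t by simp
  show "(\<lambda>i. nrm k (s i - t i - (x - y))) \<longlonglongrightarrow> 0"
    by (rule tendsto_sandwich[OF always_eventually always_eventually tendsto_const lim]) (use le ge in auto)
qed (use s t in auto)

lemma small_factor:
  fixes y :: real assumes "0 \<le> y" obtains t where "0 < t" "t \<le> 1" "t * y \<le> 1"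
  by (rule that[of "inverse (1 + y)"]) (use assms in \<open>auto simp: field_simps\<close>)

context stochastic_program
begin

lemma level_set_iff:
  assumes "x \<in> X" "u \<in> U" "0 \<le> n"
  shows "(\<integral>\<^sup>+\<omega>. e2ennreal (f \<omega> (x \<omega>, u \<omega>)) \<partial>M) \<le> ennreal n \<longleftrightarrow>
    (\<exists>a. majorant x u a \<and> (\<forall>\<omega>. 0 \<le> a \<omega>) \<and> (\<integral>\<omega>. a \<omega> \<partial>M) \<le> n)"
  using nn_integral_e2ennreal_le_iff[OF measurable_f[OF X.measurable_X[OF assms(1)] U.measurable_X[OF assms(2)]] assms(3)] assms
  by (auto simp: majorant_def)

lemma majorant_abs: "majorant x u a \<Longrightarrow> majorant x u (\<lambda>\<omega>. \<bar>a \<omega>\<bar>)"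
  by (rule majorant_mono[of x u a]) (auto simp: majorant_def)

lemma level_set_convex:
  assumes mem: "x \<in> X" "u \<in> U" "x' \<in> X" "u' \<in> U" and n: "0 \<le> n" and st: "0 \<le> s" "0 \<le> t" "s + t = 1"
    and le: "(\<integral>\<^sup>+\<omega>. e2ennreal (f \<omega> (x \<omega>, u \<omega>)) \<partial>M) \<le> ennreal n"
      "(\<integral>\<^sup>+\<omega>. e2ennreal (f \<omega> (x' \<omega>, u' \<omega>)) \<partial>M) \<le> ennreal n"
  shows "(\<integral>\<^sup>+\<omega>. e2ennreal (f \<omega> ((s *\<^sub>R x + t *\<^sub>R x') \<omega>, (s *\<^sub>R u + t *\<^sub>R u') \<omega>)) \<partial>M) \<le> ennreal n"
proof -
  obtain a where a: "majorant x u a" "\<And>\<omega>. 0 \<le> a \<omega>" "(\<integral>\<omega>. a \<omega> \<partial>M) \<le> n" using le(1) level_set_iff[OF mem(1,2) n] by blast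
  obtain b where b: "majorant x' u' b" "\<And>\<omega>. 0 \<le> b \<omega>" "(\<integral>\<omega>. b \<omega> \<partial>M) \<le> n" using le(2) level_set_iff[OF mem(3,4) n] by blast
  have i: "integrable M a" "integrable M b" using a b by (auto simp: majorant_def)
  have "(\<integral>\<omega>. s * a \<omega> + t * b \<omega> \<partial>M) = s * (\<integral>\<omega>. a \<omega> \<partial>M) + t * (\<integral>\<omega>. b \<omega> \<partial>M)" using i by simp
  also have "\<dots> \<le> n" using a(3) b(3) st by (rule convex_bound_le)
  finally show ?thesis
    using majorant_convex[OF a(1) b(1) st] a(2) b(2) st mem
    by (subst level_set_iff[OF _ _ n]) (auto intro!: exI[of _ "\<lambda>\<omega>. s * a \<omega> + t * b \<omega>"])
qed

text \<open>Holding \<open>u\<close> at \<open>ub\<close> turns the closed cone in the product space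
  into one in \<open>X\<close> alone, namely its preimage under
  \<open>z \<mapsto> (z, 0)\<close>.\<close>

lemma slice_closed:
  assumes "closedin (prod_topology X.seminorm_topology U.seminorm_topology) P"
  shows "closedin X.seminorm_topology {z\<in>X. (z, 0) \<in> P}"
proof -
  have "continuous_map X.seminorm_topology (prod_topology X.seminorm_topology U.seminorm_topology) (\<lambda>z. (z, 0))"
    by (intro continuous_map_pairedI) (auto simp: U.topspace_seminorm_topology)
  from closedin_continuous_map_preimage[OF this assms] show ?thesis
    by (simp add: X.topspace_seminorm_topology)
qed

text \<open>A subgradient of \<open>z \<mapsto> \<phi>(z, ub)\<close> at the origin.\<close>

lemma multiplier_X:
  assumes sub: "subspace (pos ((\<lambda>c. c - (0, ub)) ` dom_value_function M F stage X U f))" (is "subspace ?P")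
    and closed: "closedin (prod_topology X.seminorm_topology U.seminorm_topology)
      (pos ((\<lambda>c. c - (0, ub)) ` dom_value_function M F stage X U f))"
    and low: "\<And>x a. majorant x ub a \<Longrightarrow> x \<in> Xa \<Longrightarrow> c \<le> (\<integral>\<omega>. a \<omega> \<partial>M)"
  obtains l where "l \<in> X.dual" "\<And>x. x \<in> Xa \<Longrightarrow> l x = 0"
    "\<And>x a. majorant x ub a \<Longrightarrow> c + l x \<le> (\<integral>\<omega>. a \<omega> \<partial>M)"
proof -
  define L where "L = {z\<in>X. (z, 0) \<in> ?P}"
  have L_iff: "z \<in> L \<longleftrightarrow> z \<in> X \<and> (\<exists>r>0. \<exists>d x a. z = r *\<^sub>R d \<and> d \<in> X \<and> x - d \<in> Xa \<and> majorant x ub a)" for z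
  proof
    assume z: "z \<in> L"
    then have "(z, 0) \<in> ?P" by (simp add: L_def)
    then obtain r e where r: "0 < r" "(z, 0) = r *\<^sub>R e" "e \<in> (\<lambda>c. c - (0, ub)) ` dom_value_function M F stage X U f"
      unfolding pos_iff by blast
    then obtain d u where e: "e = (d, u) - (0, ub)" "(d, u) \<in> dom_value_function M F stage X U f" by auto
    from r e have "z = r *\<^sub>R d" "u = ub" by auto
    with r(1) e(2) z show "z \<in> X \<and> (\<exists>r>0. \<exists>d x a. z = r *\<^sub>R d \<and> d \<in> X \<and> x - d \<in> Xa \<and> majorant x ub a)"
      unfolding dom_value_function_iff by (auto simp: L_def)
  next
    assume "z \<in> X \<and> (\<exists>r>0. \<exists>d x a. z = r *\<^sub>R d \<and> d \<in> X \<and> x - d \<in> Xa \<and> majorant x ub a)"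
    then obtain r d x a where z: "z \<in> X" "0 < r" "z = r *\<^sub>R d" "d \<in> X" "x - d \<in> Xa" "majorant x ub a" by blast
    then have "(d, ub) \<in> dom_value_function M F stage X U f" using ub dom_value_function_iff by blast
    then have "(d, ub) - (0, ub) \<in> (\<lambda>c. c - (0, ub)) ` dom_value_function M F stage X U f" by blast
    moreover have "(z, 0) = r *\<^sub>R ((d, ub) - (0, ub))" using z by simp
    ultimately have "(z, 0) \<in> ?P" using z(2) unfolding pos_iff by blast
    with z(1) show "z \<in> L" by (simp add: L_def)
  qed
  have subL: "subspace L"
  proof (rule subspaceI)
    show "0 \<in> L" using subspace_0[OF sub] by (simp add: L_def zero_prod_def)
    show "x + y \<in> L" if "x \<in> L" "y \<in> L" for x y
      using that subspace_add[OF sub, of "(x, 0)" "(y, 0)"] by (simp add: L_def)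
    show "r *\<^sub>R x \<in> L" if "x \<in> L" for x r
      using that subspace_scale[OF sub, of "(x, 0)" r] by (simp add: L_def)
  qed
  have LX: "L \<subseteq> X" by (auto simp: L_def)
  have L_closed: "x \<in> L" if "\<And>i. s i \<in> L" "x \<in> X" "X.converges s x" for s x
    using X.closedin_converges[OF slice_closed[OF closed], of s x] that unfolding L_def by blast
  interpret L: complete_seminorms L \<rho>
    by (rule X.complete_seminorms_subset[OF subL LX L_closed])
  obtain x0 a0 where x0: "x0 \<in> Xa" "majorant x0 ub a0"
  proof -
    have "0 \<in> L" using subL by (rule subspace_0)
    then obtain r d x a where *: "0 < r" "0 = r *\<^sub>R d" "x - d \<in> Xa" "majorant x ub a" unfolding L_iff by blast
    then have "d = 0" by simp
    with * show thesis using that by simp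
  qed
  have x0X: "x0 \<in> X" using x0 by (simp add: Xa_def)
  \<comment> \<open>The added 1 is the allowance for a second majorant, which
    \<open>small_factor\<close> scales to have integral at most one.\<close>
  define n where "n = (\<integral>\<omega>. \<bar>a0 \<omega>\<bar> \<partial>M) + 1"
  have n0: "0 \<le> n" by (simp add: n_def add_nonneg_nonneg)
  have ia0: "integrable M a0" using x0 by (simp add: majorant_def)
  define R where "R = {(x, z). x \<in> X \<and> z \<in> L \<and> x - z \<in> Xa \<and> (\<integral>\<^sup>+\<omega>. e2ennreal (f \<omega> (x \<omega>, ub \<omega>)) \<partial>M) \<le> ennreal n}"
  have R_iff: "(x, z) \<in> R \<longleftrightarrow> x \<in> X \<and> z \<in> L \<and> x - z \<in> Xa \<and> (\<integral>\<^sup>+\<omega>. e2ennreal (f \<omega> (x \<omega>, ub \<omega>)) \<partial>M) \<le> ennreal n" for x z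
    unfolding R_def by blast
  obtain k \<epsilon> where ball: "0 < \<epsilon>" "\<And>e. e \<in> L \<Longrightarrow> X.nrm k e \<le> \<epsilon> \<Longrightarrow> \<exists>x. (x, e) \<in> R"
  proof (rule convex_open_mapping[OF X.complete_seminorms_axioms L.complete_seminorms_axioms, of R x0])
    show "R \<subseteq> X \<times> L" by (auto simp: R_def)
    show "convex R"
    proof (rule convexI)
      fix p q and s t :: real assume pq: "p \<in> R" "q \<in> R" and st: "0 \<le> s" "0 \<le> t" "s + t = 1"
      obtain x z x' z' where p: "p = (x, z)" and q: "q = (x', z')" by fastforce
      have mem: "x \<in> X" "z \<in> L" "x - z \<in> Xa" "x' \<in> X" "z' \<in> L" "x' - z' \<in> Xa" using pq by (auto simp: R_def p q)
      have ubc: "s *\<^sub>R ub + t *\<^sub>R ub = ub" using st by (simp flip: scaleR_add_left)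
      have "s *\<^sub>R (x - z) + t *\<^sub>R (x' - z') \<in> Xa"
        using mem subspace_Xa by (intro subspace_add subspace_scale)
      also have "s *\<^sub>R (x - z) + t *\<^sub>R (x' - z') = s *\<^sub>R x + t *\<^sub>R x' - (s *\<^sub>R z + t *\<^sub>R z')"
        by (simp add: algebra_simps)
      finally have "s *\<^sub>R x + t *\<^sub>R x' - (s *\<^sub>R z + t *\<^sub>R z') \<in> Xa" .
      moreover have "(\<integral>\<^sup>+\<omega>. e2ennreal (f \<omega> ((s *\<^sub>R x + t *\<^sub>R x') \<omega>, ub \<omega>)) \<partial>M) \<le> ennreal n"
        using level_set_convex[OF mem(1) ub mem(4) ub n0 st] pq unfolding ubc p q R_iff by blast
      moreover have "s *\<^sub>R x + t *\<^sub>R x' \<in> X" "s *\<^sub>R z + t *\<^sub>R z' \<in> L" using mem by auto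
      moreover have "s *\<^sub>R p + t *\<^sub>R q = (s *\<^sub>R x + t *\<^sub>R x', s *\<^sub>R z + t *\<^sub>R z')" by (simp add: p q)
      ultimately show "s *\<^sub>R p + t *\<^sub>R q \<in> R" by (simp only: R_iff)
    qed
    show "(x0, 0) \<in> R"
      using level_set_iff[OF x0X ub n0] majorant_abs[OF x0(2)] x0 x0X subspace_0[OF subL]
      by (auto simp: R_def n_def intro!: exI[of _ "\<lambda>\<omega>. \<bar>a0 \<omega>\<bar>"])
    show "\<exists>t>0. \<exists>x. (x, t *\<^sub>R e) \<in> R" if e: "e \<in> L" for e
    proof -
      obtain r d x a where d: "0 < r" "e = r *\<^sub>R d" "d \<in> X" "x - d \<in> Xa" "majorant x ub a"
        using e unfolding L_iff by blast
      have xX: "x \<in> X" and ia: "integrable M a" using d by (auto simp: majorant_def)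
      have I: "0 \<le> (\<integral>\<omega>. \<bar>a \<omega>\<bar> \<partial>M)" "0 \<le> (\<integral>\<omega>. \<bar>a0 \<omega>\<bar> \<partial>M)" by auto
      obtain t where t: "0 < t" "t \<le> 1" "t * (\<integral>\<omega>. \<bar>a \<omega>\<bar> \<partial>M) \<le> 1"
        using small_factor[OF I(1)] by blast
      let ?x = "(1 - t) *\<^sub>R x0 + t *\<^sub>R x" and ?a = "\<lambda>\<omega>. (1 - t) * \<bar>a0 \<omega>\<bar> + t * \<bar>a \<omega>\<bar>"
      have "majorant ?x ((1 - t) *\<^sub>R ub + t *\<^sub>R ub) ?a"
        using t by (intro majorant_convex majorant_abs x0 d) auto
      then have "majorant ?x ub ?a" by (simp flip: scaleR_add_left)
      moreover have "(\<integral>\<omega>. ?a \<omega> \<partial>M) \<le> n"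
      proof -
        have "(\<integral>\<omega>. ?a \<omega> \<partial>M) = (1 - t) * (\<integral>\<omega>. \<bar>a0 \<omega>\<bar> \<partial>M) + t * (\<integral>\<omega>. \<bar>a \<omega>\<bar> \<partial>M)" using ia ia0 by simp
        also have "\<dots> \<le> 1 * (\<integral>\<omega>. \<bar>a0 \<omega>\<bar> \<partial>M) + 1" using t I by (intro add_mono mult_right_mono) auto
        finally show ?thesis by (simp add: n_def)
      qed
      ultimately have "(\<integral>\<^sup>+\<omega>. e2ennreal (f \<omega> (?x \<omega>, ub \<omega>)) \<partial>M) \<le> ennreal n"
        using t xX x0X by (subst level_set_iff[OF _ ub n0]) (auto intro!: exI[of _ ?a])
      moreover have "(1 - t) *\<^sub>R x0 + t *\<^sub>R (x - d) \<in> Xa"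
        using x0 d subspace_Xa by (intro subspace_add subspace_scale)
      then have "?x - t *\<^sub>R d \<in> Xa" by (simp add: algebra_simps)
      moreover have "t *\<^sub>R d = (t / r) *\<^sub>R e" using d by simp
      moreover have "(t / r) *\<^sub>R e \<in> L" using subL e by (rule subspace_scale)
      ultimately have "(?x, (t / r) *\<^sub>R e) \<in> R" using xX x0X by (simp only: R_iff X.mem_add X.mem_scale)
      then show ?thesis using t d(1) by (intro exI[of _ "t / r"]) auto
    qed
    fix p q x y assume R: "\<And>i::nat. (p i, q i) \<in> R" and xy: "x \<in> X" "y \<in> L"
      and conv: "X.converges p x" "X.converges q y"
    have mem: "p i \<in> X" "q i \<in> X" "p i - q i \<in> Xa" "(\<integral>\<^sup>+\<omega>. e2ennreal (f \<omega> (p i \<omega>, ub \<omega>)) \<partial>M) \<le> ennreal n" for i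
      using R[of i] LX by (auto simp: R_def)
    have yX: "y \<in> X" using xy LX by blast
    have "X.converges (\<lambda>i. p i - q i) (x - y)"
      by (rule X.converges_diff[OF mem(1) xy(1) conv(1) mem(2) yX conv(2)])
    from Xa_closed[OF mem(3) X.mem_diff[OF xy(1) yX] this] have "x - y \<in> Xa" .
    moreover have "(\<integral>\<^sup>+\<omega>. e2ennreal (f \<omega> (x \<omega>, ub \<omega>)) \<partial>M) \<le> ennreal n"
      by (rule level_set_closed[OF mem(1) xy(1) conv(1) ub ub U_converges_const mem(4)])
    ultimately show "(x, y) \<in> R" using xy by (simp only: R_iff)
  qed blast
  \<comment> \<open>Replaces the epigraph of the value function at \<open>ub\<close>: heights above
    integrals of majorants, so that neither infinite values nor attainment of the infimum have to be
    discussed.\<close>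
  define G where "G = {(z, r). z \<in> X \<and> (\<exists>x a. x - z \<in> Xa \<and> majorant x ub a \<and> (\<integral>\<omega>. a \<omega> \<partial>M) \<le> r)}"
  have G_iff: "(z, r) \<in> G \<longleftrightarrow> z \<in> X \<and> (\<exists>x a. x - z \<in> Xa \<and> majorant x ub a \<and> (\<integral>\<omega>. a \<omega> \<partial>M) \<le> r)" for z r
    unfolding G_def by blast
  obtain l C where l: "linear_on_subspace X l" "\<And>x. x \<in> X \<Longrightarrow> l x \<le> C * X.nrm k x"
    "\<And>d r. (d, r) \<in> G \<Longrightarrow> c + l d \<le> r"
  proof (rule X.subgradient[of G L c \<epsilon> k n])
    show "convex G"
    proof (rule convexI)
      fix p q and s t :: real assume pq: "p \<in> G" "q \<in> G" and st: "0 \<le> s" "0 \<le> t" "s + t = 1"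
      obtain z r z' r' where p: "p = (z, r)" and q: "q = (z', r')" by fastforce
      obtain x a where x: "z \<in> X" "x - z \<in> Xa" "majorant x ub a" "(\<integral>\<omega>. a \<omega> \<partial>M) \<le> r" using pq unfolding p q G_iff by blast
      obtain x' a' where x': "z' \<in> X" "x' - z' \<in> Xa" "majorant x' ub a'" "(\<integral>\<omega>. a' \<omega> \<partial>M) \<le> r'" using pq unfolding p q G_iff by blast
      have i: "integrable M a" "integrable M a'" using x x' by (auto simp: majorant_def)
      have "majorant (s *\<^sub>R x + t *\<^sub>R x') ub (\<lambda>\<omega>. s * a \<omega> + t * a' \<omega>)"
        using majorant_convex[OF x(3) x'(3) st] st by (simp flip: scaleR_add_left)
      moreover have "s *\<^sub>R (x - z) + t *\<^sub>R (x' - z') \<in> Xa"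
        using x x' subspace_Xa by (intro subspace_add subspace_scale)
      moreover have "s *\<^sub>R (x - z) + t *\<^sub>R (x' - z') = s *\<^sub>R x + t *\<^sub>R x' - (s *\<^sub>R z + t *\<^sub>R z')"
        by (simp add: algebra_simps)
      ultimately have "s *\<^sub>R x + t *\<^sub>R x' - (s *\<^sub>R z + t *\<^sub>R z') \<in> Xa" "majorant (s *\<^sub>R x + t *\<^sub>R x') ub (\<lambda>\<omega>. s * a \<omega> + t * a' \<omega>)"
        by simp_all
      moreover have "(\<integral>\<omega>. s * a \<omega> + t * a' \<omega> \<partial>M) \<le> s * r + t * r'"
        using i x(4) x'(4) st by (simp add: add_mono mult_left_mono)
      moreover have "s *\<^sub>R z + t *\<^sub>R z' \<in> X" using x x' by simp
      ultimately have "(s *\<^sub>R z + t *\<^sub>R z', s * r + t * r') \<in> G" unfolding G_iff by blast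
      then show "s *\<^sub>R p + t *\<^sub>R q \<in> G" by (simp add: p q)
    qed
    show "G \<subseteq> L \<times> UNIV"
    proof
      fix p assume "p \<in> G"
      then obtain z r x a where p: "p = (z, r)" "z \<in> X" "x - z \<in> Xa" "majorant x ub a" using G_iff by (metis surj_pair)
      have "z = 1 *\<^sub>R z" by simp
      then have "z \<in> L" unfolding L_iff using p zero_less_one by blast
      then show "p \<in> L \<times> UNIV" by (simp add: p)
    qed
    show "c \<le> r" if "(0, r) \<in> G" for r
    proof -
      from that obtain x a where "x - 0 \<in> Xa" "majorant x ub a" "(\<integral>\<omega>. a \<omega> \<partial>M) \<le> r" unfolding G_iff by blast
      then show ?thesis using low[of x a] by simp
    qed
    show "(e, n) \<in> G" if e: "e \<in> L" "X.nrm k e \<le> \<epsilon>" for e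
    proof -
      obtain x where "(x, e) \<in> R" using ball(2)[OF e] by blast
      then show ?thesis using level_set_iff[OF _ ub n0, of x] LX unfolding R_iff G_iff by blast
    qed
  qed (use subL LX ball in auto)
  have dual: "l \<in> X.dual"
  proof (rule X.topological_dualI[OF l(1) zero_less_one])
    fix x assume x: "x \<in> X" "X.nrm k x \<le> 1"
    have "l x \<le> C * X.nrm k x" by (rule l(2)[OF x(1)])
    also have "\<dots> \<le> \<bar>C\<bar> * 1" using x by (intro mult_mono) auto
    finally show "l x \<le> \<bar>C\<bar>" by simp
  qed
  show thesis
  proof (rule that[OF dual])
    fix x assume x: "x \<in> Xa"
    then have xX: "x \<in> X" by (simp add: Xa_def)
    \<comment> \<open>Shifting \<open>z\<close> along \<open>Xa\<close> does not change the value,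
      so the linear functional is bounded above on the whole line through \<open>x\<close> and must
      vanish on it.\<close>
    have le: "c + s * l x \<le> (\<integral>\<omega>. a0 \<omega> \<partial>M)" for s
    proof -
      have "s *\<^sub>R x \<in> Xa" using subspace_Xa x by (rule subspace_scale)
      then have "x0 - s *\<^sub>R x \<in> Xa" using subspace_diff[OF subspace_Xa x0(1)] by blast
      then have "(s *\<^sub>R x, \<integral>\<omega>. a0 \<omega> \<partial>M) \<in> G" using x0(2) xX unfolding G_iff by blast
      from l(3)[OF this] show ?thesis by (simp add: X.dual_scale[OF dual xX])
    qed
    show "l x = 0"
    proof (rule ccontr)
      assume "l x \<noteq> 0"
      then show False using le[of "((\<integral>\<omega>. a0 \<omega> \<partial>M) - c + 1) / l x"] by simp
    qed
  next
    fix x a assume x: "majorant x ub a"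
    moreover have "x - x \<in> Xa" using subspace_0[OF subspace_Xa] by simp
    moreover have "x \<in> X" using x by (simp add: majorant_def)
    ultimately have "(x, \<integral>\<omega>. a \<omega> \<partial>M) \<in> G" unfolding G_iff by blast
    then show "c + l x \<le> (\<integral>\<omega>. a \<omega> \<partial>M)" by (rule l(3))
  qed
qed

text \<open>Pasting \<open>x'\<close> into \<open>x\<close> on sets of vanishing probability changes the countably additive terms
  arbitrarily little, whereas the singular functional takes its value at \<open>x'\<close>.\<close>

lemma singular_split_X:
  assumes v: "v \<in> V" and s: "s \<in> X.singular"
    and low: "\<And>x a. majorant x ub a \<Longrightarrow> c + pairing M x v + s x \<le> (\<integral>\<omega>. a \<omega> \<partial>M)"
    and x: "majorant x ub a" and x': "majorant x' ub a'"
  shows "c + pairing M x v + s x' \<le> (\<integral>\<omega>. a \<omega> \<partial>M)"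
proof -
  have xX: "x \<in> X" "x' \<in> X" "x' - x \<in> X" and i: "integrable M a" "integrable M a'"
    using x x' by (auto simp: majorant_def)
  note sd = X.singular_dual[OF s]
  obtain A where A: "range A \<subseteq> sets M" "decseq A" "(\<lambda>\<nu>. measure M (A \<nu>)) \<longlonglongrightarrow> 0"
    "\<And>\<nu>::nat. s (\<lambda>\<omega>. if \<omega> \<in> A \<nu> then (x' - x) \<omega> else 0) = s (x' - x)"
    using X.singular_vanishing_sets[OF s xX(3)] by blast
  \<comment> \<open>Pointwise change of all countably additive terms when \<open>x'\<close> is
    pasted in.\<close>
  define g where "g \<omega> = a' \<omega> - a \<omega> - (x' - x) \<omega> \<bullet> v \<omega>" for \<omega>
  have ip: "integrable M (\<lambda>\<omega>. (x' - x) \<omega> \<bullet> v \<omega>)" by (rule X.integrable_pairing[OF xX(3) v])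
  have g: "integrable M g" unfolding g_def[abs_def] by (intro Bochner_Integration.integrable_diff i ip)
  have le: "c + pairing M x v + s x' \<le> (\<integral>\<omega>. a \<omega> \<partial>M) + (\<integral>\<omega>. (if \<omega> \<in> A \<nu> then g \<omega> else 0) \<partial>M)" for \<nu>
  proof -
    have A\<nu>: "A \<nu> \<in> sets M" using A(1) by auto
    define d where "d \<omega> = (if \<omega> \<in> A \<nu> then (x' - x) \<omega> else 0)" for \<omega>
    have dX: "d \<in> X" unfolding d_def[abs_def] by (rule X.restrict_X[OF xX(3) A\<nu>])
    have y: "(\<lambda>\<omega>. if \<omega> \<in> A \<nu> then x' \<omega> else x \<omega>) = x + d" by (auto simp: d_def fun_eq_iff)
    have "s d = s (x' - x)" using A(4)[of \<nu>] by (simp add: d_def[abs_def])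
    then have s1: "s (x + d) = s x'"
      using X.dual_add[OF sd xX(1) dX] X.dual_diff[OF sd xX(2,1)] by simp
    have m: "majorant (x + d) ub (\<lambda>\<omega>. if \<omega> \<in> A \<nu> then a' \<omega> else a \<omega>)"
      using majorant_paste[OF x' x A\<nu>] by (simp add: y)
    have p: "pairing M (x + d) v = pairing M x v + pairing M d v" by (rule X.pairing_add[OF xX(1) dX v])
    have id: "integrable M (\<lambda>\<omega>. d \<omega> \<bullet> v \<omega>)" by (rule X.integrable_pairing[OF dX v])
    have im: "integrable M (\<lambda>\<omega>. if \<omega> \<in> A \<nu> then a' \<omega> else a \<omega>)" using m by (simp add: majorant_def)
    have "(\<integral>\<omega>. (if \<omega> \<in> A \<nu> then g \<omega> else 0) \<partial>M) = (\<integral>\<omega>. (if \<omega> \<in> A \<nu> then a' \<omega> else a \<omega>) - a \<omega> - d \<omega> \<bullet> v \<omega> \<partial>M)"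
      by (rule Bochner_Integration.integral_cong) (auto simp: g_def d_def)
    also have "\<dots> = (\<integral>\<omega>. (if \<omega> \<in> A \<nu> then a' \<omega> else a \<omega>) \<partial>M) - (\<integral>\<omega>. a \<omega> \<partial>M) - pairing M d v"
      unfolding pairing_def using im i(1) id by simp
    finally show ?thesis using low[OF m] unfolding s1 p by simp
  qed
  have "(\<lambda>\<nu>. (\<integral>\<omega>. a \<omega> \<partial>M) + (\<integral>\<omega>. (if \<omega> \<in> A \<nu> then g \<omega> else 0) \<partial>M)) \<longlonglongrightarrow> (\<integral>\<omega>. a \<omega> \<partial>M) + 0"
    by (intro tendsto_add tendsto_const X.integral_vanishing_sets[OF A(1-3) g])
  from LIMSEQ_le_const[OF this] le show ?thesis by auto
qed

text \<open>Here \<open>(x', ub)\<close> is pasted into \<open>(x, u)\<close>. The singular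
  functional acts on \<open>u - ub\<close>, which becomes zero on the pasted sets, exactly where the
  functional reads it; its contribution disappears altogether.\<close>

lemma singular_split_U:
  assumes p: "p \<in> V" and y: "y \<in> Y" and s: "s \<in> U.singular"
    and low: "\<And>x u a. majorant x u a \<Longrightarrow> c + pairing M x p + pairing M (u - ub) y + s (u - ub) \<le> (\<integral>\<omega>. a \<omega> \<partial>M)"
    and x: "majorant x u a" and x': "majorant x' ub a'"
  shows "c + pairing M x p + pairing M (u - ub) y \<le> (\<integral>\<omega>. a \<omega> \<partial>M)"
proof -
  have xX: "x \<in> X" "x' \<in> X" "x' - x \<in> X" and uU: "u \<in> U" "ub - u \<in> U" "u - ub \<in> U"
    and i: "integrable M a" "integrable M a'"
    using x x' ub by (auto simp: majorant_def)
  note sd = U.singular_dual[OF s]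
  obtain A where A: "range A \<subseteq> sets M" "decseq A" "(\<lambda>\<nu>. measure M (A \<nu>)) \<longlonglongrightarrow> 0"
    "\<And>\<nu>::nat. s (\<lambda>\<omega>. if \<omega> \<in> A \<nu> then (ub - u) \<omega> else 0) = s (ub - u)"
    using U.singular_vanishing_sets[OF s uU(2)] by blast
  define g where "g \<omega> = a' \<omega> - a \<omega> - (x' - x) \<omega> \<bullet> p \<omega> - (ub - u) \<omega> \<bullet> y \<omega>" for \<omega>
  have ip: "integrable M (\<lambda>\<omega>. (x' - x) \<omega> \<bullet> p \<omega>)" by (rule X.integrable_pairing[OF xX(3) p])
  have iy: "integrable M (\<lambda>\<omega>. (ub - u) \<omega> \<bullet> y \<omega>)" by (rule U.integrable_pairing[OF uU(2) y])
  have g: "integrable M g" unfolding g_def[abs_def] by (intro Bochner_Integration.integrable_diff i ip iy)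
  have le: "c + pairing M x p + pairing M (u - ub) y \<le> (\<integral>\<omega>. a \<omega> \<partial>M) + (\<integral>\<omega>. (if \<omega> \<in> A \<nu> then g \<omega> else 0) \<partial>M)" for \<nu>
  proof -
    have A\<nu>: "A \<nu> \<in> sets M" using A(1) by auto
    define d where "d \<omega> = (if \<omega> \<in> A \<nu> then (x' - x) \<omega> else 0)" for \<omega>
    define e where "e \<omega> = (if \<omega> \<in> A \<nu> then (ub - u) \<omega> else 0)" for \<omega>
    have dX: "d \<in> X" unfolding d_def[abs_def] by (rule X.restrict_X[OF xX(3) A\<nu>])
    have eU: "e \<in> U" unfolding e_def[abs_def] by (rule U.restrict_X[OF uU(2) A\<nu>])
    have xd: "(\<lambda>\<omega>. if \<omega> \<in> A \<nu> then x' \<omega> else x \<omega>) = x + d" by (auto simp: d_def fun_eq_iff)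
    have ue: "(\<lambda>\<omega>. if \<omega> \<in> A \<nu> then ub \<omega> else u \<omega>) = u + e" by (auto simp: e_def fun_eq_iff)
    have ue': "u + e - ub = (u - ub) + e" by simp
    have "s e = s (ub - u)" using A(4)[of \<nu>] by (simp add: e_def[abs_def])
    then have s1: "s ((u - ub) + e) = 0"
      using U.dual_add[OF sd uU(3) eU] U.dual_diff[OF sd ub uU(1)] U.dual_diff[OF sd uU(1) ub] by simp
    have m: "majorant (x + d) (u + e) (\<lambda>\<omega>. if \<omega> \<in> A \<nu> then a' \<omega> else a \<omega>)"
      using majorant_paste[OF x' x A\<nu>] by (simp add: xd ue)
    have q: "pairing M (x + d) p = pairing M x p + pairing M d p" by (rule X.pairing_add[OF xX(1) dX p])
    have r: "pairing M ((u - ub) + e) y = pairing M (u - ub) y + pairing M e y" by (rule U.pairing_add[OF uU(3) eU y])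
    have id: "integrable M (\<lambda>\<omega>. d \<omega> \<bullet> p \<omega>)" by (rule X.integrable_pairing[OF dX p])
    have ie: "integrable M (\<lambda>\<omega>. e \<omega> \<bullet> y \<omega>)" by (rule U.integrable_pairing[OF eU y])
    have im: "integrable M (\<lambda>\<omega>. if \<omega> \<in> A \<nu> then a' \<omega> else a \<omega>)" using m by (simp add: majorant_def)
    have "(\<integral>\<omega>. (if \<omega> \<in> A \<nu> then g \<omega> else 0) \<partial>M) = (\<integral>\<omega>. (if \<omega> \<in> A \<nu> then a' \<omega> else a \<omega>) - a \<omega> - d \<omega> \<bullet> p \<omega> - e \<omega> \<bullet> y \<omega> \<partial>M)"
      by (rule Bochner_Integration.integral_cong) (auto simp: g_def d_def e_def)
    also have "\<dots> = (\<integral>\<omega>. (if \<omega> \<in> A \<nu> then a' \<omega> else a \<omega>) \<partial>M) - (\<integral>\<omega>. a \<omega> \<partial>M) - pairing M d p - pairing M e y"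
      unfolding pairing_def using im i(1) id ie by simp
    finally show ?thesis using low[OF m] unfolding ue' s1 q r by simp
  qed
  have "(\<lambda>\<nu>. (\<integral>\<omega>. a \<omega> \<partial>M) + (\<integral>\<omega>. (if \<omega> \<in> A \<nu> then g \<omega> else 0) \<partial>M)) \<longlonglongrightarrow> (\<integral>\<omega>. a \<omega> \<partial>M) + 0"
    by (intro tendsto_add tendsto_const X.integral_vanishing_sets[OF A(1-3) g])
  from LIMSEQ_le_const[OF this] le show ?thesis by auto
qed

lemma E_adapted:
  assumes t: "t \<le> T" and x: "x \<in> Xa" and i: "stage i \<le> t"
  shows "AE \<omega> in M. E t x \<omega> $ i = x \<omega> $ i"
proof -
  interpret S: sigma_finite_subalgebra M "F t" by (rule sigma_finite_subalgebra[OF t])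
  obtain y where y: "y \<in> adapted F stage" "AE \<omega> in M. x \<omega> = y \<omega>" and xX: "x \<in> X" using x by (auto simp: Xa_def)
  note m = borel_measurable_vec_component[OF X.measurable_X[OF xX]] borel_measurable_vec_component[OF adapted_measurable[OF y(1)]]
  have ae: "AE \<omega> in M. x \<omega> $ i = y \<omega> $ i" using y(2) by eventually_elim simp
  have "integrable M (\<lambda>\<omega>. y \<omega> $ i)"
    using integrable_cong_AE[OF m ae] X.integrable_component[OF xX, of i] by simp
  then have "AE \<omega> in M. real_cond_exp M (F t) (\<lambda>\<omega>. y \<omega> $ i) \<omega> = y \<omega> $ i"
    by (rule S.real_cond_exp_F_meas) (rule adapted_component[OF y(1) i t])
  moreover have "AE \<omega> in M. real_cond_exp M (F t) (\<lambda>\<omega>. x \<omega> $ i) \<omega> = real_cond_exp M (F t) (\<lambda>\<omega>. y \<omega> $ i) \<omega>"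
    by (rule S.real_cond_exp_cong[OF ae m])
  ultimately show ?thesis using ae by eventually_elim simp
qed

lemma E_null_component:
  assumes t: "t \<le> T" and x: "x \<in> X" "AE \<omega> in M. x \<omega> $ i = 0"
  shows "AE \<omega> in M. E t x \<omega> $ i = 0"
proof -
  interpret S: sigma_finite_subalgebra M "F t" by (rule sigma_finite_subalgebra[OF t])
  have "AE \<omega> in M. real_cond_exp M (F t) (\<lambda>\<omega>. x \<omega> $ i) \<omega> = real_cond_exp M (F t) (\<lambda>\<omega>. 0) \<omega>"
    by (rule S.real_cond_exp_cong[OF x(2)]) (use borel_measurable_vec_component[OF X.measurable_X[OF x(1)]] in auto)
  moreover have "AE \<omega> in M. real_cond_exp M (F t) (\<lambda>\<omega>. 0) \<omega> = 0"
    by (rule S.real_cond_exp_F_meas) auto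
  ultimately show ?thesis by eventually_elim simp
qed

text \<open>The vector with the single entry \<open>\<bar>x \<omega> $ i\<bar>\<close> lies in
  \<open>X\<close> by solidity, and so does its conditional expectation. Pairing the latter with
  \<open>v\<close> gives the integrability that the exchange requires, with nothing presupposed
  about \<open>E t v\<close> belonging to \<open>V\<close>.\<close>

lemma E_component_swap:
  assumes t: "t \<le> T" and x: "x \<in> X" and v: "v \<in> V"
  shows "integrable M (\<lambda>\<omega>. E t v \<omega> $ i * x \<omega> $ i)"
    and "(\<integral>\<omega>. E t v \<omega> $ i * x \<omega> $ i \<partial>M) = (\<integral>\<omega>. v \<omega> $ i * E t x \<omega> $ i \<partial>M)"
proof -
  interpret S: sigma_finite_subalgebra M "F t" by (rule sigma_finite_subalgebra[OF t])
  have "(\<lambda>\<omega>. axis i \<bar>x \<omega> $ i\<bar>) \<in> X"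
    by (rule X.axis_X[OF x]) (use borel_measurable_vec_component[OF X.measurable_X[OF x]] in auto)
  from X.integrable_component_mult[OF cond_exp_X[OF t this] v, of i]
  have "integrable M (\<lambda>\<omega>. v \<omega> $ i * real_cond_exp M (F t) (\<lambda>\<omega>. \<bar>x \<omega> $ i\<bar>) \<omega>)"
    by (simp add: axis_def mult.commute)
  note swap = S.integrable_cond_exp_swap[OF X.integrable_component_V[OF v] X.integrable_component[OF x] this]
  show "integrable M (\<lambda>\<omega>. E t v \<omega> $ i * x \<omega> $ i)"
    and "(\<integral>\<omega>. E t v \<omega> $ i * x \<omega> $ i \<partial>M) = (\<integral>\<omega>. v \<omega> $ i * E t x \<omega> $ i \<partial>M)"
    using swap by simp_all
qed

text \<open>Backward induction over the stages: with \<open>v + s\<close> the decomposition of the current multiplier,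
  \<open>s\<close> is replaced by \<open>s \<circ> E\<^sub>t\<close>. On the coordinates of stage \<open>t\<close> this agrees with the countably
  additive functional \<open>x \<mapsto> - E[E\<^sub>t x \<cdot> v]\<close>, so the singular part retreats to the earlier stages.\<close>

lemma pure_multiplier:
  assumes l: "l \<in> X.dual" "\<And>x. x \<in> Xa \<Longrightarrow> l x = 0"
    and low: "\<And>x a. majorant x ub a \<Longrightarrow> c + l x \<le> (\<integral>\<omega>. a \<omega> \<partial>M)"
    and recourse: "\<And>t z a. t \<le> T \<Longrightarrow> majorant z ub a \<Longrightarrow>
      \<exists>zb b. majorant zb ub b \<and> (\<forall>i. stage i \<le> t \<longrightarrow> (AE \<omega> in M. zb \<omega> $ i = E t z \<omega> $ i))"
  obtains p where "p \<in> V" "\<And>x. x \<in> Xa \<Longrightarrow> pairing M x p = 0"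
    "\<And>x a. majorant x ub a \<Longrightarrow> c + pairing M x p \<le> (\<integral>\<omega>. a \<omega> \<partial>M)"
proof -
  \<comment> \<open>The last clause says that \<open>s\<close> depends only on stages before
    \<open>j\<close>: void at \<open>Suc T\<close>, and at 0 it makes \<open>s\<close> vanish on
    \<open>X\<close>.\<close>
  define Q where "Q j \<longleftrightarrow> (\<exists>v\<in>V. \<exists>s\<in>X.singular. (\<forall>x\<in>Xa. pairing M x v + s x = 0) \<and>
    (\<forall>x a. majorant x ub a \<longrightarrow> c + pairing M x v + s x \<le> (\<integral>\<omega>. a \<omega> \<partial>M)) \<and>
    (\<forall>x\<in>X. (\<forall>i. stage i < j \<longrightarrow> (AE \<omega> in M. x \<omega> $ i = 0)) \<longrightarrow> s x = 0))" for j
  have "Q j" if "j \<le> Suc T" for j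
    using that
  proof (induction rule: inc_induct)
    case base
    obtain v s where vs: "v \<in> V" "s \<in> X.singular" "\<And>x. x \<in> X \<Longrightarrow> l x = pairing M x v + s x"
      using X.dual_decompose[OF l(1)] by blast
    have "s x = 0" if x: "x \<in> X" "\<forall>i. stage i < Suc T \<longrightarrow> (AE \<omega> in M. x \<omega> $ i = 0)" for x
    proof (rule X.dual_null[OF X.singular_dual[OF vs(2)] x(1)])
      have "AE \<omega> in M. \<forall>i. x \<omega> $ i = 0" using x(2) stage_le by (simp add: AE_all_countable less_Suc_eq_le)
      then show "AE \<omega> in M. x \<omega> = 0" by eventually_elim (simp add: vec_eq_iff)
    qed
    moreover have "pairing M x v + s x = 0" if "x \<in> Xa" for x
      using l(2)[OF that] vs(3)[of x] that by (simp add: Xa_def)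
    moreover have "c + pairing M x v + s x \<le> (\<integral>\<omega>. a \<omega> \<partial>M)" if "majorant x ub a" for x a
      using low[OF that] vs(3)[of x] that by (simp add: majorant_def)
    ultimately show ?case unfolding Q_def using vs(1,2) by blast
  next
    case (step t)
    then have t: "t \<le> T" by simp
    obtain v s where v: "v \<in> V" and s: "s \<in> X.singular" and perp: "\<And>x. x \<in> Xa \<Longrightarrow> pairing M x v + s x = 0"
      and ineq: "\<And>x a. majorant x ub a \<Longrightarrow> c + pairing M x v + s x \<le> (\<integral>\<omega>. a \<omega> \<partial>M)"
      and van: "\<And>x. x \<in> X \<Longrightarrow> (\<And>i. stage i < Suc t \<Longrightarrow> AE \<omega> in M. x \<omega> $ i = 0) \<Longrightarrow> s x = 0"
      using step.IH unfolding Q_def by blast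
    note sd = X.singular_dual[OF s]
    \<comment> \<open>By the induction hypothesis the functional sees only the components up to
      stage \<open>t\<close>, modulo null sets.\<close>
    have s_cong: "s x = s y" if "x \<in> X" "y \<in> X" "\<And>i. stage i \<le> t \<Longrightarrow> AE \<omega> in M. x \<omega> $ i = y \<omega> $ i" for x y
    proof -
      have "s (x - y) = 0"
      proof (rule van)
        fix i assume "stage i < Suc t"
        then have "AE \<omega> in M. x \<omega> $ i = y \<omega> $ i" using that(3) by simp
        then show "AE \<omega> in M. (x - y) \<omega> $ i = 0" by eventually_elim simp
      qed (use that in auto)
      then show ?thesis using X.dual_diff[OF sd that(1,2)] by simp
    qed
    obtain v' s' where v': "v' \<in> V" and s': "s' \<in> X.singular"
      and dec: "\<And>x. x \<in> X \<Longrightarrow> s (E t x) = pairing M x v' + s' x"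
      using X.dual_decompose[OF dual_cond_exp[OF t sd]] by blast
    have pv: "pairing M x (v + v') = pairing M x v + pairing M x v'" if "x \<in> X" for x
      by (rule X.pairing_add_right[OF that v v'])
    have "pairing M x (v + v') + s' x = 0" if x: "x \<in> Xa" for x
    proof -
      have xX: "x \<in> X" using x by (simp add: Xa_def)
      have "s (E t x) = s x" by (rule s_cong[OF cond_exp_X[OF t xX] xX E_adapted[OF t x]])
      then show ?thesis using perp[OF x] dec[OF xX] pv[OF xX] by simp
    qed
    moreover have "c + pairing M x (v + v') + s' x \<le> (\<integral>\<omega>. a \<omega> \<partial>M)" if x: "majorant x ub a" for x a
    proof -
      have xX: "x \<in> X" using x by (simp add: majorant_def)
      \<comment> \<open>The recourse agrees with \<open>E t x\<close> up to stage \<open>t\<close>,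
        so \<open>s\<close> has the same value at both; splitting then puts \<open>s zb\<close> in
        place of \<open>s x\<close> while \<open>x\<close> stays in all other terms.\<close>
      obtain zb b where zb: "majorant zb ub b" "\<And>i. stage i \<le> t \<Longrightarrow> AE \<omega> in M. zb \<omega> $ i = E t x \<omega> $ i"
        using recourse[OF t x] by blast
      have zbX: "zb \<in> X" using zb(1) by (simp add: majorant_def)
      have "s zb = s (E t x)" by (rule s_cong[OF zbX cond_exp_X[OF t xX] zb(2)])
      moreover have "c + pairing M x v + s zb \<le> (\<integral>\<omega>. a \<omega> \<partial>M)"
        by (rule singular_split_X[OF v s ineq x zb(1)])
      ultimately show ?thesis using dec[OF xX] pv[OF xX] by simp
    qed
    moreover have "s' x = 0" if xX: "x \<in> X" and zero: "\<forall>i. stage i < t \<longrightarrow> (AE \<omega> in M. x \<omega> $ i = 0)" for x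
    proof -
      \<comment> \<open>Up to stage \<open>t\<close> only the block of that stage is left in
        \<open>E t w\<close>. Extended by zero it is an adapted process \<open>y\<close>, where
        \<open>v + s\<close> vanishes, so \<open>s\<close> is minus the integral against
        \<open>v\<close>; moving \<open>E t\<close> onto \<open>v\<close> removes it from
        \<open>w\<close>.\<close>
      have m: "s (E t w) = - (\<Sum>i\<in>{i. stage i = t}. \<integral>\<omega>. E t v \<omega> $ i * w \<omega> $ i \<partial>M)"
        if wX: "w \<in> X" and wz: "\<And>i. stage i < t \<Longrightarrow> AE \<omega> in M. w \<omega> $ i = 0" for w
      proof -
        have EX: "E t w \<in> X" by (rule cond_exp_X[OF t wX])
        define y where "y \<omega> = (\<chi> i. if stage i = t then E t w \<omega> $ i else 0)" for \<omega>
        have "(\<lambda>\<omega>. y \<omega> $ i) \<in> borel_measurable M" for i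
          by (cases "stage i = t") (simp_all add: y_def)
        then have "y \<in> borel_measurable M" by (simp add: borel_measurable_vec_iff)
        then have yX: "y \<in> X" by (rule X.solid_X[OF EX]) (simp add: y_def)
        have "(\<lambda>\<omega>. y \<omega> $ i) \<in> borel_measurable (F (stage i))" for i
          by (cases "stage i = t") (simp_all add: y_def)
        then have "y \<in> adapted F stage" by (simp add: adapted_def)
        then have "pairing M y v + s y = 0" using perp adapted_Xa[OF yX] by blast
        moreover have "s (E t w) = s y"
        proof (rule s_cong[OF EX yX])
          fix i assume i: "stage i \<le> t"
          show "AE \<omega> in M. E t w \<omega> $ i = y \<omega> $ i"
          proof (cases "stage i = t")
            case False
            then have "AE \<omega> in M. E t w \<omega> $ i = 0" using i by (intro E_null_component[OF t wX wz]) simp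
            then show ?thesis by eventually_elim (simp add: y_def False)
          qed (simp add: y_def)
        qed
        moreover have "pairing M y v = (\<Sum>i\<in>{i. stage i = t}. \<integral>\<omega>. E t v \<omega> $ i * w \<omega> $ i \<partial>M)"
        proof -
          have "pairing M y v = (\<Sum>i\<in>UNIV. \<integral>\<omega>. y \<omega> $ i * v \<omega> $ i \<partial>M)" by (rule X.pairing_sum[OF yX v])
          also have "\<dots> = (\<Sum>i\<in>UNIV. if stage i = t then (\<integral>\<omega>. E t v \<omega> $ i * w \<omega> $ i \<partial>M) else 0)"
          proof (rule sum.cong[OF refl])
            fix i show "(\<integral>\<omega>. y \<omega> $ i * v \<omega> $ i \<partial>M) = (if stage i = t then (\<integral>\<omega>. E t v \<omega> $ i * w \<omega> $ i \<partial>M) else 0)"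
              using E_component_swap(2)[OF t wX v, of i] by (simp add: y_def mult.commute)
          qed
          also have "\<dots> = (\<Sum>i\<in>{i. stage i = t}. \<integral>\<omega>. E t v \<omega> $ i * w \<omega> $ i \<partial>M)"
            by (simp add: sum.If_cases)
          finally show ?thesis .
        qed
        ultimately show ?thesis by simp
      qed
      \<comment> \<open>Density of \<open>s'\<close> on restrictions of \<open>x\<close>: the one
        found in \<open>m\<close> less that of \<open>v'\<close>. Being singular as well,
        \<open>s'\<close> keeps its value along vanishing sets, where the integral of
        \<open>g\<close> tends to zero.\<close>
      define g where "g \<omega> = - (\<Sum>i\<in>{i. stage i = t}. E t v \<omega> $ i * x \<omega> $ i) - x \<omega> \<bullet> v' \<omega>" for \<omega>
      have g: "integrable M g" unfolding g_def[abs_def]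
        by (intro Bochner_Integration.integrable_diff Bochner_Integration.integrable_minus Bochner_Integration.integrable_sum
            E_component_swap(1)[OF t xX v] X.integrable_pairing[OF xX v'])
      obtain A where A: "range A \<subseteq> sets M" "decseq A" "(\<lambda>\<nu>. measure M (A \<nu>)) \<longlonglongrightarrow> 0"
        "\<And>\<nu>::nat. s' (\<lambda>\<omega>. if \<omega> \<in> A \<nu> then x \<omega> else 0) = s' x"
        using X.singular_vanishing_sets[OF s' xX] by blast
      have "s' x = (\<integral>\<omega>. (if \<omega> \<in> A \<nu> then g \<omega> else 0) \<partial>M)" for \<nu>
      proof -
        define w where "w \<omega> = (if \<omega> \<in> A \<nu> then x \<omega> else 0)" for \<omega>
        have wX: "w \<in> X" unfolding w_def[abs_def] using X.restrict_X[OF xX] A(1) by blast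
        have "AE \<omega> in M. w \<omega> $ i = 0" if "stage i < t" for i
          using zero[rule_format, OF that] by eventually_elim (simp add: w_def)
        note mw = m[OF wX this]
        have "(\<integral>\<omega>. (if \<omega> \<in> A \<nu> then g \<omega> else 0) \<partial>M) = (\<integral>\<omega>. - (\<Sum>i\<in>{i. stage i = t}. E t v \<omega> $ i * w \<omega> $ i) - w \<omega> \<bullet> v' \<omega> \<partial>M)"
          by (rule Bochner_Integration.integral_cong) (auto simp: g_def w_def)
        also have "\<dots> = - (\<Sum>i\<in>{i. stage i = t}. \<integral>\<omega>. E t v \<omega> $ i * w \<omega> $ i \<partial>M) - pairing M w v'"
          unfolding pairing_def using E_component_swap(1)[OF t wX v] X.integrable_pairing[OF wX v']
          by (simp add: Bochner_Integration.integral_sum del: E_component)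
        also have "\<dots> = s (E t w) - pairing M w v'" using mw by simp
        also have "\<dots> = s' w" using dec[OF wX] by simp
        also have "s' w = s' x" using A(4)[of \<nu>] by (simp add: w_def[abs_def])
        finally show ?thesis by simp
      qed
      then have "(\<lambda>\<nu>::nat. s' x) \<longlonglongrightarrow> 0" using X.integral_vanishing_sets[OF A(1-3) g] by simp
      then show ?thesis by (simp add: LIMSEQ_const_iff)
    qed
    ultimately show ?case unfolding Q_def using s' subspace_add[OF X.subspace_V v v'] by blast
  qed
  then have "Q 0" by simp
  then have "\<exists>v\<in>V. \<exists>s\<in>X.singular. (\<forall>x\<in>Xa. pairing M x v + s x = 0) \<and>
    (\<forall>x a. majorant x ub a \<longrightarrow> c + pairing M x v + s x \<le> (\<integral>\<omega>. a \<omega> \<partial>M)) \<and> (\<forall>x\<in>X. s x = 0)"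
    by (simp add: Q_def)
  then obtain v s where v: "v \<in> V" "\<And>x. x \<in> Xa \<Longrightarrow> pairing M x v + s x = 0"
    "\<And>x a. majorant x ub a \<Longrightarrow> c + pairing M x v + s x \<le> (\<integral>\<omega>. a \<omega> \<partial>M)" "\<And>x. x \<in> X \<Longrightarrow> s x = 0"
    by blast
  show thesis
  proof (rule that[OF v(1)])
    show "pairing M x v = 0" if "x \<in> Xa" for x using v(2)[OF that] v(4)[of x] that by (simp add: Xa_def)
    show "c + pairing M x v \<le> (\<integral>\<omega>. a \<omega> \<partial>M)" if "majorant x ub a" for x a
      using v(3)[OF that] v(4)[of x] that by (simp add: majorant_def)
  qed
qed

text \<open>A subgradient of \<open>u \<mapsto> inf\<^sub>x Ef(x, ub + u) - \<langle>x, p\<rangle>\<close> at the origin, whose singular part is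
  then discarded.\<close>

lemma multiplier_U:
  assumes sub: "subspace (pos ((\<lambda>u. u - ub) ` (snd ` dom_Ef M f X U)))" (is "subspace ?L")
    and closed: "closedin U.seminorm_topology (pos ((\<lambda>u. u - ub) ` (snd ` dom_Ef M f X U)))"
    and p: "p \<in> V" and low: "\<And>x a. majorant x ub a \<Longrightarrow> c + pairing M x p \<le> (\<integral>\<omega>. a \<omega> \<partial>M)"
    and x0: "majorant x0 ub a0"
  obtains y where "y \<in> Y"
    "\<And>x u a. majorant x u a \<Longrightarrow> c + pairing M x p + pairing M (u - ub) y \<le> (\<integral>\<omega>. a \<omega> \<partial>M)"
proof -
  have L_iff: "d \<in> ?L \<longleftrightarrow> (\<exists>r>0. \<exists>x u a. d = r *\<^sub>R (u - ub) \<and> majorant x u a)" for d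
  proof
    assume "d \<in> ?L"
    then obtain r e where r: "0 < r" "e \<in> (\<lambda>u. u - ub) ` (snd ` dom_Ef M f X U)" "d = r *\<^sub>R e"
      unfolding pos_iff by blast
    from r(2) obtain q where q: "q \<in> dom_Ef M f X U" "e = snd q - ub" by (elim imageE) simp
    have "(fst q, snd q) \<in> dom_Ef M f X U" using q(1) by simp
    with r(1,3) q(2) show "\<exists>r>0. \<exists>x u a. d = r *\<^sub>R (u - ub) \<and> majorant x u a" unfolding dom_Ef_iff by blast
  next
    assume "\<exists>r>0. \<exists>x u a. d = r *\<^sub>R (u - ub) \<and> majorant x u a"
    then obtain r x u a where r: "0 < r" "d = r *\<^sub>R (u - ub)" "majorant x u a" by (elim exE conjE) (rule that)
    then have "(x, u) \<in> dom_Ef M f X U" using dom_Ef_iff by blast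
    then have "snd (x, u) \<in> snd ` dom_Ef M f X U" by (rule imageI)
    then have "u \<in> snd ` dom_Ef M f X U" by simp
    with r show "d \<in> ?L" unfolding pos_iff by blast
  qed
  have LU: "?L \<subseteq> U"
  proof
    fix d assume "d \<in> ?L"
    then obtain r x u a where "d = r *\<^sub>R (u - ub)" "majorant x u a" unfolding L_iff by blast
    then show "d \<in> U" using ub by (auto simp: majorant_def)
  qed
  interpret L: complete_seminorms ?L \<sigma>
    by (rule U.complete_seminorms_subset[OF sub LU]) (rule U.closedin_converges[OF closed])
  have x0X: "x0 \<in> X" and ia0: "integrable M a0" using x0 by (auto simp: majorant_def)
  \<comment> \<open>Besides the allowance 1 for a scaled second point, the pairing of
    \<open>x0\<close> with \<open>p\<close> enters, because \<open>R\<close> also has to bound the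
    linear term of the function that is minimized over \<open>x\<close>.\<close>
  define n where "n = (\<integral>\<omega>. \<bar>a0 \<omega>\<bar> \<partial>M) + \<bar>pairing M x0 p\<bar> + 1"
  have n0: "0 \<le> n" by (simp add: n_def add_nonneg_nonneg)
  define R where "R = {(x, d). x \<in> X \<and> d \<in> ?L \<and> \<bar>pairing M x p\<bar> \<le> n \<and>
    (\<integral>\<^sup>+\<omega>. e2ennreal (f \<omega> (x \<omega>, (ub + d) \<omega>)) \<partial>M) \<le> ennreal n}"
  have R_iff: "(x, d) \<in> R \<longleftrightarrow> x \<in> X \<and> d \<in> ?L \<and> \<bar>pairing M x p\<bar> \<le> n \<and>
    (\<integral>\<^sup>+\<omega>. e2ennreal (f \<omega> (x \<omega>, (ub + d) \<omega>)) \<partial>M) \<le> ennreal n" for x d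
    unfolding R_def by blast
  have comb: "s *\<^sub>R (ub + d) + t *\<^sub>R (ub + d') = ub + (s *\<^sub>R d + t *\<^sub>R d')" if "s + t = 1" for s t d d'
  proof -
    have "s *\<^sub>R (ub + d) + t *\<^sub>R (ub + d') = (s + t) *\<^sub>R ub + (s *\<^sub>R d + t *\<^sub>R d')" by (simp add: algebra_simps)
    then show ?thesis using that by simp
  qed
  have pair_comb: "pairing M (s *\<^sub>R x + t *\<^sub>R x') p = s * pairing M x p + t * pairing M x' p" if "x \<in> X" "x' \<in> X" for s t x x'
    using that p by (simp add: X.pairing_add X.pairing_scale)
  obtain k \<epsilon> where ball: "0 < \<epsilon>" "\<And>e. e \<in> ?L \<Longrightarrow> U.nrm k e \<le> \<epsilon> \<Longrightarrow> \<exists>x. (x, e) \<in> R"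
  proof (rule convex_open_mapping[OF X.complete_seminorms_axioms L.complete_seminorms_axioms, of R x0])
    show "R \<subseteq> X \<times> ?L" by (auto simp: R_def)
    show "convex R"
    proof (rule convexI)
      fix q q' and s t :: real assume q: "q \<in> R" "q' \<in> R" and st: "0 \<le> s" "0 \<le> t" "s + t = 1"
      obtain x d x' d' where qq: "q = (x, d)" "q' = (x', d')" by fastforce
      have mem: "x \<in> X" "d \<in> ?L" "x' \<in> X" "d' \<in> ?L" "\<bar>pairing M x p\<bar> \<le> n" "\<bar>pairing M x' p\<bar> \<le> n"
        and lev: "(\<integral>\<^sup>+\<omega>. e2ennreal (f \<omega> (x \<omega>, (ub + d) \<omega>)) \<partial>M) \<le> ennreal n"
          "(\<integral>\<^sup>+\<omega>. e2ennreal (f \<omega> (x' \<omega>, (ub + d') \<omega>)) \<partial>M) \<le> ennreal n" using q unfolding qq R_iff by blast+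
      have U: "ub + d \<in> U" "ub + d' \<in> U" using mem LU ub by auto
      have "(\<integral>\<^sup>+\<omega>. e2ennreal (f \<omega> ((s *\<^sub>R x + t *\<^sub>R x') \<omega>, (ub + (s *\<^sub>R d + t *\<^sub>R d')) \<omega>)) \<partial>M) \<le> ennreal n"
        using level_set_convex[OF mem(1) U(1) mem(3) U(2) n0 st lev] unfolding comb[OF st(3)] .
      moreover have "\<bar>pairing M (s *\<^sub>R x + t *\<^sub>R x') p\<bar> \<le> n"
      proof -
        have "\<bar>s * pairing M x p + t * pairing M x' p\<bar> \<le> s * \<bar>pairing M x p\<bar> + t * \<bar>pairing M x' p\<bar>"
          using st by (intro order_trans[OF abs_triangle_ineq]) (simp add: abs_mult)
        also have "\<dots> \<le> n" by (rule convex_bound_le[OF mem(5,6) st])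
        finally show ?thesis by (simp add: pair_comb mem)
      qed
      moreover have "s *\<^sub>R x + t *\<^sub>R x' \<in> X" "s *\<^sub>R d + t *\<^sub>R d' \<in> ?L" using mem by (auto intro: L.mem_add L.mem_scale)
      ultimately have "(s *\<^sub>R x + t *\<^sub>R x', s *\<^sub>R d + t *\<^sub>R d') \<in> R" by (simp only: R_iff)
      then show "s *\<^sub>R q + t *\<^sub>R q' \<in> R" by (simp add: qq)
    qed
    show "(x0, 0) \<in> R"
    proof -
      have "(\<integral>\<^sup>+\<omega>. e2ennreal (f \<omega> (x0 \<omega>, ub \<omega>)) \<partial>M) \<le> ennreal n"
        using level_set_iff[OF x0X ub n0] majorant_abs[OF x0]
        by (auto simp: n_def intro!: exI[of _ "\<lambda>\<omega>. \<bar>a0 \<omega>\<bar>"])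
      moreover have "\<bar>pairing M x0 p\<bar> \<le> n" by (simp add: n_def add_increasing)
      ultimately show ?thesis using x0X L.mem_zero by (simp add: R_def)
    qed
    show "\<exists>t>0. \<exists>x. (x, t *\<^sub>R e) \<in> R" if e: "e \<in> ?L" for e
    proof -
      obtain r x u a where d: "0 < r" "e = r *\<^sub>R (u - ub)" "majorant x u a" using e unfolding L_iff by blast
      have xX: "x \<in> X" and uU: "u \<in> U" and ia: "integrable M a" using d by (auto simp: majorant_def)
      have I: "0 \<le> (\<integral>\<omega>. \<bar>a \<omega>\<bar> \<partial>M) + \<bar>pairing M x p\<bar>" "0 \<le> (\<integral>\<omega>. \<bar>a \<omega>\<bar> \<partial>M)" "0 \<le> (\<integral>\<omega>. \<bar>a0 \<omega>\<bar> \<partial>M)" by auto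
      obtain t where t: "0 < t" "t \<le> 1" "t * ((\<integral>\<omega>. \<bar>a \<omega>\<bar> \<partial>M) + \<bar>pairing M x p\<bar>) \<le> 1"
        using small_factor[OF I(1)] by blast
      have t': "t * (\<integral>\<omega>. \<bar>a \<omega>\<bar> \<partial>M) \<le> 1" "t * \<bar>pairing M x p\<bar> \<le> 1"
      proof -
        have "0 \<le> t * (\<integral>\<omega>. \<bar>a \<omega>\<bar> \<partial>M)" "0 \<le> t * \<bar>pairing M x p\<bar>" using t(1) I(2) by auto
        with t(3) show "t * (\<integral>\<omega>. \<bar>a \<omega>\<bar> \<partial>M) \<le> 1" "t * \<bar>pairing M x p\<bar> \<le> 1" by (auto simp: distrib_left)
      qed
      let ?x = "(1 - t) *\<^sub>R x0 + t *\<^sub>R x" and ?a = "\<lambda>\<omega>. (1 - t) * \<bar>a0 \<omega>\<bar> + t * \<bar>a \<omega>\<bar>"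
      have ueq: "(1 - t) *\<^sub>R ub + t *\<^sub>R u = ub + t *\<^sub>R (u - ub)" by (simp add: algebra_simps)
      have "majorant ?x ((1 - t) *\<^sub>R ub + t *\<^sub>R u) ?a"
        using t by (intro majorant_convex majorant_abs x0 d) auto
      then have maj: "majorant ?x (ub + t *\<^sub>R (u - ub)) ?a" unfolding ueq .
      have "(\<integral>\<omega>. ?a \<omega> \<partial>M) \<le> n"
      proof -
        have "(\<integral>\<omega>. ?a \<omega> \<partial>M) = (1 - t) * (\<integral>\<omega>. \<bar>a0 \<omega>\<bar> \<partial>M) + t * (\<integral>\<omega>. \<bar>a \<omega>\<bar> \<partial>M)" using ia ia0 by simp
        also have "\<dots> \<le> 1 * (\<integral>\<omega>. \<bar>a0 \<omega>\<bar> \<partial>M) + 1" using t t' I by (intro add_mono mult_right_mono) auto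
        finally show ?thesis by (simp add: n_def)
      qed
      moreover have "\<forall>\<omega>. 0 \<le> ?a \<omega>" using t by simp
      moreover have XU: "?x \<in> X" "ub + t *\<^sub>R (u - ub) \<in> U" using maj by (auto simp only: majorant_def)
      ultimately have "(\<integral>\<^sup>+\<omega>. e2ennreal (f \<omega> (?x \<omega>, (ub + t *\<^sub>R (u - ub)) \<omega>)) \<partial>M) \<le> ennreal n"
        using maj level_set_iff[OF XU n0] by blast
      moreover have "\<bar>pairing M ?x p\<bar> \<le> n"
      proof -
        have "\<bar>pairing M ?x p\<bar> \<le> (1 - t) * \<bar>pairing M x0 p\<bar> + t * \<bar>pairing M x p\<bar>"
          unfolding pair_comb[OF x0X xX] using t by (intro order_trans[OF abs_triangle_ineq]) (simp add: abs_mult)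
        also have "\<dots> \<le> 1 * \<bar>pairing M x0 p\<bar> + 1" using t t' by (intro add_mono mult_right_mono) auto
        finally show ?thesis using I(3) unfolding n_def by linarith
      qed
      moreover have "t *\<^sub>R (u - ub) = (t / r) *\<^sub>R e" using d by simp
      moreover have "(t / r) *\<^sub>R e \<in> ?L" using e by (rule L.mem_scale)
      ultimately have "(?x, (t / r) *\<^sub>R e) \<in> R" using XU(1) by (simp only: R_iff)
      then show ?thesis using t d(1) by (intro exI[of _ "t / r"]) auto
    qed
    fix s t x d assume R: "\<And>i::nat. (s i, t i) \<in> R" and xd: "x \<in> X" "d \<in> ?L"
      and conv: "X.converges s x" "U.converges t d"
    have mem: "s i \<in> X" "t i \<in> ?L" "\<bar>pairing M (s i) p\<bar> \<le> n"
      "(\<integral>\<^sup>+\<omega>. e2ennreal (f \<omega> (s i \<omega>, (ub + t i) \<omega>)) \<partial>M) \<le> ennreal n" for i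
      using R[of i] unfolding R_iff by blast+
    have "(\<lambda>i. \<bar>pairing M (s i) p\<bar>) \<longlonglongrightarrow> \<bar>pairing M x p\<bar>"
      by (intro tendsto_rabs X.pairing_converges[OF conv(1) mem(1) xd(1) p])
    then have "\<bar>pairing M x p\<bar> \<le> n" by (rule LIMSEQ_le_const2) (use mem(3) in auto)
    moreover have "U.converges (\<lambda>i. ub + t i) (ub + d)" using conv(2) by (simp add: U.converges_def)
    then have "(\<integral>\<^sup>+\<omega>. e2ennreal (f \<omega> (x \<omega>, (ub + d) \<omega>)) \<partial>M) \<le> ennreal n"
      using mem(2) xd(2) LU ub
      by (intro level_set_closed[OF mem(1) xd(1) conv(1) _ _ _ mem(4)]) (auto simp del: plus_fun_apply)
    ultimately show "(x, d) \<in> R" using xd by (simp only: R_iff)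
  qed blast
  define G where "G = {(d, r). \<exists>x a. majorant x (ub + d) a \<and> (\<integral>\<omega>. a \<omega> \<partial>M) - pairing M x p \<le> r}"
  have G_iff: "(d, r) \<in> G \<longleftrightarrow> (\<exists>x a. majorant x (ub + d) a \<and> (\<integral>\<omega>. a \<omega> \<partial>M) - pairing M x p \<le> r)" for d r
    unfolding G_def by blast
  obtain l C where l: "linear_on_subspace U l" "\<And>x. x \<in> U \<Longrightarrow> l x \<le> C * U.nrm k x"
    "\<And>d r. (d, r) \<in> G \<Longrightarrow> c + l d \<le> r"
  proof (rule U.subgradient[of G ?L c \<epsilon> k "n + n"])
    show "convex G"
    proof (rule convexI)
      fix q q' and s t :: real assume q: "q \<in> G" "q' \<in> G" and st: "0 \<le> s" "0 \<le> t" "s + t = 1"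
      obtain d r d' r' where qq: "q = (d, r)" "q' = (d', r')" by fastforce
      obtain x a where x: "majorant x (ub + d) a" "(\<integral>\<omega>. a \<omega> \<partial>M) - pairing M x p \<le> r" using q unfolding qq G_iff by blast
      obtain x' a' where x': "majorant x' (ub + d') a'" "(\<integral>\<omega>. a' \<omega> \<partial>M) - pairing M x' p \<le> r'" using q unfolding qq G_iff by blast
      have i: "integrable M a" "integrable M a'" "x \<in> X" "x' \<in> X" using x x' by (auto simp: majorant_def)
      have "majorant (s *\<^sub>R x + t *\<^sub>R x') (ub + (s *\<^sub>R d + t *\<^sub>R d')) (\<lambda>\<omega>. s * a \<omega> + t * a' \<omega>)"
        using majorant_convex[OF x(1) x'(1) st] unfolding comb[OF st(3)] .
      moreover have "(\<integral>\<omega>. s * a \<omega> + t * a' \<omega> \<partial>M) - pairing M (s *\<^sub>R x + t *\<^sub>R x') p \<le> s * r + t * r'"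
      proof -
        have "(\<integral>\<omega>. s * a \<omega> + t * a' \<omega> \<partial>M) - pairing M (s *\<^sub>R x + t *\<^sub>R x') p
          = s * ((\<integral>\<omega>. a \<omega> \<partial>M) - pairing M x p) + t * ((\<integral>\<omega>. a' \<omega> \<partial>M) - pairing M x' p)"
          using i by (simp add: pair_comb algebra_simps)
        also have "\<dots> \<le> s * r + t * r'" using x(2) x'(2) st by (intro add_mono mult_left_mono)
        finally show ?thesis .
      qed
      ultimately have "(s *\<^sub>R d + t *\<^sub>R d', s * r + t * r') \<in> G" unfolding G_iff by blast
      then show "s *\<^sub>R q + t *\<^sub>R q' \<in> G" by (simp add: qq)
    qed
    show "G \<subseteq> ?L \<times> UNIV"
    proof
      fix q assume "q \<in> G"
      then obtain d r x a where q: "q = (d, r)" "majorant x (ub + d) a" using G_iff by (metis surj_pair)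
      have "d = 1 *\<^sub>R (ub + d - ub)" by simp
      then have "d \<in> ?L" unfolding L_iff using q zero_less_one by blast
      then show "q \<in> ?L \<times> UNIV" by (simp add: q)
    qed
    show "c \<le> r" if "(0, r) \<in> G" for r
    proof -
      from that obtain x a where "majorant x (ub + 0) a" "(\<integral>\<omega>. a \<omega> \<partial>M) - pairing M x p \<le> r" unfolding G_iff by blast
      then show ?thesis using low[of x a] by simp
    qed
    \<comment> \<open>One \<open>n\<close> bounds the integral of the majorant, the other the
      pairing that is subtracted from it.\<close>
    show "(e, n + n) \<in> G" if e: "e \<in> ?L" "U.nrm k e \<le> \<epsilon>" for e
    proof -
      obtain x where x: "(x, e) \<in> R" using ball(2)[OF e] by blast
      have mem: "x \<in> X" "ub + e \<in> U" using x LU ub unfolding R_iff by auto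
      obtain a where a: "majorant x (ub + e) a" "(\<integral>\<omega>. a \<omega> \<partial>M) \<le> n"
        using x level_set_iff[OF mem n0] unfolding R_iff by blast
      have "\<bar>pairing M x p\<bar> \<le> n" using x unfolding R_iff by blast
      then have "(\<integral>\<omega>. a \<omega> \<partial>M) - pairing M x p \<le> n + n" using a(2) by linarith
      then show ?thesis unfolding G_iff using a(1) by blast
    qed
  qed (use sub LU ball in auto)
  have dual: "l \<in> U.dual"
  proof (rule U.topological_dualI[OF l(1) zero_less_one])
    fix x assume x: "x \<in> U" "U.nrm k x \<le> 1"
    have "l x \<le> C * U.nrm k x" by (rule l(2)[OF x(1)])
    also have "\<dots> \<le> \<bar>C\<bar> * 1" using x by (intro mult_mono) auto
    finally show "l x \<le> \<bar>C\<bar>" by simp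
  qed
  obtain y s where y: "y \<in> Y" "s \<in> U.singular" "\<And>u. u \<in> U \<Longrightarrow> l u = pairing M u y + s u"
    using U.dual_decompose[OF dual] by blast
  have "c + pairing M x p + pairing M (u - ub) y + s (u - ub) \<le> (\<integral>\<omega>. a \<omega> \<partial>M)" if m: "majorant x u a" for x u a
  proof -
    have "u - ub \<in> U" using m ub by (auto simp: majorant_def)
    have "majorant x (ub + (u - ub)) a" using m by simp
    then have "(u - ub, (\<integral>\<omega>. a \<omega> \<partial>M) - pairing M x p) \<in> G" unfolding G_iff by blast
    from l(3)[OF this] y(3)[OF \<open>u - ub \<in> U\<close>] show ?thesis by simp
  qed
  from singular_split_U[OF p y(1,2) this _ x0] show thesis by (intro that[OF y(1)])
qed

text \<open>Interchange of infimum and integral: finitely many selections of a Castaing representation of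
  \<open>epi f\<close>, truncated to stay in the decomposable spaces, are pasted to approximate the conjugate.\<close>

lemma conjugate_integral_le:
  assumes p: "p \<in> V" and y: "y \<in> Y" and x0: "majorant x0 u0 a0"
    and low: "\<And>x u a. majorant x u a \<Longrightarrow> pairing M x p + pairing M u y - (\<integral>\<omega>. a \<omega> \<partial>M) \<le> K"
  shows "conj_functional M f p y \<le> ereal K"
proof -
  note [measurable] = X.measurable_V[OF p] U.measurable_V[OF y]
  obtain \<xi> \<alpha> where \<xi>: "\<And>j::nat. \<xi> j \<in> borel_measurable M" and \<alpha>[measurable]: "\<And>j. \<alpha> j \<in> borel_measurable M"
    and rep: "\<And>\<omega>. \<omega> \<in> space M \<Longrightarrow> epi (f \<omega>) \<noteq> {} \<Longrightarrow> epi (f \<omega>) = closure (range (\<lambda>j. (\<xi> j \<omega>, \<alpha> j \<omega>)))"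
    using normal_integrand_representation[OF normal] by blast
  note [measurable] = pred_epi_empty[OF normal]
  have m1 [measurable]: "(\<lambda>\<omega>. fst (\<xi> j \<omega>)) \<in> borel_measurable M" and m2 [measurable]: "(\<lambda>\<omega>. snd (\<xi> j \<omega>)) \<in> borel_measurable M" for j
    using \<xi>[of j] by (simp_all add: borel_prod[symmetric])
  define h where "h x u a \<omega> = x \<omega> \<bullet> p \<omega> + u \<omega> \<bullet> y \<omega> - a \<omega>" for x u and a :: "'w \<Rightarrow> real" and \<omega>
  have h_int: "integrable M (h x u a)" and h_le: "(\<integral>\<omega>. h x u a \<omega> \<partial>M) \<le> K" if m: "majorant x u a" for x u a
  proof -
    have i: "integrable M (\<lambda>\<omega>. x \<omega> \<bullet> p \<omega>)" "integrable M (\<lambda>\<omega>. u \<omega> \<bullet> y \<omega>)" "integrable M a"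
      using m X.integrable_pairing[OF _ p] U.integrable_pairing[OF _ y] by (auto simp: majorant_def)
    show "integrable M (h x u a)" unfolding h_def[abs_def] using i by auto
    show "(\<integral>\<omega>. h x u a \<omega> \<partial>M) \<le> K" using low[OF m] i by (simp add: h_def pairing_def)
  qed
  \<comment> \<open>On this set selection \<open>j\<close> is bounded, so cut off to it the
    selection lies in \<open>Linfty\<close> and its height is integrable. For fixed \<open>j\<close>
    these sets exhaust the scenarios with nonempty epigraph as \<open>n\<close> grows.\<close>
  define B where "B j n = {\<omega>\<in>space M. epi (f \<omega>) \<noteq> {} \<and> norm (fst (\<xi> j \<omega>)) \<le> real n \<and>
    norm (snd (\<xi> j \<omega>)) \<le> real n \<and> \<bar>\<alpha> j \<omega>\<bar> \<le> real n}" for j n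
  have B [measurable]: "B j n \<in> sets M" for j n unfolding B_def by measurable
  define h0 where "h0 = h x0 u0 a0"
  define w where "w j \<omega> = fst (\<xi> j \<omega>) \<bullet> p \<omega> + snd (\<xi> j \<omega>) \<bullet> y \<omega> - \<alpha> j \<omega>" for j \<omega>
  \<comment> \<open>Selection \<open>j\<close> is used on \<open>B j n\<close> and the given
    majorant elsewhere; \<open>prod_decode\<close> enumerates all pairs.\<close>
  define hc where "hc k \<omega> = (case prod_decode k of (j, n) \<Rightarrow> if \<omega> \<in> B j n then w j \<omega> else h0 \<omega>)" for k \<omega>
  have cand: "\<exists>x u a. majorant x u a \<and> h x u a = hc k" for k
  proof -
    obtain j n where jn: "prod_decode k = (j, n)" by fastforce
    let ?x = "\<lambda>\<omega>. if \<omega> \<in> B j n then fst (\<xi> j \<omega>) else 0" and ?u = "\<lambda>\<omega>. if \<omega> \<in> B j n then snd (\<xi> j \<omega>) else 0"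
    have x: "(\<lambda>\<omega>. if \<omega> \<in> B j n then ?x \<omega> else x0 \<omega>) \<in> X"
    proof (rule X.paste_X)
      have "?x \<in> Linfty M" by (auto simp: Linfty_def B_def intro!: exI[of _ "real n"] measurable_If_set m1 B)
      then show "?x \<in> X" using X.Linfty_subset by blast
    qed (use x0 in \<open>auto simp: majorant_def\<close>)
    have u: "(\<lambda>\<omega>. if \<omega> \<in> B j n then ?u \<omega> else u0 \<omega>) \<in> U"
    proof (rule U.paste_X)
      have "?u \<in> Linfty M" by (auto simp: Linfty_def B_def intro!: exI[of _ "real n"] measurable_If_set m2 B)
      then show "?u \<in> U" using U.Linfty_subset by blast
    qed (use x0 in \<open>auto simp: majorant_def\<close>)
    have "integrable M (\<lambda>\<omega>. if \<omega> \<in> B j n then \<alpha> j \<omega> else a0 \<omega>)"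
    proof (rule Bochner_Integration.integrable_bound)
      show "integrable M (\<lambda>\<omega>. real n + \<bar>a0 \<omega>\<bar>)" using x0 by (auto simp: majorant_def)
      show "(\<lambda>\<omega>. if \<omega> \<in> B j n then \<alpha> j \<omega> else a0 \<omega>) \<in> borel_measurable M"
        using x0 by (auto simp: majorant_def intro!: measurable_If_set \<alpha> B)
    qed (auto simp: B_def)
    moreover have "AE \<omega> in M. f \<omega> (x0 \<omega>, u0 \<omega>) \<le> ereal (a0 \<omega>)" using x0 by (simp add: majorant_def)
    then have "AE \<omega> in M. f \<omega> (if \<omega> \<in> B j n then ?x \<omega> else x0 \<omega>, if \<omega> \<in> B j n then ?u \<omega> else u0 \<omega>)
      \<le> ereal (if \<omega> \<in> B j n then \<alpha> j \<omega> else a0 \<omega>)"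
      using AE_space
    proof eventually_elim
      case (elim \<omega>)
      have "f \<omega> (\<xi> j \<omega>) \<le> ereal (\<alpha> j \<omega>)" if "\<omega> \<in> B j n"
      proof -
        have "(\<xi> j \<omega>, \<alpha> j \<omega>) \<in> closure (range (\<lambda>j. (\<xi> j \<omega>, \<alpha> j \<omega>)))" by (intro subsetD[OF closure_subset]) simp
        then have "(\<xi> j \<omega>, \<alpha> j \<omega>) \<in> epi (f \<omega>)" using rep[of \<omega>] that by (simp add: B_def)
        then show ?thesis by (simp add: epi_def)
      qed
      with elim show ?case by simp
    qed
    ultimately have "majorant (\<lambda>\<omega>. if \<omega> \<in> B j n then ?x \<omega> else x0 \<omega>) (\<lambda>\<omega>. if \<omega> \<in> B j n then ?u \<omega> else u0 \<omega>)
      (\<lambda>\<omega>. if \<omega> \<in> B j n then \<alpha> j \<omega> else a0 \<omega>)" using x u unfolding majorant_def by blast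
    moreover have "h (\<lambda>\<omega>. if \<omega> \<in> B j n then ?x \<omega> else x0 \<omega>) (\<lambda>\<omega>. if \<omega> \<in> B j n then ?u \<omega> else u0 \<omega>)
      (\<lambda>\<omega>. if \<omega> \<in> B j n then \<alpha> j \<omega> else a0 \<omega>) = hc k"
      by (auto simp: fun_eq_iff hc_def jn h_def w_def h0_def)
    ultimately show ?thesis by blast
  qed
  define H where "H k = rec_nat h0 (\<lambda>k r \<omega>. max (r \<omega>) (hc k \<omega>)) k" for k
  have H_0: "H 0 = h0" and H_Suc: "H (Suc k) \<omega> = max (H k \<omega>) (hc k \<omega>)" for k \<omega> by (simp_all add: H_def)
  have H_ex: "\<exists>x u a. majorant x u a \<and> (\<forall>\<omega>\<in>space M. h x u a \<omega> = H k \<omega>)" for k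
  proof (induction k)
    case 0
    show ?case unfolding H_0 h0_def using x0 by blast
  next
    case (Suc k)
    then obtain x u a where xua: "majorant x u a" "\<And>\<omega>. \<omega> \<in> space M \<Longrightarrow> h x u a \<omega> = H k \<omega>" by blast
    obtain x' u' a' where xua': "majorant x' u' a'" "h x' u' a' = hc k" using cand by blast
    \<comment> \<open>Pasting along this set realizes the pointwise maximum by one single
      majorant.\<close>
    define A where "A = {\<omega>\<in>space M. h x u a \<omega> \<le> h x' u' a' \<omega>}"
    have "A \<in> sets M" unfolding A_def
      by (intro borel_measurable_le borel_measurable_integrable h_int xua xua')
    from majorant_paste[OF xua'(1) xua(1) this]
    have "majorant (\<lambda>\<omega>. if \<omega> \<in> A then x' \<omega> else x \<omega>) (\<lambda>\<omega>. if \<omega> \<in> A then u' \<omega> else u \<omega>) (\<lambda>\<omega>. if \<omega> \<in> A then a' \<omega> else a \<omega>)" .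
    moreover have "h (\<lambda>\<omega>. if \<omega> \<in> A then x' \<omega> else x \<omega>) (\<lambda>\<omega>. if \<omega> \<in> A then u' \<omega> else u \<omega>) (\<lambda>\<omega>. if \<omega> \<in> A then a' \<omega> else a \<omega>) \<omega> = H (Suc k) \<omega>"
      if "\<omega> \<in> space M" for \<omega>
    proof -
      have "h (\<lambda>\<omega>. if \<omega> \<in> A then x' \<omega> else x \<omega>) (\<lambda>\<omega>. if \<omega> \<in> A then u' \<omega> else u \<omega>) (\<lambda>\<omega>. if \<omega> \<in> A then a' \<omega> else a \<omega>) \<omega>
        = (if \<omega> \<in> A then h x' u' a' \<omega> else h x u a \<omega>)" by (simp add: h_def)
      also have "\<dots> = max (h x u a \<omega>) (h x' u' a' \<omega>)" using that by (simp add: A_def)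
      finally show ?thesis using xua(2)[OF that] xua'(2) by (simp add: H_Suc)
    qed
    ultimately show ?case by blast
  qed
  have h0: "integrable M h0" unfolding h0_def by (rule h_int[OF x0])
  have H_int: "integrable M (H k)" and H_le: "(\<integral>\<omega>. H k \<omega> \<partial>M) \<le> K" for k
  proof -
    obtain x u a where xua: "majorant x u a" "\<And>\<omega>. \<omega> \<in> space M \<Longrightarrow> h x u a \<omega> = H k \<omega>" using H_ex by blast
    show "integrable M (H k)" using h_int[OF xua(1)] xua(2) by (simp cong: Bochner_Integration.integrable_cong)
    show "(\<integral>\<omega>. H k \<omega> \<partial>M) \<le> K" using h_le[OF xua(1)] xua(2) by (simp cong: Bochner_Integration.integral_cong)
  qed
  have H_mono: "H k \<omega> \<le> H l \<omega>" if "k \<le> l" for k l \<omega>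
    using that by (induction rule: dec_induct) (auto simp: H_Suc)
  have H_ge0: "h0 \<omega> \<le> H k \<omega>" for k \<omega> using H_mono[of 0 k \<omega>] by (simp add: H_0)
  define G where "G \<omega> = conjugate (f \<omega>) (p \<omega>, y \<omega>)" for \<omega>
  have G [measurable]: "G \<in> borel_measurable M"
    unfolding G_def[abs_def] by (rule measurable_conjugate[OF normal]) measurable
  \<comment> \<open>Relative to \<open>h0\<close> the running maxima are nonnegative, as monotone
    convergence in \<open>ennreal\<close> requires.\<close>
  have key: "e2ennreal (G \<omega> - ereal (h0 \<omega>)) \<le> (SUP k. ennreal (H k \<omega> - h0 \<omega>))" if \<omega>: "\<omega> \<in> space M" for \<omega>
  proof (cases "(SUP k. ennreal (H k \<omega> - h0 \<omega>))")
    case (real r)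
    have Hr: "H k \<omega> \<le> h0 \<omega> + r" for k
    proof -
      have "ennreal (H k \<omega> - h0 \<omega>) \<le> ennreal r" unfolding real(2)[symmetric] by (rule SUP_upper) simp
      then show ?thesis using real(1) by (simp add: ennreal_le_iff)
    qed
    have "G \<omega> \<le> ereal (h0 \<omega> + r)"
    proof (cases "epi (f \<omega>) = {}")
      case True
      then have "f \<omega> q = \<infinity>" for q using epi_empty_iff[of "f \<omega>"] by blast
      then show ?thesis by (simp add: G_def conjugate_def)
    next
      case False
      show ?thesis unfolding G_def conjugate_representation[OF rep[OF \<omega> False]]
      proof (rule SUP_least)
        fix j
        obtain n where n: "norm (fst (\<xi> j \<omega>)) + norm (snd (\<xi> j \<omega>)) + \<bar>\<alpha> j \<omega>\<bar> \<le> real n" using real_arch_simple by blast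
        have nn: "0 \<le> norm (fst (\<xi> j \<omega>))" "0 \<le> norm (snd (\<xi> j \<omega>))" "0 \<le> \<bar>\<alpha> j \<omega>\<bar>" by auto
        have "norm (fst (\<xi> j \<omega>)) \<le> real n" "norm (snd (\<xi> j \<omega>)) \<le> real n" "\<bar>\<alpha> j \<omega>\<bar> \<le> real n" using n nn by linarith+
        then have "\<omega> \<in> B j n" using \<omega> False by (simp add: B_def)
        then have "hc (prod_encode (j, n)) \<omega> = w j \<omega>" by (simp add: hc_def)
        then have "w j \<omega> \<le> H (Suc (prod_encode (j, n))) \<omega>" by (simp add: H_Suc)
        also have "\<dots> \<le> h0 \<omega> + r" by (rule Hr)
        finally show "ereal (\<xi> j \<omega> \<bullet> (p \<omega>, y \<omega>) - \<alpha> j \<omega>) \<le> ereal (h0 \<omega> + r)" by (simp add: w_def inner_prod_def)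
      qed
    qed
    then have "G \<omega> - ereal (h0 \<omega>) \<le> ereal r" by (cases "G \<omega>") auto
    then show ?thesis using real by (simp add: e2ennreal_le_iff)
  next
    case top
    show ?thesis unfolding top by simp
  qed
  have K: "0 \<le> K - (\<integral>\<omega>. h0 \<omega> \<partial>M)" using h_le[OF x0] by (simp add: h0_def)
  have "(\<integral>\<^sup>+\<omega>. e2ennreal (G \<omega> - ereal (h0 \<omega>)) \<partial>M) \<le> (\<integral>\<^sup>+\<omega>. (SUP k. ennreal (H k \<omega> - h0 \<omega>)) \<partial>M)"
    by (rule nn_integral_mono) (rule key)
  also have "\<dots> = (SUP k. \<integral>\<^sup>+\<omega>. ennreal (H k \<omega> - h0 \<omega>) \<partial>M)"
  proof (rule nn_integral_monotone_convergence_SUP)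
    show "incseq (\<lambda>k \<omega>. ennreal (H k \<omega> - h0 \<omega>))"
      by (auto simp: incseq_def le_fun_def intro!: ennreal_leI H_mono)
    show "(\<lambda>\<omega>. ennreal (H k \<omega> - h0 \<omega>)) \<in> borel_measurable M" for k
      using borel_measurable_integrable[OF H_int[of k]] borel_measurable_integrable[OF h0] by measurable
  qed
  also have "\<dots> \<le> ennreal (K - (\<integral>\<omega>. h0 \<omega> \<partial>M))"
  proof (rule SUP_least)
    fix k
    have "(\<integral>\<^sup>+\<omega>. ennreal (H k \<omega> - h0 \<omega>) \<partial>M) = ennreal (\<integral>\<omega>. H k \<omega> - h0 \<omega> \<partial>M)"
      by (rule nn_integral_eq_integral) (use H_int h0 H_ge0 in auto)
    also have "\<dots> \<le> ennreal (K - (\<integral>\<omega>. h0 \<omega> \<partial>M))"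
      using H_int h0 H_le by (intro ennreal_leI) simp
    finally show "(\<integral>\<^sup>+\<omega>. ennreal (H k \<omega> - h0 \<omega>) \<partial>M) \<le> ennreal (K - (\<integral>\<omega>. h0 \<omega> \<partial>M))" .
  qed
  finally have "(\<integral>\<^sup>+\<omega>. e2ennreal (G \<omega> - ereal (h0 \<omega>)) \<partial>M) \<le> ennreal (K - (\<integral>\<omega>. h0 \<omega> \<partial>M))" .
  moreover have "(\<lambda>\<omega>. G \<omega> - ereal (h0 \<omega>)) \<in> borel_measurable M"
    using borel_measurable_integrable[OF h0] by measurable
  ultimately obtain b where b: "integrable M b" "AE \<omega> in M. G \<omega> - ereal (h0 \<omega>) \<le> ereal (b \<omega>)"
    "(\<integral>\<omega>. b \<omega> \<partial>M) \<le> K - (\<integral>\<omega>. h0 \<omega> \<partial>M)"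
    using nn_integral_e2ennreal_le_iff[OF _ K] by blast
  have "AE \<omega> in M. G \<omega> \<le> ereal (h0 \<omega> + b \<omega>)"
    using b(2)
  proof eventually_elim
    case (elim \<omega>)
    then show ?case by (cases "G \<omega>") auto
  qed
  then have "ext_integral M G \<le> ereal (\<integral>\<omega>. h0 \<omega> + b \<omega> \<partial>M)"
    using h0 b(1) by (intro ext_integral_le) auto
  also have "\<dots> \<le> ereal K" using h0 b by simp
  finally show ?thesis by (simp add: conj_functional_def integral_functional_def G_def[abs_def])
qed

end

section \<open>Optimality conditions\<close>

lemma fenchel_young: "ereal (x \<bullet> v) - g x \<le> conjugate g v"
  unfolding conjugate_def by (rule SUP_upper) simp

text \<open>If either value were \<open>- \<infinity>\<close>, the Fenchel-Young inequality would
  force the other to be \<open>\<infinity>\<close>; hence upper bounds for both make both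
  finite.\<close>

lemma conjugate_finite:
  assumes "g x \<le> ereal a" "conjugate g v \<le> ereal b"
  shows "g x = ereal (real_of_ereal (g x))" "conjugate g v = ereal (real_of_ereal (conjugate g v))"
    "x \<bullet> v \<le> real_of_ereal (g x) + real_of_ereal (conjugate g v)"
    "real_of_ereal (g x) \<le> a" "real_of_ereal (conjugate g v) \<le> b"
  using fenchel_young[of x v g] assms by (cases "g x"; cases "conjugate g v"; simp)+

text \<open>Subgradients are the equality case of the Fenchel-Young inequality; one inequality
  suffices, as the opposite one always holds.\<close>

lemma subdifferential_iff:
  assumes "g x = ereal \<alpha>" "conjugate g v = ereal \<beta>"
  shows "v \<in> subdifferential g x \<longleftrightarrow> \<alpha> + \<beta> \<le> x \<bullet> v"
proof
  assume v: "v \<in> subdifferential g x"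
  have "conjugate g v \<le> ereal (x \<bullet> v - \<alpha>)"
    unfolding conjugate_def
  proof (rule SUP_least)
    fix z
    have "ereal (\<alpha> + (z - x) \<bullet> v) \<le> g z" using v assms(1) by (simp add: subdifferential_def)
    then show "ereal (z \<bullet> v) - g z \<le> ereal (x \<bullet> v - \<alpha>)" by (cases "g z") (auto simp: inner_diff_left)
  qed
  then show "\<alpha> + \<beta> \<le> x \<bullet> v" using assms(2) by simp
next
  assume le: "\<alpha> + \<beta> \<le> x \<bullet> v"
  show "v \<in> subdifferential g x"
    unfolding subdifferential_def
  proof (intro CollectI allI)
    fix z
    have "ereal (z \<bullet> v) - g z \<le> ereal \<beta>" using fenchel_young[of z v g] assms(2) by simp
    then show "g x + ereal ((z - x) \<bullet> v) \<le> g z"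
      using assms(1) le by (cases "g z") (auto simp: inner_diff_left)
  qed
qed

context stochastic_program
begin

text \<open>The process \<open>x\<close> need not lie in \<open>X\<close>, so the pairing with
  \<open>p\<close> is not known to exist. The Fenchel-Young inequality bounds
  \<open>x \<bullet> p\<close> above by an integrable function, which is what
  \<open>adapted_perp_integral\<close> asks for; then all terms are integrable.\<close>

lemma primal_dual_integrals:
  assumes x: "x \<in> adapted F stage" "integral_functional M f x ub < \<infinity>"
    and py: "p \<in> adapted_perp M F stage X V" "y \<in> Y" "conj_functional M f p y < \<infinity>"
  obtains \<alpha> \<beta> where "integrable M \<alpha>" "integrable M \<beta>"
    "AE \<omega> in M. f \<omega> (x \<omega>, ub \<omega>) = ereal (\<alpha> \<omega>)" "AE \<omega> in M. conjugate (f \<omega>) (p \<omega>, y \<omega>) = ereal (\<beta> \<omega>)"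
    "integral_functional M f x ub = ereal (\<integral>\<omega>. \<alpha> \<omega> \<partial>M)" "conj_functional M f p y = ereal (\<integral>\<omega>. \<beta> \<omega> \<partial>M)"
    "AE \<omega> in M. x \<omega> \<bullet> p \<omega> + ub \<omega> \<bullet> y \<omega> \<le> \<alpha> \<omega> + \<beta> \<omega>"
    "integrable M (\<lambda>\<omega>. x \<omega> \<bullet> p \<omega> + ub \<omega> \<bullet> y \<omega>)"
    "(\<integral>\<omega>. x \<omega> \<bullet> p \<omega> + ub \<omega> \<bullet> y \<omega> \<partial>M) = pairing M ub y"
proof -
  have pV: "p \<in> V" using py(1) by (simp add: adapted_perp_def)
  note xm [measurable] = adapted_measurable[OF x(1)]
  note [measurable] = X.measurable_V[OF pV] U.measurable_V[OF py(2)] U.measurable_X[OF ub]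
  have fm [measurable]: "(\<lambda>\<omega>. f \<omega> (x \<omega>, ub \<omega>)) \<in> borel_measurable M"
    by (rule measurable_f[OF xm U.measurable_X[OF ub]])
  have cm [measurable]: "(\<lambda>\<omega>. conjugate (f \<omega>) (p \<omega>, y \<omega>)) \<in> borel_measurable M"
    by (rule measurable_conjugate[OF normal]) measurable
  obtain a where a: "integrable M a" "AE \<omega> in M. f \<omega> (x \<omega>, ub \<omega>) \<le> ereal (a \<omega>)"
    using x(2) ext_integral_less_infty_iff[OF fm] unfolding integral_functional_def by blast
  obtain b where b: "integrable M b" "AE \<omega> in M. conjugate (f \<omega>) (p \<omega>, y \<omega>) \<le> ereal (b \<omega>)"
    using py(3) ext_integral_less_infty_iff[OF cm] unfolding conj_functional_def integral_functional_def by blast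
  define \<alpha> where "\<alpha> \<omega> = real_of_ereal (f \<omega> (x \<omega>, ub \<omega>))" for \<omega>
  define \<beta> where "\<beta> \<omega> = real_of_ereal (conjugate (f \<omega>) (p \<omega>, y \<omega>))" for \<omega>
  have \<alpha>m: "\<alpha> \<in> borel_measurable M" and \<beta>m: "\<beta> \<in> borel_measurable M"
    unfolding \<alpha>_def[abs_def] \<beta>_def[abs_def] by measurable
  have all: "AE \<omega> in M. f \<omega> (x \<omega>, ub \<omega>) = ereal (\<alpha> \<omega>) \<and> conjugate (f \<omega>) (p \<omega>, y \<omega>) = ereal (\<beta> \<omega>) \<and>
    x \<omega> \<bullet> p \<omega> + ub \<omega> \<bullet> y \<omega> \<le> \<alpha> \<omega> + \<beta> \<omega> \<and> \<alpha> \<omega> \<le> a \<omega> \<and> \<beta> \<omega> \<le> b \<omega>"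
    using a(2) b(2)
  proof eventually_elim
    case (elim \<omega>)
    from conjugate_finite[OF elim] show ?case by (simp add: \<alpha>_def \<beta>_def inner_prod_def)
  qed
  have iy: "integrable M (\<lambda>\<omega>. ub \<omega> \<bullet> y \<omega>)" by (rule U.integrable_pairing[OF ub py(2)])
  have bound: "integrable M (\<lambda>\<omega>. \<bar>a \<omega>\<bar> + \<bar>b \<omega>\<bar> + \<bar>ub \<omega> \<bullet> y \<omega>\<bar>)" using a b iy by auto
  have xp: "integrable M (\<lambda>\<omega>. x \<omega> \<bullet> p \<omega>)" "(\<integral>\<omega>. x \<omega> \<bullet> p \<omega> \<partial>M) = 0"
  proof -
    have "AE \<omega> in M. x \<omega> \<bullet> p \<omega> \<le> \<bar>a \<omega>\<bar> + \<bar>b \<omega>\<bar> + \<bar>ub \<omega> \<bullet> y \<omega>\<bar>" using all by eventually_elim auto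
    from adapted_perp_integral[OF py(1) x(1) bound this]
    show "integrable M (\<lambda>\<omega>. x \<omega> \<bullet> p \<omega>)" "(\<integral>\<omega>. x \<omega> \<bullet> p \<omega> \<partial>M) = 0" by auto
  qed
  \<comment> \<open>The Fenchel-Young inequality and the majorant of \<open>\<beta>\<close> bound
    \<open>\<alpha>\<close> from below, and likewise with the roles exchanged.\<close>
  have bound': "integrable M (\<lambda>\<omega>. \<bar>a \<omega>\<bar> + \<bar>b \<omega>\<bar> + \<bar>ub \<omega> \<bullet> y \<omega>\<bar> + \<bar>x \<omega> \<bullet> p \<omega>\<bar>)" using bound xp by auto
  have i: "integrable M \<alpha>" "integrable M \<beta>"
    by (rule Bochner_Integration.integrable_bound[OF bound'], fact,
        use all in eventually_elim, auto simp: abs_le_iff)+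
  show thesis
  proof (rule that[OF i])
    show f_eq: "AE \<omega> in M. f \<omega> (x \<omega>, ub \<omega>) = ereal (\<alpha> \<omega>)" and c_eq: "AE \<omega> in M. conjugate (f \<omega>) (p \<omega>, y \<omega>) = ereal (\<beta> \<omega>)"
      and "AE \<omega> in M. x \<omega> \<bullet> p \<omega> + ub \<omega> \<bullet> y \<omega> \<le> \<alpha> \<omega> + \<beta> \<omega>"
      using all by (auto elim: eventually_mono)
    show "integral_functional M f x ub = ereal (\<integral>\<omega>. \<alpha> \<omega> \<partial>M)"
      unfolding integral_functional_def ext_integral_cong_AE[OF f_eq] by (rule ext_integral_ereal[OF i(1)])
    show "conj_functional M f p y = ereal (\<integral>\<omega>. \<beta> \<omega> \<partial>M)"
      unfolding conj_functional_def integral_functional_def ext_integral_cong_AE[OF c_eq] by (rule ext_integral_ereal[OF i(2)])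
    show "integrable M (\<lambda>\<omega>. x \<omega> \<bullet> p \<omega> + ub \<omega> \<bullet> y \<omega>)" using xp iy by auto
    show "(\<integral>\<omega>. x \<omega> \<bullet> p \<omega> + ub \<omega> \<bullet> y \<omega> \<partial>M) = pairing M ub y" using xp iy by (simp add: pairing_def)
  qed
qed

lemma weak_duality:
  assumes "x \<in> adapted F stage" "p \<in> adapted_perp M F stage X V" "y \<in> Y"
  shows "dual_objective M f ub p y \<le> integral_functional M f x ub"
proof (cases "integral_functional M f x ub < \<infinity> \<and> conj_functional M f p y < \<infinity>")
  case True
  obtain \<alpha> \<beta> where *: "integrable M \<alpha>" "integrable M \<beta>"
    "integral_functional M f x ub = ereal (\<integral>\<omega>. \<alpha> \<omega> \<partial>M)" "conj_functional M f p y = ereal (\<integral>\<omega>. \<beta> \<omega> \<partial>M)"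
    "AE \<omega> in M. x \<omega> \<bullet> p \<omega> + ub \<omega> \<bullet> y \<omega> \<le> \<alpha> \<omega> + \<beta> \<omega>"
    "integrable M (\<lambda>\<omega>. x \<omega> \<bullet> p \<omega> + ub \<omega> \<bullet> y \<omega>)"
    "(\<integral>\<omega>. x \<omega> \<bullet> p \<omega> + ub \<omega> \<bullet> y \<omega> \<partial>M) = pairing M ub y"
    by (rule primal_dual_integrals[OF assms(1) conjunct1[OF True] assms(2,3) conjunct2[OF True]])
  have "pairing M ub y \<le> (\<integral>\<omega>. \<alpha> \<omega> + \<beta> \<omega> \<partial>M)"
    unfolding *(7)[symmetric] using * by (intro integral_mono_AE) auto
  then show ?thesis using * by (simp add: dual_objective_def)
qed (auto simp: dual_objective_def)

lemma sup_D_le_inf_SP: "sup_D M F stage X V Y f ub \<le> inf_SP M F stage f ub"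
  unfolding sup_D_def inf_SP_def using weak_duality by (auto intro!: SUP_least INF_greatest)

lemma inf_SP_le_inf_SPX: "inf_SP M F stage f ub \<le> inf_SPX M F stage X f ub"
  unfolding inf_SP_def inf_SPX_def by (rule INF_superset_mono) auto

lemma dual_objective_le_sup_D:
  "p \<in> adapted_perp M F stage X V \<Longrightarrow> y \<in> Y \<Longrightarrow> dual_objective M f ub p y \<le> sup_D M F stage X V Y f ub"
  unfolding sup_D_def by (rule SUP_upper2[of "(p, y)"]) auto

text \<open>The finite value \<open>c\<close> is carried unchanged through all multiplier steps. The
  last inequality bounds \<open>pairing M x p + pairing M u y\<close> minus the integral of a
  majorant, uniformly over all majorants, and therefore the integral of the conjugate.\<close>

lemma dual_attainment:
  assumes pos_phi: "subspace (pos ((\<lambda>c. c - (0, ub)) ` dom_value_function M F stage X U f))"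
      "closedin (prod_topology X.seminorm_topology U.seminorm_topology)
        (pos ((\<lambda>c. c - (0, ub)) ` dom_value_function M F stage X U f))"
    and pos_dom: "subspace (pos ((\<lambda>u. u - ub) ` (snd ` dom_Ef M f X U)))"
      "closedin U.seminorm_topology (pos ((\<lambda>u. u - ub) ` (snd ` dom_Ef M f X U)))"
    and recourse: "\<And>t z. t \<le> T \<Longrightarrow> z \<in> X \<Longrightarrow> (z, ub) \<in> dom_Ef M f X U \<Longrightarrow>
      \<exists>zb\<in>X. (zb, ub) \<in> dom_Ef M f X U \<and> (\<forall>i. stage i \<le> t \<longrightarrow> (AE \<omega> in M. zb \<omega> $ i = E t z \<omega> $ i))"
  obtains p y where "p \<in> adapted_perp M F stage X V" "y \<in> Y"
    "inf_SPX M F stage X f ub \<le> dual_objective M f ub p y"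
proof (cases "inf_SPX M F stage X f ub = - \<infinity>")
  \<comment> \<open>Every dual point satisfies the inequality; zero is available in both
    spaces.\<close>
  case True
  have "0 \<in> adapted_perp M F stage X V" using subspace_perp by (rule subspace_0)
  moreover have "0 \<in> Y" using U.subspace_V by (rule subspace_0)
  ultimately show thesis using True that by auto
next
  case False
  \<comment> \<open>A linear cone contains zero, so \<open>(0, ub)\<close> belongs to the domain;
    this supplies the feasible point that the later constructions start from.\<close>
  have "0 \<in> pos ((\<lambda>c. c - (0, ub)) ` dom_value_function M F stage X U f)" using pos_phi(1) by (rule subspace_0)
  then obtain r q where q: "0 < r" "0 = r *\<^sub>R (q - (0, ub))" "q \<in> dom_value_function M F stage X U f"
    unfolding pos_iff by blast
  then have "q = (0, ub)" by simp
  then obtain x0 a0 where x0: "x0 - 0 \<in> Xa" "majorant x0 ub a0" using q(3) dom_value_function_iff by blast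
  have le_maj: "inf_SPX M F stage X f ub \<le> ereal (\<integral>\<omega>. a \<omega> \<partial>M)" if m: "majorant x ub a" and x: "x \<in> Xa" for x a
  proof -
    obtain z where z: "z \<in> adapted F stage" "AE \<omega> in M. x \<omega> = z \<omega>" using x by (auto simp: Xa_def)
    have "majorant z ub a"
      by (rule majorant_cong_AE[OF m adapted_measurable[OF z(1)]]) (use z(2) in \<open>auto elim: eventually_mono\<close>)
    then have zX: "z \<in> X" and "integrable M a" "AE \<omega> in M. f \<omega> (z \<omega>, ub \<omega>) \<le> ereal (a \<omega>)" by (auto simp: majorant_def)
    then have "integral_functional M f z ub \<le> ereal (\<integral>\<omega>. a \<omega> \<partial>M)"
      unfolding integral_functional_def by (intro ext_integral_le)
    then show ?thesis unfolding inf_SPX_def using z(1) zX by (intro INF_lower2[of z]) auto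
  qed
  have "inf_SPX M F stage X f ub \<le> ereal (\<integral>\<omega>. a0 \<omega> \<partial>M)" using le_maj[OF x0(2)] x0(1) by simp
  with False obtain c where c: "inf_SPX M F stage X f ub = ereal c" by (cases "inf_SPX M F stage X f ub") auto
  obtain l where l: "l \<in> X.dual" "\<And>x. x \<in> Xa \<Longrightarrow> l x = 0" "\<And>x a. majorant x ub a \<Longrightarrow> c + l x \<le> (\<integral>\<omega>. a \<omega> \<partial>M)"
  proof (rule multiplier_X[OF pos_phi, of c])
    show "c \<le> (\<integral>\<omega>. a \<omega> \<partial>M)" if "majorant x ub a" "x \<in> Xa" for x a
      using le_maj[OF that] c by simp
  qed blast
  have recourse': "\<exists>zb b. majorant zb ub b \<and> (\<forall>i. stage i \<le> t \<longrightarrow> (AE \<omega> in M. zb \<omega> $ i = E t z \<omega> $ i))"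
    if "t \<le> T" "majorant z ub a" for t z a
  proof -
    have "z \<in> X" "(z, ub) \<in> dom_Ef M f X U" using that(2) dom_Ef_iff by (auto simp: majorant_def)
    from recourse[OF that(1) this] show ?thesis using dom_Ef_iff by blast
  qed
  obtain p where p: "p \<in> V" "\<And>x. x \<in> Xa \<Longrightarrow> pairing M x p = 0"
    "\<And>x a. majorant x ub a \<Longrightarrow> c + pairing M x p \<le> (\<integral>\<omega>. a \<omega> \<partial>M)"
    by (rule pure_multiplier[OF l recourse']) blast+
  obtain y where y: "y \<in> Y"
    "\<And>x u a. majorant x u a \<Longrightarrow> c + pairing M x p + pairing M (u - ub) y \<le> (\<integral>\<omega>. a \<omega> \<partial>M)"
    by (rule multiplier_U[OF pos_dom p(1,3) x0(2)]) blast+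
  have "conj_functional M f p y \<le> ereal (pairing M ub y - c)"
  proof (rule conjugate_integral_le[OF p(1) y(1) x0(2)])
    fix x u a assume m: "majorant x u a"
    then have "u \<in> U" by (simp add: majorant_def)
    with y(2)[OF m] show "pairing M x p + pairing M u y - (\<integral>\<omega>. a \<omega> \<partial>M) \<le> pairing M ub y - c"
      using U.pairing_diff[OF _ ub y(1), of u] by simp
  qed
  then have "ereal c \<le> dual_objective M f ub p y"
    unfolding dual_objective_def by (cases "conj_functional M f p y") auto
  moreover have "p \<in> adapted_perp M F stage X V"
    using p(1,2) adapted_Xa by (auto simp: adapted_perp_def)
  ultimately show thesis using that y(1) c by simp
qed

text \<open>The Fenchel-Young gap is nonnegative, and equality of primal and dual values makes its
  integral at most zero; hence it vanishes almost surely, which is the subgradient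
  condition.\<close>

lemma optimality_conditions:
  assumes opt: "p \<in> adapted_perp M F stage X V" "y \<in> Y" "inf_SP M F stage f ub \<le> dual_objective M f ub p y"
    and x: "primal_feasible M F stage f ub x"
    and sol: "integral_functional M f x ub = inf_SP M F stage f ub" "inf_SP M F stage f ub \<noteq> - \<infinity>"
  shows "dual_feasible M F stage X V Y f p y"
    and "AE \<omega> in M. (p \<omega>, y \<omega>) \<in> subdifferential (f \<omega>) (x \<omega>, ub \<omega>)"
proof -
  have xa: "x \<in> adapted F stage" "integral_functional M f x ub < \<infinity>" using x by (auto simp: primal_feasible_def)
  \<comment> \<open>An infinite conjugate integral would push the dual objective down to
    \<open>- \<infinity>\<close>, below the optimum value.\<close>
  have "conj_functional M f p y < \<infinity>"
    using opt(3) sol(2) by (cases "conj_functional M f p y") (auto simp: dual_objective_def)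
  then show "dual_feasible M F stage X V Y f p y" using opt by (simp add: dual_feasible_def)
  obtain \<alpha> \<beta> where *: "integrable M \<alpha>" "integrable M \<beta>"
    "AE \<omega> in M. f \<omega> (x \<omega>, ub \<omega>) = ereal (\<alpha> \<omega>)" "AE \<omega> in M. conjugate (f \<omega>) (p \<omega>, y \<omega>) = ereal (\<beta> \<omega>)"
    "integral_functional M f x ub = ereal (\<integral>\<omega>. \<alpha> \<omega> \<partial>M)" "conj_functional M f p y = ereal (\<integral>\<omega>. \<beta> \<omega> \<partial>M)"
    "AE \<omega> in M. x \<omega> \<bullet> p \<omega> + ub \<omega> \<bullet> y \<omega> \<le> \<alpha> \<omega> + \<beta> \<omega>"
    "integrable M (\<lambda>\<omega>. x \<omega> \<bullet> p \<omega> + ub \<omega> \<bullet> y \<omega>)"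
    "(\<integral>\<omega>. x \<omega> \<bullet> p \<omega> + ub \<omega> \<bullet> y \<omega> \<partial>M) = pairing M ub y"
    by (rule primal_dual_integrals[OF xa opt(1,2) \<open>conj_functional M f p y < \<infinity>\<close>])
  let ?g = "\<lambda>\<omega>. \<alpha> \<omega> + \<beta> \<omega> - (x \<omega> \<bullet> p \<omega> + ub \<omega> \<bullet> y \<omega>)"
  have g_int: "integrable M ?g"
    by (intro Bochner_Integration.integrable_diff Bochner_Integration.integrable_add *(1,2,8))
  have g_pos: "AE \<omega> in M. 0 \<le> ?g \<omega>" using *(7) by eventually_elim simp
  have "(\<integral>\<omega>. ?g \<omega> \<partial>M) = (\<integral>\<omega>. \<alpha> \<omega> \<partial>M) + (\<integral>\<omega>. \<beta> \<omega> \<partial>M) - pairing M ub y"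
    unfolding *(9)[symmetric]
    by (simp only: Bochner_Integration.integral_diff[OF Bochner_Integration.integrable_add[OF *(1,2)] *(8)]
        Bochner_Integration.integral_add[OF *(1,2)])
  also have "\<dots> \<le> 0"
    using opt(3) unfolding sol(1)[symmetric] dual_objective_def *(5,6) by simp
  finally have "(\<integral>\<omega>. ?g \<omega> \<partial>M) = 0" using integral_nonneg_AE[OF g_pos] by linarith
  then have "AE \<omega> in M. ?g \<omega> = 0" using integral_nonneg_eq_0_iff_AE[OF g_int g_pos] by blast
  with *(3,4) show "AE \<omega> in M. (p \<omega>, y \<omega>) \<in> subdifferential (f \<omega>) (x \<omega>, ub \<omega>)"
  proof eventually_elim
    case (elim \<omega>)
    then show ?case by (simp add: subdifferential_iff[OF elim(1,2)] inner_prod_def)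
  qed
qed

text \<open>The subgradient condition closes the Fenchel-Young gap pointwise; integration puts the
  primal value of \<open>x\<close> below a dual value, and weak duality turns this into optimality.
  Finiteness comes from \<open>primal_dual_integrals\<close>.\<close>

lemma optimality_sufficient:
  assumes x: "primal_feasible M F stage f ub x" and py: "dual_feasible M F stage X V Y f p y"
    and sub: "AE \<omega> in M. (p \<omega>, y \<omega>) \<in> subdifferential (f \<omega>) (x \<omega>, ub \<omega>)"
  shows "solves_SP M F stage f ub x \<and> inf_SP M F stage f ub \<noteq> - \<infinity>"
proof -
  have xa: "x \<in> adapted F stage" "integral_functional M f x ub < \<infinity>" using x by (auto simp: primal_feasible_def)
  have p: "p \<in> adapted_perp M F stage X V" "y \<in> Y" "conj_functional M f p y < \<infinity>" using py by (auto simp: dual_feasible_def)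
  obtain \<alpha> \<beta> where *: "integrable M \<alpha>" "integrable M \<beta>"
    "AE \<omega> in M. f \<omega> (x \<omega>, ub \<omega>) = ereal (\<alpha> \<omega>)" "AE \<omega> in M. conjugate (f \<omega>) (p \<omega>, y \<omega>) = ereal (\<beta> \<omega>)"
    "integral_functional M f x ub = ereal (\<integral>\<omega>. \<alpha> \<omega> \<partial>M)" "conj_functional M f p y = ereal (\<integral>\<omega>. \<beta> \<omega> \<partial>M)"
    "AE \<omega> in M. x \<omega> \<bullet> p \<omega> + ub \<omega> \<bullet> y \<omega> \<le> \<alpha> \<omega> + \<beta> \<omega>"
    "integrable M (\<lambda>\<omega>. x \<omega> \<bullet> p \<omega> + ub \<omega> \<bullet> y \<omega>)"
    "(\<integral>\<omega>. x \<omega> \<bullet> p \<omega> + ub \<omega> \<bullet> y \<omega> \<partial>M) = pairing M ub y"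
    by (rule primal_dual_integrals[OF xa p])
  have "AE \<omega> in M. \<alpha> \<omega> + \<beta> \<omega> \<le> x \<omega> \<bullet> p \<omega> + ub \<omega> \<bullet> y \<omega>"
    using *(3,4) sub
  proof eventually_elim
    case (elim \<omega>)
    then show ?case using subdifferential_iff[OF elim(1,2)] by (simp add: inner_prod_def)
  qed
  then have "(\<integral>\<omega>. \<alpha> \<omega> + \<beta> \<omega> \<partial>M) \<le> pairing M ub y"
    unfolding *(9)[symmetric] by (intro integral_mono_AE Bochner_Integration.integrable_add *(1,2,8))
  then have "integral_functional M f x ub \<le> dual_objective M f ub p y"
    using * by (simp add: dual_objective_def)
  also have "\<dots> \<le> inf_SP M F stage f ub"
    using dual_objective_le_sup_D[OF p(1,2)] sup_D_le_inf_SP by (rule order_trans)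
  finally have le: "integral_functional M f x ub \<le> inf_SP M F stage f ub" .
  moreover have "inf_SP M F stage f ub \<le> integral_functional M f x ub"
    unfolding inf_SP_def using xa(1) by (rule INF_lower)
  ultimately show ?thesis using xa(1) *(5) by (auto simp: solves_SP_def)
qed

end

section \<open>From the topologies in the hypotheses to seminorms\<close>

lemma frechet_seminorms:
  fixes X :: "('a \<Rightarrow> 'b::euclidean_space) set"
  assumes "frechet M X TX" "subspace X"
  obtains \<rho> where "complete_seminorms X \<rho>" "TX = complete_seminorms.seminorm_topology X \<rho>"
    "\<And>x. x \<in> X \<Longrightarrow> (\<forall>k. \<rho> k x = 0) \<longleftrightarrow> (AE \<omega> in M. x \<omega> = 0)"
proof -
  obtain \<rho> :: "nat \<Rightarrow> ('a \<Rightarrow> 'b) \<Rightarrow> real" where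
    \<rho>: "\<forall>k. seminorm_on X (\<rho> k)" "\<forall>x\<in>X. (\<forall>k. \<rho> k x = 0) \<longleftrightarrow> (AE \<omega> in M. x \<omega> = 0)"
    "TX = topology_generated_by {{x'\<in>X. \<rho> k (x' - x) < \<epsilon>} | k x \<epsilon>. x \<in> X \<and> 0 < \<epsilon>}"
    "\<forall>s::nat \<Rightarrow> 'a \<Rightarrow> 'b. range s \<subseteq> X \<and> (\<forall>k. \<forall>\<epsilon>>0. \<exists>n0. \<forall>i\<ge>n0. \<forall>j\<ge>n0. \<rho> k (s i - s j) < \<epsilon>) \<longrightarrow>
      (\<exists>x\<in>X. \<forall>k. (\<lambda>i. \<rho> k (s i - x)) \<longlonglongrightarrow> 0)"
    using assms(1)[unfolded frechet_def] by (elim exE conjE) (rule that)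
  have cs: "complete_seminorms X \<rho>"
  proof
    show "subspace X" by (rule assms(2))
    show "seminorm_on X (\<rho> k)" for k using \<rho>(1) by (rule spec)
    fix s :: "nat \<Rightarrow> 'a \<Rightarrow> 'b"
    assume "range s \<subseteq> X" "\<And>k e. 0 < e \<Longrightarrow> \<exists>n0. \<forall>i\<ge>n0. \<forall>j\<ge>n0. \<rho> k (s i - s j) < e"
    then show "\<exists>x\<in>X. \<forall>k. (\<lambda>i. \<rho> k (s i - x)) \<longlonglongrightarrow> 0"
      by (intro \<rho>(4)[rule_format] conjI allI impI)
  qed
  have "TX = complete_seminorms.seminorm_topology X \<rho>"
    unfolding complete_seminorms.seminorm_topology_def[OF cs] by (rule \<rho>(3))
  then show thesis by (rule that[OF cs]) (rule \<rho>(2)[rule_format])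
qed

lemma random_frechet_spaceI:
  assumes "prob_space M" "random_variable_space M X" "random_variable_space M V"
    "separating_duality M X V" "strong_topology M X V TX"
  obtains \<rho> where "random_frechet_space M X \<rho> V" "TX = complete_seminorms.seminorm_topology X \<rho>"
proof -
  have "frechet M X TX" "subspace X" "dual_is_direct_sum M X V TX"
    using assms by (auto simp: strong_topology_def random_variable_space_def)
  then obtain \<rho> where \<rho>: "complete_seminorms X \<rho>" "TX = complete_seminorms.seminorm_topology X \<rho>"
    "\<And>x. x \<in> X \<Longrightarrow> (\<forall>k. \<rho> k x = 0) \<longleftrightarrow> (AE \<omega> in M. x \<omega> = 0)"
    using frechet_seminorms by blast
  have "random_frechet_space M X \<rho> V"
    unfolding random_frechet_space_def random_frechet_space_axioms_def
    using assms \<rho> \<open>dual_is_direct_sum M X V TX\<close> by simp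
  then show thesis using \<rho>(2) by (rule that)
qed

text \<open>If a feasible \<open>x\<close> has \<open>Ef(x, ub) = - \<infinity>\<close>, it is a
  minimizer, but weak duality leaves no dual feasible point. A characterization by subgradients can
  therefore hold only for optimum values above \<open>- \<infinity>\<close>, which is why
  \<open>solves_SP\<close> comes together with the exclusion of that value.\<close>

theorem theorem27:
  fixes M :: "'w measure" and T :: nat and F :: "nat \<Rightarrow> 'w measure"
    and stage :: "'n::finite \<Rightarrow> nat"
    and X V :: "('w \<Rightarrow> real ^ 'n) set" and U Y :: "('w \<Rightarrow> real ^ 'm::finite) set"
    and TX :: "('w \<Rightarrow> real ^ 'n) topology" and TU :: "('w \<Rightarrow> real ^ 'm) topology"
    and f :: "'w \<Rightarrow> (real ^ 'n) \<times> (real ^ 'm) \<Rightarrow> ereal"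
    and ub :: "'w \<Rightarrow> real ^ 'm"
  assumes "prob_space M"
    and "finite_filtration M T F"
    and "\<forall>i. stage i \<le> T"
    and "convex_normal_integrand M f"
    and "random_variable_space M X" and "random_variable_space M V"
    and "random_variable_space M U" and "random_variable_space M Y"
    and "separating_duality M X V" and "separating_duality M U Y"
    and "strong_topology M X V TX" and "strong_topology M U Y TU"
    and "\<forall>t\<le>T. \<forall>x\<in>X. cond_exp_vec M (F t) x \<in> X"
    and "ub \<in> U"
    and "subspace (pos ((\<lambda>c. c - (0, ub)) ` dom_value_function M F stage X U f))"
    and "closedin (prod_topology TX TU)
           (pos ((\<lambda>c. c - (0, ub)) ` dom_value_function M F stage X U f))"
    and "subspace (pos ((\<lambda>u. u - ub) ` (snd ` dom_Ef M f X U)))"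
    and "closedin TU (pos ((\<lambda>u. u - ub) ` (snd ` dom_Ef M f X U)))"
    and "\<forall>t\<le>T. \<forall>z\<in>X. (z, ub) \<in> dom_Ef M f X U \<longrightarrow>
           (\<exists>zb\<in>X. (zb, ub) \<in> dom_Ef M f X U \<and>
              (\<forall>i. stage i \<le> t \<longrightarrow> (AE \<omega> in M. zb \<omega> $ i = cond_exp_vec M (F t) z \<omega> $ i)))"
  shows "inf_SP M F stage f ub = inf_SPX M F stage X f ub \<and>
    inf_SPX M F stage X f ub = sup_D M F stage X V Y f ub \<and>
    (\<exists>p\<in>adapted_perp M F stage X V. \<exists>y\<in>Y.
       dual_objective M f ub p y = sup_D M F stage X V Y f ub) \<and>
    (\<forall>x. primal_feasible M F stage f ub x \<longrightarrow>
       (solves_SP M F stage f ub x \<and> inf_SP M F stage f ub \<noteq> - \<infinity> \<longleftrightarrow>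
        (\<exists>p y. dual_feasible M F stage X V Y f p y \<and>
           (AE \<omega> in M. (p \<omega>, y \<omega>) \<in> subdifferential (f \<omega>) (x \<omega>, ub \<omega>)))))"
proof -
  obtain \<rho> where \<rho>: "random_frechet_space M X \<rho> V" "TX = complete_seminorms.seminorm_topology X \<rho>"
    by (rule random_frechet_spaceI[OF assms(1,5,6,9,11)])
  obtain \<sigma> where \<sigma>: "random_frechet_space M U \<sigma> Y" "TU = complete_seminorms.seminorm_topology U \<sigma>"
    by (rule random_frechet_spaceI[OF assms(1,7,8,10,12)])
  interpret stochastic_program M X V \<rho> U Y \<sigma> T F stage f ub
    unfolding stochastic_program_def stochastic_program_axioms_def using \<rho>(1) \<sigma>(1) assms by simp
  obtain p y where py: "p \<in> adapted_perp M F stage X V" "y \<in> Y"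
    "inf_SPX M F stage X f ub \<le> dual_objective M f ub p y"
  proof (rule dual_attainment)
    show "closedin (prod_topology X.seminorm_topology U.seminorm_topology)
        (pos ((\<lambda>c. c - (0, ub)) ` dom_value_function M F stage X U f))"
      using assms(16) unfolding \<rho>(2) \<sigma>(2) .
    show "closedin U.seminorm_topology (pos ((\<lambda>u. u - ub) ` (snd ` dom_Ef M f X U)))"
      using assms(18) unfolding \<sigma>(2) .
  qed (use assms(15,17,19) in blast)+
  note le_sup = dual_objective_le_sup_D[OF py(1,2)]
  note sup_le = order_trans[OF sup_D_le_inf_SP inf_SP_le_inf_SPX]
  \<comment> \<open>Everything lies on one cycle: \<open>sup_D\<close>, then \<open>inf_SP\<close>,
    then \<open>inf_SPX\<close>, then the dual objective at \<open>(p, y)\<close>, and back to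
    \<open>sup_D\<close>, each at most the next.\<close>
  have eq: "dual_objective M f ub p y = sup_D M F stage X V Y f ub"
    "inf_SPX M F stage X f ub = sup_D M F stage X V Y f ub"
    by (rule antisym[OF le_sup order_trans[OF sup_le py(3)]],
        rule antisym[OF order_trans[OF py(3) le_sup] sup_le])
  have opt: "inf_SP M F stage f ub \<le> dual_objective M f ub p y"
    using inf_SP_le_inf_SPX py(3) by (rule order_trans)
  have inf_eq: "inf_SP M F stage f ub = inf_SPX M F stage X f ub"
    by (rule antisym[OF inf_SP_le_inf_SPX]) (use sup_D_le_inf_SP eq(2) in simp)
  have "solves_SP M F stage f ub x \<and> inf_SP M F stage f ub \<noteq> - \<infinity> \<longleftrightarrow>
      (\<exists>p y. dual_feasible M F stage X V Y f p y \<and>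
        (AE \<omega> in M. (p \<omega>, y \<omega>) \<in> subdifferential (f \<omega>) (x \<omega>, ub \<omega>)))"
    if x: "primal_feasible M F stage f ub x" for x
    using optimality_conditions[OF py(1,2) opt x] optimality_sufficient[OF x] unfolding solves_SP_def by blast
  with eq inf_eq py(1,2) show ?thesis by blast
qed

end
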